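(* Let $c_0, c_1>0$ with $c_0\neq c_1$, let $H$ be the Heaviside function and $c(t)=c_0+(c_1-c_0)H(t-1)$ for $t\in\mathbb{R}$. Let $\varphi$ be an admissible mollifier (see context). Let $h:(0,1]\to(0,\infty)$ satisfy $h(\varepsilon)\to 0$ as $\varepsilon\downarrow 0$ and $1/h(\varepsilon)=O(\varepsilon^{-N})$ as $\varepsilon\downarrow0$ for some $N\ge 0$, and let $C$ be the class of $(c*\varphi_{h(\varepsilon)})_{\varepsilon\in(0,1]}$, viewed as an element of $\mathcal{G}(\mathbb{R})$ in the variable $t$ and also as an element of $\mathcal{G}([0,\infty)\times\mathbb{R})$ independent of $x$. Let $U_0=0$ and let $U_1\in\mathcal{G}(\mathbb{R})$ be the class of $(\varphi_\varepsilon)_{\varepsilon\in(0,1]}$. Let $U\in\mathcal{G}([0,\infty)\times\mathbb{R})$ be the (unique) solution of $$\partial_t^2U - C^2\partial_x^2U = 0 \ \text{ in } \mathcal{G}([0,\infty)\times\mathbb{R}),\qquad U|_{t = 0} = U_0,\quad \partial_tU|_{t = 0} = U_1 \ \text{ in } \mathcal{G}(\mathbb{R}).$$ If $C\in\mathcal{G}^\infty(\mathbb{R})$, then $$\operatorname{sing\,supp}_{\mathcal{G}^\infty} U = \left\{(t,x) \;\Big|\; x = \pm\int_0^t c(s)\,ds,\ t \ge 0\right\}.$$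
   Context: Admissible mollifier: a function $\varphi\in\mathcal{C}^\infty_0(\mathbb{R})$ that is symmetric (even), with $\varphi'\ge 0$ on $[-1,0]$, $\operatorname{supp}\varphi\subset[-1,1]$ and $\int_{\mathbb{R}}\varphi(x)\,dx=1$. Notation: $\varphi_\eta(x)=\eta^{-1}\varphi(x/\eta)$ for $\eta>0$. Colombeau algebra. Let $X$ be a non-empty open subset of $\mathbb{R}^d$, or a (relatively) open subset of $[0,\infty)\times\mathbb{R}$ (in which case $\mathcal{C}^\infty(X)$ denotes functions smooth up to the boundary part contained in $X$, and compact sets $K$ are compact subsets of $X$). Let $\mathcal{E}_M(X)$ be the set of families $(u^\varepsilon)_{\varepsilon\in(0,1]}$ of real-valued functions in $\mathcal{C}^\infty(X)$ such that for every compact $K\subset X$ and every multi-index $\alpha$ there is $p\ge 0$ with $\sup_{K}|\partial^\alpha u^\varepsilon| = O(\varepsilon^{-p})$ as $\varepsilon\downarrow 0$. Let $\mathcal{N}(X)$ be the set of families such that for every compact $K\subset X$, every $\alpha$ and every $q\ge 0$, $\sup_{K}|\partial^\alpha u^\varepsilon| = O(\varepsilon^{q})$ as $\varepsilon\downarrow 0$. Then $\mathcal{G}(X)=\mathcal{E}_M(X)/\mathcal{N}(X)$. Derivatives, products, restrictions to open subsets and the restriction $U|_{t=0}$ are defined on representatives. Regular generalized functions. $\mathcal{G}^\infty(X)$ is the set of elements of $\mathcal{G}(X)$ having a representative $(u^\varepsilon)_\varepsilon$ such that for every compact $K\subset X$ there is $p\ge 0$ such that for all multi-indices $\alpha$,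 $\sup_K|\partial^\alpha u^\varepsilon|=O(\varepsilon^{-p})$ as $\varepsilon\downarrow0$ (with $p$ independent of $\alpha$). The set $\operatorname{sing\,supp}_{\mathcal{G}^\infty}U$ is the complement (in $[0,\infty)\times\mathbb{R}$) of the largest (relatively) open set on which $U$ is $\mathcal{G}^\infty$-regular. Slow scale nets. A net $(r^\varepsilon)_{\varepsilon\in(0,1]}$ is slow scale if $|r^\varepsilon|^p=O(\varepsilon^{-1})$ as $\varepsilon\downarrow0$ for every $p\ge0$. A sufficient condition for $C\in\mathcal{G}^\infty(\mathbb{R})$ is that $(1/h(\varepsilon))_\varepsilon$ is a slow scale net. Under the hypotheses of the claim, the Cauchy problem has exactly one solution $U\in\mathcal{G}([0,\infty)\times\mathbb{R})$. *)

theory Defs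
  imports "HOL-Analysis.Analysis" "HOL-Library.Landau_Symbols"
begin

section \<open>Smooth functions, possibly up to the boundary\<close>

text \<open>
  Functions on \<open>X\<close> are total functions whose values outside \<open>X\<close> are ignored: the derivative
  in direction \<open>b\<close> is taken within \<open>X\<close>, hence one-sided at a boundary point contained in \<open>X\<close>.
  The intended \<open>X\<close> are the open sets and the relatively open subsets of the half plane; there these
  derivatives are uniquely determined.
\<close>

definition partial_on :: "'a::euclidean_space set \<Rightarrow> 'a \<Rightarrow> ('a \<Rightarrow> real) \<Rightarrow> 'a \<Rightarrow> real" where
  "partial_on X b f x =
     vector_derivative (\<lambda>s. f (x + s *\<^sub>R b)) (at 0 within {s. x + s *\<^sub>R b \<in> X})"

text \<open>
  A multi-index is represented by a list of basis vectors, one entry per differentiation; the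
  partial derivatives of a smooth function commute, so all lists with the same multiplicities
  denote the same derivative.
\<close>

fun partials_on :: "'a::euclidean_space set \<Rightarrow> 'a list \<Rightarrow> ('a \<Rightarrow> real) \<Rightarrow> 'a \<Rightarrow> real" where
  "partials_on X [] f = f"
| "partials_on X (b # bs) f = partial_on X b (partials_on X bs f)"

definition smooth_on :: "'a::euclidean_space set \<Rightarrow> ('a \<Rightarrow> real) \<Rightarrow> bool" where
  "smooth_on X f \<longleftrightarrow>
     (\<forall>bs\<in>lists Basis.
        continuous_on X (partials_on X bs f) \<and>
        (\<forall>b\<in>Basis. \<forall>x\<in>X.
           (\<lambda>s. partials_on X bs f (x + s *\<^sub>R b)) differentiable
             (at 0 within {s. x + s *\<^sub>R b \<in> X})))"

definition sup_on :: "'a set \<Rightarrow> ('a \<Rightarrow> real) \<Rightarrow> real" where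
  "sup_on K f = (SUP x\<in>K. \<bar>f x\<bar>)"


section \<open>The Colombeau algebra\<close>

type_synonym 'a net = "real \<Rightarrow> 'a \<Rightarrow> real"

text \<open>
  Only the parameters in \<open>{0<..1}\<close> matter. The compact sets are taken to be non-empty because the
  supremum of the empty set of reals is an unspecified number.
\<close>

definition moderate_nets :: "'a::euclidean_space set \<Rightarrow> 'a net set" where
  "moderate_nets X =
     {u. (\<forall>\<epsilon>\<in>{0<..1}. smooth_on X (u \<epsilon>)) \<and>
         (\<forall>K. compact K \<and> K \<subseteq> X \<and> K \<noteq> {} \<longrightarrow>
            (\<forall>bs\<in>lists Basis. \<exists>p\<ge>0.
               (\<lambda>\<epsilon>. sup_on K (partials_on X bs (u \<epsilon>))) \<in> O[at_right 0](\<lambda>\<epsilon>. \<epsilon> powr (- p))))}"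

definition negligible_nets :: "'a::euclidean_space set \<Rightarrow> 'a net set" where
  "negligible_nets X =
     {u. (\<forall>\<epsilon>\<in>{0<..1}. smooth_on X (u \<epsilon>)) \<and>
         (\<forall>K. compact K \<and> K \<subseteq> X \<and> K \<noteq> {} \<longrightarrow>
            (\<forall>bs\<in>lists Basis. \<forall>q\<ge>0.
               (\<lambda>\<epsilon>. sup_on K (partials_on X bs (u \<epsilon>))) \<in> O[at_right 0](\<lambda>\<epsilon>. \<epsilon> powr q)))}"

definition colombeau_rel :: "'a::euclidean_space set \<Rightarrow> ('a net \<times> 'a net) set" where
  "colombeau_rel X =
     {(u, v). u \<in> moderate_nets X \<and> v \<in> moderate_nets X \<and>
              (\<lambda>\<epsilon> x. u \<epsilon> x - v \<epsilon> x) \<in> negligible_nets X}"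

definition colombeau :: "'a::euclidean_space set \<Rightarrow> 'a net set set" where
  "colombeau X = moderate_nets X // colombeau_rel X"

definition colombeau_class :: "'a::euclidean_space set \<Rightarrow> 'a net \<Rightarrow> 'a net set" where
  "colombeau_class X u = colombeau_rel X `` {u}"

text \<open>
  Operations on representatives. The unions range over all representatives of the arguments;
  all of them yield the same class.
\<close>

definition g_zero :: "'a::euclidean_space set \<Rightarrow> 'a net set" where
  "g_zero X = colombeau_class X (\<lambda>\<epsilon> x. 0)"

definition g_minus :: "'a::euclidean_space set \<Rightarrow> 'a net set \<Rightarrow> 'a net set \<Rightarrow> 'a net set" where
  "g_minus X U V = (\<Union>u\<in>U. \<Union>v\<in>V. colombeau_class X (\<lambda>\<epsilon> x. u \<epsilon> x - v \<epsilon> x))"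

definition g_times :: "'a::euclidean_space set \<Rightarrow> 'a net set \<Rightarrow> 'a net set \<Rightarrow> 'a net set" where
  "g_times X U V = (\<Union>u\<in>U. \<Union>v\<in>V. colombeau_class X (\<lambda>\<epsilon> x. u \<epsilon> x * v \<epsilon> x))"

definition g_partial :: "'a::euclidean_space set \<Rightarrow> 'a \<Rightarrow> 'a net set \<Rightarrow> 'a net set" where
  "g_partial X b U = (\<Union>u\<in>U. colombeau_class X (\<lambda>\<epsilon>. partial_on X b (u \<epsilon>)))"

text \<open>Pullback along a smooth map \<open>g\<close> from \<open>Y\<close> into the domain of \<open>U\<close>.\<close>

definition g_pullback ::
    "'b::euclidean_space set \<Rightarrow> ('b \<Rightarrow> 'a::euclidean_space) \<Rightarrow> 'a net set \<Rightarrow> 'b net set" where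
  "g_pullback Y g U = (\<Union>u\<in>U. colombeau_class Y (\<lambda>\<epsilon> y. u \<epsilon> (g y)))"

definition g_restrict :: "'a::euclidean_space set \<Rightarrow> 'a net set \<Rightarrow> 'a net set" where
  "g_restrict Y U = g_pullback Y (\<lambda>y. y) U"


section \<open>Regular generalized functions\<close>

definition colombeau_regular :: "'a::euclidean_space set \<Rightarrow> 'a net set set" where
  "colombeau_regular X =
     {U \<in> colombeau X. \<exists>u\<in>U.
        \<forall>K. compact K \<and> K \<subseteq> X \<and> K \<noteq> {} \<longrightarrow>
          (\<exists>p\<ge>0. \<forall>bs\<in>lists Basis.
             (\<lambda>\<epsilon>. sup_on K (partials_on X bs (u \<epsilon>))) \<in> O[at_right 0](\<lambda>\<epsilon>. \<epsilon> powr (- p)))}"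

text \<open>Points of the half plane are pairs \<open>(t, x)\<close>.\<close>

definition half_plane :: "(real \<times> real) set" where
  "half_plane = {0..} \<times> UNIV"

text \<open>
  The greatest set exists: by compactness, regularity passes to unions of relatively open sets.
\<close>

definition sing_supp :: "(real \<times> real) net set \<Rightarrow> (real \<times> real) set" where
  "sing_supp U =
     half_plane - (GREATEST \<Omega>. openin (top_of_set half_plane) \<Omega> \<and>
                               g_restrict \<Omega> U \<in> colombeau_regular \<Omega>)"


section \<open>The wave equation with a jump in the propagation speed\<close>

definition admissible_mollifier :: "(real \<Rightarrow> real) \<Rightarrow> bool" where
  "admissible_mollifier \<phi> \<longleftrightarrow>
     smooth_on UNIV \<phi> \<and> (\<forall>x. \<phi> (- x) = \<phi> x) \<and> (\<forall>x\<in>{-1..0}. deriv \<phi> x \<ge> 0) \<and>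
     closure {x. \<phi> x \<noteq> 0} \<subseteq> {-1..1} \<and> (LINT x|lborel. \<phi> x) = 1"

definition scaled :: "(real \<Rightarrow> real) \<Rightarrow> real \<Rightarrow> real \<Rightarrow> real" where
  "scaled \<phi> \<eta> x = \<phi> (x / \<eta>) / \<eta>"

definition convolve :: "(real \<Rightarrow> real) \<Rightarrow> (real \<Rightarrow> real) \<Rightarrow> real \<Rightarrow> real" where
  "convolve f g t = (LINT s|lborel. f (t - s) * g s)"

definition heaviside :: "real \<Rightarrow> real" where
  "heaviside t = (if t \<ge> 0 then 1 else 0)"

definition jump_speed :: "real \<Rightarrow> real \<Rightarrow> real \<Rightarrow> real" where
  "jump_speed c0 c1 t = c0 + (c1 - c0) * heaviside (t - 1)"

definition wave_solution ::
    "(real \<times> real) net set \<Rightarrow> real net set \<Rightarrow> real net set \<Rightarrow> (real \<times> real) net set \<Rightarrow> bool" where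
  "wave_solution C U0 U1 U \<longleftrightarrow>
     U \<in> colombeau half_plane \<and>
     g_minus half_plane
       (g_partial half_plane (1, 0) (g_partial half_plane (1, 0) U))
       (g_times half_plane (g_times half_plane C C)
          (g_partial half_plane (0, 1) (g_partial half_plane (0, 1) U))) = g_zero half_plane \<and>
     g_pullback UNIV (\<lambda>x. (0, x)) U = U0 \<and>
     g_pullback UNIV (\<lambda>x. (0, x)) (g_partial half_plane (1, 0) U) = U1"

end

theory Submission
  imports Defs
begin

text \<open>
  With \<open>T = (1/c) \<partial>\<^sub>t\<close> and \<open>X = \<partial>\<^sub>x\<close> the operators \<open>P\<^sub>r = T + r X\<close>, \<open>r = 1, -1\<close>, commute, and the wave
  equation reads \<open>P\<^sub>r P\<^bsub>-r\<^esub> u = - b (P\<^sub>r u + P\<^bsub>-r\<^esub> u)\<close> up to a negligible net, with \<open>b = c' / (2 c\<^sup>2)\<close>.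
  Since \<open>C\<close> is regular, \<open>1 / h\<close> is a slow scale net, so \<open>c\<close>, \<open>1 / c\<close>, \<open>b\<close> and all their derivatives are
  slow scale coefficients, which do not change growth exponents. Applying powers of \<open>P\<^bsub>-r\<^esub>\<close> to the equation
  turns it into transport equations for the powers \<open>P\<^bsub>-r\<^esub>\<^sup>k u\<close> along the characteristics of \<open>P\<^sub>r\<close>, with
  sources that involve only lower powers. Hence a growth exponent common to all powers travels along each
  characteristic in both directions. Away from the curve \<open>x = r \<integral> c\<close> it comes from the vanishing
  initial data, and both families of powers together give regularity off both curves. Regularity near
  a point of that curve would travel back to \<open>t = 0\<close> and bound all derivatives of the initial velocity
  \<open>\<phi>\<^sub>\<epsilon>\<close> by one power of \<open>\<epsilon>\<close>, but the \<open>k\<close>-th one has size \<open>\<epsilon>\<^bsup>-k-1\<^esup>\<close>.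
\<close>

section \<open>Calculus of partial derivatives within a set\<close>

text \<open>The two families of powers are decoupled. In the transport equation for
  \<open>(P (- r) ^^ Suc k) u\<close> along the characteristics of \<open>P r\<close>, the other
  factor occurs only as \<open>P r u\<close>, never as a higher power. So a region off the curve of
  sign \<open>r\<close> may cross the opposite curve: only \<open>u\<close> and \<open>P r u\<close>
  must be bounded there beforehand, and moderateness gives these few nets one exponent. No new
  exponent enters as \<open>k\<close> grows. The factor \<open>1 / c\<close> in \<open>T\<close>
  makes \<open>P r\<close> and \<open>P (- r)\<close> commute exactly, so commutators leave no
  second order terms. The zero order coefficient \<open>b\<close> can still have size
  \<open>1 / h\<close>, and slow scale alone would not control the exponential in a Gronwall
  estimate. The weight \<open>sqrt c\<close> removes \<open>b\<close> and leaves constants that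
  depend only on the bounds of the speed. Bounds on powers of \<open>P (- r)\<close> are turned into
  bounds on the velocity only on the initial line, where the vanishing initial value makes
  \<open>P r u\<close> and \<open>P (- r) u\<close> agree up to negligible terms.\<close>

definition direction_limits :: "'a::euclidean_space set \<Rightarrow> bool" where
  "direction_limits X \<longleftrightarrow> (\<forall>x\<in>X. \<forall>b\<in>Basis. at 0 within {s. x + s *\<^sub>R b \<in> X} \<noteq> bot)"

definition partial_exists :: "'a::euclidean_space set \<Rightarrow> ('a \<Rightarrow> real) \<Rightarrow> bool" where
  "partial_exists X f \<longleftrightarrow>
     (\<forall>b\<in>Basis. \<forall>x\<in>X. (\<lambda>s. f (x + s *\<^sub>R b)) differentiable (at 0 within {s. x + s *\<^sub>R b \<in> X}))"

lemma partial_exists_has_vector_derivative: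
  assumes "partial_exists X f" "b \<in> Basis" "x \<in> X"
  shows "((\<lambda>s. f (x + s *\<^sub>R b)) has_vector_derivative partial_on X b f x)
           (at 0 within {s. x + s *\<^sub>R b \<in> X})"
  using assms by (auto simp: partial_exists_def partial_on_def vector_derivative_works)

text \<open>\<open>vector_derivative\<close> picks some derivative. By
  \<open>direction_limits\<close> the admissible parameters accumulate at 0, so one-sided
  derivatives are unique and the pick can be evaluated.\<close>

lemma partial_on_eqI:
  assumes "direction_limits X" "b \<in> Basis" "x \<in> X"
    and "((\<lambda>s. f (x + s *\<^sub>R b)) has_vector_derivative d) (at 0 within {s. x + s *\<^sub>R b \<in> X})"
  shows "partial_on X b f x = d"
  unfolding partial_on_def
  using assms by (intro vector_derivative_within) (auto simp: direction_limits_def)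

text \<open>Difference quotients at a point of \<open>X\<close> only see values on \<open>X\<close>.
  The defining predicates of the two choices are compared, so this also covers functions without a
  derivative.\<close>

lemma partial_on_cong:
  assumes "\<And>y. y \<in> X \<Longrightarrow> f y = g y" "x \<in> X"
  shows "partial_on X b f x = partial_on X b g x"
proof -
  have "((\<lambda>s. f (x + s *\<^sub>R b)) has_vector_derivative d) (at 0 within {s. x + s *\<^sub>R b \<in> X}) \<longleftrightarrow>
        ((\<lambda>s. g (x + s *\<^sub>R b)) has_vector_derivative d) (at 0 within {s. x + s *\<^sub>R b \<in> X})" for d
    using assms
    by (intro iffI; (elim has_vector_derivative_transform[rotated 2])) auto
  then show ?thesis unfolding partial_on_def vector_derivative_def by simp
qed

lemma partial_exists_cong:
  assumes "\<And>y. y \<in> X \<Longrightarrow> f y = g y"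
  shows "partial_exists X f \<longleftrightarrow> partial_exists X g"
proof -
  have "partial_exists X g" if "partial_exists X f" "\<And>y. y \<in> X \<Longrightarrow> f y = g y" for f g
    unfolding partial_exists_def
  proof (intro ballI)
    fix b x :: 'a assume b: "b \<in> Basis" "x \<in> X"
    have "((\<lambda>s. g (x + s *\<^sub>R b)) has_vector_derivative partial_on X b f x)
           (at 0 within {s. x + s *\<^sub>R b \<in> X})"
      using partial_exists_has_vector_derivative[OF that(1) b] 
      by (rule has_vector_derivative_transform[rotated 2]) (use b that(2) in auto)
    then show "(\<lambda>s. g (x + s *\<^sub>R b)) differentiable (at 0 within {s. x + s *\<^sub>R b \<in> X})"
      by (auto simp: has_vector_derivative_def differentiable_def)
  qed
  from this[of f g] this[of g f] show ?thesis using assms by auto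
qed

lemma partials_on_cong:
  assumes "\<And>y. y \<in> X \<Longrightarrow> f y = g y" "x \<in> X"
  shows "partials_on X bs f x = partials_on X bs g x"
  using assms(2)
proof (induction bs arbitrary: x rule: list.induct)
  case (Cons b bs)
  then show ?case by (auto intro!: partial_on_cong)
qed (use assms in auto)

lemma partials_on_append: "partials_on X (as @ bs) f = partials_on X as (partials_on X bs f)"
  by (induction as) auto

lemma smooth_on_alt:
  "smooth_on X f \<longleftrightarrow> 
    (\<forall>bs\<in>lists Basis. continuous_on X (partials_on X bs f) \<and> partial_exists X (partials_on X bs f))"
  unfolding smooth_on_def partial_exists_def by simp

lemma smooth_on_partials:
  assumes "smooth_on X f" "bs \<in> lists Basis"
  shows "smooth_on X (partials_on X bs f)"
  using assms unfolding smooth_on_alt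
  by (metis append_in_lists_conv partials_on_append)

lemma smooth_on_partial:
  assumes "smooth_on X f" "b \<in> Basis"
  shows "smooth_on X (partial_on X b f)"
  using smooth_on_partials[OF assms(1), of "[b]"] assms(2) by simp

lemma smooth_on_continuous: "smooth_on X f \<Longrightarrow> continuous_on X f"
  unfolding smooth_on_alt by (metis lists.Nil partials_on.simps(1))

lemma smooth_on_partial_exists: "smooth_on X f \<Longrightarrow> partial_exists X f"
  unfolding smooth_on_alt by (metis lists.Nil partials_on.simps(1))

lemma smooth_on_cong:
  assumes "\<And>y. y \<in> X \<Longrightarrow> f y = g y"
  shows "smooth_on X f \<longleftrightarrow> smooth_on X g"
proof -
  have "continuous_on X (partials_on X bs f) \<longleftrightarrow> continuous_on X (partials_on X bs g)"
       "partial_exists X (partials_on X bs f) \<longleftrightarrow> partial_exists X (partials_on X bs g)" for bs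
    by (intro continuous_on_cong partial_exists_cong partials_on_cong assms; simp)+
  then show ?thesis unfolding smooth_on_alt by simp
qed

section \<open>Smoothness as regularity of every finite order\<close>

primrec ck_on :: "nat \<Rightarrow> 'a::euclidean_space set \<Rightarrow> ('a \<Rightarrow> real) \<Rightarrow> bool" where
  "ck_on 0 X f \<longleftrightarrow> continuous_on X f"
| "ck_on (Suc n) X f \<longleftrightarrow>
     continuous_on X f \<and> partial_exists X f \<and> (\<forall>b\<in>Basis. ck_on n X (partial_on X b f))"

text \<open>\<open>ck_on\<close> peels off the derivative applied first, which is the last list
  entry; hence the induction from the right. The order exceeds the length by one because one further
  derivative has to exist.\<close>

lemma ck_on_partials:
  "ck_on (Suc (length bs)) X f \<Longrightarrow> bs \<in> lists Basis \<Longrightarrow>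
    continuous_on X (partials_on X bs f) \<and> partial_exists X (partials_on X bs f)"
proof (induction bs arbitrary: f rule: rev_induct)
  case (snoc b bs)
  then show ?case by (simp add: partials_on_append)
qed simp

lemma smooth_on_iff_ck: "smooth_on X f \<longleftrightarrow> (\<forall>n. ck_on n X f)"
proof
  assume "smooth_on X f"
  have "ck_on n X f" if "smooth_on X f" for n f
    using that
    by (induction n arbitrary: f)
       (auto simp: smooth_on_continuous smooth_on_partial_exists smooth_on_partial)
  then show "\<forall>n. ck_on n X f" using \<open>smooth_on X f\<close> by blast
next
  assume "\<forall>n. ck_on n X f"
  then show "smooth_on X f" unfolding smooth_on_alt using ck_on_partials by blast
qed

lemma ck_on_cong:
  assumes "\<And>y. y \<in> X \<Longrightarrow> f y = g y"
  shows "ck_on n X f \<longleftrightarrow> ck_on n X g"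
  using assms
proof (induction n arbitrary: f g)
  case 0
  then show ?case by (auto intro: continuous_on_cong)
next
  case (Suc n)
  have "ck_on n X (partial_on X b f) \<longleftrightarrow> ck_on n X (partial_on X b g)" for b
    by (rule Suc.IH) (auto intro: partial_on_cong Suc.prems)
  then show ?case
    using partial_exists_cong[of X f g] continuous_on_cong[of X X f g] Suc.prems by simp
qed

lemma ck_on_Suc: "ck_on (Suc n) X f \<Longrightarrow> ck_on n X f"
  by (induction n arbitrary: f) auto

lemma partial_existsI:
  assumes "\<And>b x. b \<in> Basis \<Longrightarrow> x \<in> X \<Longrightarrow>
     ((\<lambda>s. f (x + s *\<^sub>R b)) has_vector_derivative d b x) (at 0 within {s. x + s *\<^sub>R b \<in> X})"
  shows "partial_exists X f"
  using assms by (fastforce simp: partial_exists_def differentiable_def has_vector_derivative_def)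

lemma partial_on_const:
  assumes "direction_limits X" "b \<in> Basis" "x \<in> X"
  shows "partial_on X b (\<lambda>x. r) x = 0"
  by (rule partial_on_eqI[OF assms]) auto

lemma partial_on_add:
  assumes "direction_limits X" "b \<in> Basis" "x \<in> X" "partial_exists X f" "partial_exists X g"
  shows "partial_on X b (\<lambda>x. f x + g x) x = partial_on X b f x + partial_on X b g x"
  by (rule partial_on_eqI[OF assms(1-3)])
     (intro has_vector_derivative_add partial_exists_has_vector_derivative assms)

lemma partial_on_diff:
  assumes "direction_limits X" "b \<in> Basis" "x \<in> X" "partial_exists X f" "partial_exists X g"
  shows "partial_on X b (\<lambda>x. f x - g x) x = partial_on X b f x - partial_on X b g x"
  by (rule partial_on_eqI[OF assms(1-3)])
     (intro has_vector_derivative_diff partial_exists_has_vector_derivative assms)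

lemma partial_on_mult:
  assumes "direction_limits X" "b \<in> Basis" "x \<in> X" "partial_exists X f" "partial_exists X g"
  shows "partial_on X b (\<lambda>x. f x * g x) x = partial_on X b f x * g x + f x * partial_on X b g x"
  using has_vector_derivative_mult[OF partial_exists_has_vector_derivative[OF assms(4,2,3)]
      partial_exists_has_vector_derivative[OF assms(5,2,3)]]
  by (intro partial_on_eqI[OF assms(1-3)]) (simp add: algebra_simps)

lemma partial_exists_const: "partial_exists X (\<lambda>x. r)"
  by (auto simp: partial_exists_def)

lemma partial_exists_add:
  "partial_exists X f \<Longrightarrow> partial_exists X g \<Longrightarrow> partial_exists X (\<lambda>x. f x + g x)"
  by (auto simp: partial_exists_def)

lemma partial_exists_mult:
  "partial_exists X f \<Longrightarrow> partial_exists X g \<Longrightarrow> partial_exists X (\<lambda>x. f x * g x)"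
  by (auto simp: partial_exists_def)

lemma ck_on_const: "direction_limits X \<Longrightarrow> ck_on n X (\<lambda>x. r)"
proof (induction n arbitrary: r)
  case (Suc n)
  have "ck_on n X (partial_on X b (\<lambda>x. r))" if "b \<in> Basis" for b
    using ck_on_cong[of X "partial_on X b (\<lambda>x. r)" "\<lambda>x. 0"] partial_on_const Suc that by blast
  then show ?case by (auto simp: partial_exists_const)
qed simp

lemma ck_on_add:
  "direction_limits X \<Longrightarrow> ck_on n X f \<Longrightarrow> ck_on n X g \<Longrightarrow> ck_on n X (\<lambda>x. f x + g x)"
proof (induction n arbitrary: f g)
  case 0
  then show ?case by (auto intro: continuous_intros)
next
  case (Suc n)
  have "ck_on n X (partial_on X b (\<lambda>x. f x + g x))" if "b \<in> Basis" for b
    using ck_on_cong[of X "partial_on X b (\<lambda>x. f x + g x)"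
        "\<lambda>x. partial_on X b f x + partial_on X b g x"] Suc that
    by (auto simp: partial_on_add)
  then show ?case using Suc.prems by (auto intro: continuous_intros partial_exists_add)
qed

text \<open>The order by order form pays off here: the derivative of a product is a sum of products
  of functions of one order less.\<close>

lemma ck_on_mult:
  "direction_limits X \<Longrightarrow> ck_on n X f \<Longrightarrow> ck_on n X g \<Longrightarrow> ck_on n X (\<lambda>x. f x * g x)"
proof (induction n arbitrary: f g)
  case 0
  then show ?case by (auto intro: continuous_intros)
next
  case (Suc n)
  have "ck_on n X (partial_on X b (\<lambda>x. f x * g x))" if b: "b \<in> Basis" for b
  proof -
    have "ck_on n X (\<lambda>x. partial_on X b f x * g x + f x * partial_on X b g x)"
      using Suc.prems(1) ck_on_Suc[OF Suc.prems(2)] ck_on_Suc[OF Suc.prems(3)] Suc.prems(2,3) b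
      by (intro ck_on_add Suc.IH) simp_all
    then show ?thesis
      using ck_on_cong[of X "partial_on X b (\<lambda>x. f x * g x)"] Suc.prems b
      by (auto simp: partial_on_mult)
  qed
  then show ?case using Suc.prems by (auto intro: continuous_intros partial_exists_mult)
qed

lemma smooth_on_const: "direction_limits X \<Longrightarrow> smooth_on X (\<lambda>x. r)"
  and smooth_on_add:
    "direction_limits X \<Longrightarrow> smooth_on X f \<Longrightarrow> smooth_on X g \<Longrightarrow> smooth_on X (\<lambda>x. f x + g x)"
  and smooth_on_mult:
    "direction_limits X \<Longrightarrow> smooth_on X f \<Longrightarrow> smooth_on X g \<Longrightarrow> smooth_on X (\<lambda>x. f x * g x)"
  by (auto simp: smooth_on_iff_ck ck_on_const ck_on_add ck_on_mult)

lemma smooth_on_diff: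
  "direction_limits X \<Longrightarrow> smooth_on X f \<Longrightarrow> smooth_on X g \<Longrightarrow> smooth_on X (\<lambda>x. f x - g x)"
  using smooth_on_add[of X f "\<lambda>x. (-1) * g x"] smooth_on_mult[of X "\<lambda>x. -1" g]
    smooth_on_const[of X "-1"]
  by simp

lemma partials_on_diff:
  assumes "direction_limits X" "smooth_on X f" "smooth_on X g" "bs \<in> lists Basis" "x \<in> X"
  shows "partials_on X bs (\<lambda>x. f x - g x) x = partials_on X bs f x - partials_on X bs g x"
  using assms(4,5)
proof (induction bs arbitrary: x rule: list.induct)
  case (Cons b bs)
  then have b: "b \<in> Basis" "bs \<in> lists Basis" by auto
  have ex: "partial_exists X (partials_on X bs f)" "partial_exists X (partials_on X bs g)"
    using b(2) assms(2,3) unfolding smooth_on_alt by blast+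
  have "partial_on X b (partials_on X bs (\<lambda>x. f x - g x)) x =
        partial_on X b (\<lambda>x. partials_on X bs f x - partials_on X bs g x) x"
    using Cons by (intro partial_on_cong) auto
  also have "\<dots> = partial_on X b (partials_on X bs f) x - partial_on X b (partials_on X bs g) x"
    by (rule partial_on_diff[OF assms(1) b(1) Cons.prems(2) ex])
  finally show ?case by simp
qed simp

section \<open>Relatively open subsets and the half plane\<close>

lemma at_within_openin:
  assumes "openin (top_of_set X) Y" "x \<in> Y" "norm b = 1"
  shows "at 0 within {s. x + s *\<^sub>R b \<in> Y} = at 0 within {s. x + s *\<^sub>R b \<in> X}"
proof -
  obtain e where e: "e > 0" "ball x e \<inter> X \<subseteq> Y"
    using assms(1,2) by (meson openin_contains_ball)
  have "Y \<subseteq> X" using assms(1) openin_imp_subset by blast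
  show ?thesis
  proof (rule at_within_nhd[of 0 "ball 0 e"])
    have "x + s *\<^sub>R b \<in> ball x e" if "s \<in> ball 0 e" for s
      using that assms(3) by (simp add: dist_norm)
    then show "{s. x + s *\<^sub>R b \<in> Y} \<inter> ball 0 e - {0} = {s. x + s *\<^sub>R b \<in> X} \<inter> ball 0 e - {0}"
      using e \<open>Y \<subseteq> X\<close> by fastforce
  qed (use e in auto)
qed

lemma partial_on_openin:
  assumes "openin (top_of_set X) Y" "x \<in> Y" "b \<in> Basis"
  shows "partial_on Y b f x = partial_on X b f x"
  using at_within_openin[OF assms(1,2)] assms(3) by (simp add: partial_on_def)

lemma direction_limits_openin:
  assumes "openin (top_of_set X) Y" "direction_limits X"
  shows "direction_limits Y"
  using at_within_openin[OF assms(1)] assms openin_imp_subset[OF assms(1)]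
  by (auto simp: direction_limits_def)

lemma partials_on_openin:
  assumes "openin (top_of_set X) Y" "x \<in> Y" "bs \<in> lists Basis"
  shows "partials_on Y bs f x = partials_on X bs f x"
  using assms(2,3)
proof (induction bs arbitrary: x rule: list.induct)
  case (Cons b bs)
  have "partial_on Y b (partials_on Y bs f) x = partial_on Y b (partials_on X bs f) x"
    using Cons by (intro partial_on_cong) auto
  then show ?case using Cons.prems partial_on_openin[OF assms(1), of x b] by simp
qed simp

lemma smooth_on_openin:
  assumes Y: "openin (top_of_set X) Y" and f: "smooth_on X f"
  shows "smooth_on Y f"
  unfolding smooth_on_alt
proof (intro ballI conjI)
  fix bs :: "'a list" assume bs: "bs \<in> lists Basis"
  have sub: "Y \<subseteq> X" using Y openin_imp_subset by blast
  have eq: "partials_on Y bs f x = partials_on X bs f x" if "x \<in> Y" for x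
    using partials_on_openin[OF Y that bs] .
  have "continuous_on Y (partials_on X bs f)"
    using f bs sub by (auto simp: smooth_on_alt intro: continuous_on_subset)
  then show "continuous_on Y (partials_on Y bs f)" using eq continuous_on_cong by force
  have "partial_exists Y (partials_on X bs f)"
    using f bs sub at_within_openin[OF Y] 
    by (fastforce simp: smooth_on_alt partial_exists_def)
  then show "partial_exists Y (partials_on Y bs f)" using eq partial_exists_cong by blast
qed

lemma direction_limits_UNIV: "direction_limits UNIV"
  by (simp add: direction_limits_def)

text \<open>Steps with nonnegative parameter along either basis vector stay in the half plane, even
  from a boundary point.\<close>

lemma direction_limits_half_plane: "direction_limits half_plane"
  unfolding direction_limits_def
proof (intro ballI)
  fix z b :: "real \<times> real" assume z: "z \<in> half_plane" "b \<in> Basis"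
  have "{0..} \<subseteq> {s. z + s *\<^sub>R b \<in> half_plane}"
    using z by (auto simp: half_plane_def Basis_prod_def)
  then have "at_right 0 \<le> at 0 within {s. z + s *\<^sub>R b \<in> half_plane}"
    by (intro at_le) (meson atLeast_iff greaterThan_iff less_imp_le subset_iff)
  then show "at 0 within {s. z + s *\<^sub>R b \<in> half_plane} \<noteq> bot"
    using trivial_limit_at_right_real by (metis bot.extremum_uniqueI)
qed

lemma Basis_real2: "Basis = {(1::real, 0::real), (0, 1)}"
  by (auto simp: Basis_prod_def)

section \<open>Smooth functions on the half plane\<close>

abbreviation "partial_t \<equiv> partial_on half_plane (1, 0)"
abbreviation "partial_x \<equiv> partial_on half_plane (0, 1)"

lemma half_plane_iff: "(t, x) \<in> half_plane \<longleftrightarrow> 0 \<le> t"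
  by (auto simp: half_plane_def)

lemma partial_t_has_derivative:
  assumes "partial_exists half_plane f" "0 \<le> t"
  shows "((\<lambda>t. f (t, x)) has_real_derivative partial_t f (t, x)) (at t within {0..})"
proof -
  have im: "(\<lambda>r. r - t) ` {0..} = {s. (t, x) + s *\<^sub>R (1, 0) \<in> half_plane}"
  proof (intro set_eqI iffI)
    fix s assume "s \<in> {s. (t, x) + s *\<^sub>R (1, 0) \<in> half_plane}"
    then show "s \<in> (\<lambda>r. r - t) ` {0..}"
      by (intro image_eqI[of _ _ "t + s"]) (auto simp: half_plane_iff)
  qed (auto simp: half_plane_iff)
  have "((\<lambda>s. f ((t, x) + s *\<^sub>R (1, 0))) has_vector_derivative partial_t f (t, x))
          (at ((\<lambda>r. r - t) t) within (\<lambda>r. r - t) ` {0..})"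
    using partial_exists_has_vector_derivative[OF assms(1), of "(1, 0)" "(t, x)"] assms(2) im
    by (simp add: Basis_real2 half_plane_iff)
  from vector_diff_chain_within[OF _ this, of 1]
  show ?thesis
    by (simp add: o_def has_real_derivative_iff_has_vector_derivative has_vector_derivative_diff_const)
qed

lemma partial_x_has_derivative:
  assumes "partial_exists half_plane f" "0 \<le> t"
  shows "((\<lambda>x. f (t, x)) has_real_derivative partial_x f (t, x)) (at x)"
proof -
  have "((\<lambda>s. f ((t, x) + s *\<^sub>R (0, 1))) has_vector_derivative partial_x f (t, x))
          (at 0)"
    using partial_exists_has_vector_derivative[OF assms(1), of "(0, 1)" "(t, x)"] assms(2)
    by (simp add: Basis_real2 half_plane_iff)
  then have "((\<lambda>s. f (t, s + x)) has_real_derivative partial_x f (t, x)) (at 0)"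
    by (simp add: has_real_derivative_iff_has_vector_derivative add.commute)
  then show ?thesis using DERIV_shift[of "\<lambda>s. f (t, s)" _ 0 x] by simp
qed

text \<open>On a product set, one partial derivative at the point and continuity of the other one
  give total differentiability. This supplies the chain rule along characteristics, up to their
  starting points on the boundary.\<close>

lemma smooth_on_half_plane_has_derivative:
  assumes "smooth_on half_plane f" "z \<in> half_plane"
  shows "(f has_derivative
           (\<lambda>d. fst d * partial_t f z + snd d * partial_x f z))
         (at z within half_plane)"
proof -
  obtain t x where z: "z = (t, x)" by force
  have t: "0 \<le> t" using assms(2) z by (simp add: half_plane_iff)
  have ex: "partial_exists half_plane f" by (rule smooth_on_partial_exists[OF assms(1)])
  have cont: "continuous_on half_plane (partial_x f)"
    by (intro smooth_on_continuous smooth_on_partial assms) (simp add: Basis_real2)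
  have "((\<lambda>(t, x). f (t, x)) has_derivative
      (\<lambda>(dt, dx). dt * partial_t f (t, x)
        + blinfun_scaleR_left (partial_x f (t, x)) dx)) (at (t, x) within {0..} \<times> UNIV)"
  proof (rule has_derivative_partialsI)
    show "((\<lambda>t. f (t, x)) has_derivative (\<lambda>dt. dt * partial_t f (t, x)))
            (at t within {0..})"
      using partial_t_has_derivative[OF ex t, of x]
      by (simp add: has_field_derivative_def mult.commute[of _ "partial_t f (t, x)"])
    show "((\<lambda>y. f (t, y)) has_derivative
        blinfun_apply (blinfun_scaleR_left (partial_x f (t, y)))) (at y within UNIV)"
      if "t \<in> {0..}" for t y
      using partial_x_has_derivative[OF ex, of t y] that
      by (simp add: has_field_derivative_def mult.commute[of _ "partial_x f (t, y)"])
    have "continuous (at (t, x) within {0..} \<times> UNIV) (partial_x f)"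
      using cont assms(2) z by (simp add: continuous_on_eq_continuous_within half_plane_def)
    then have "continuous (at (t, x) within {0..} \<times> UNIV)
        (\<lambda>p. blinfun_scaleR_left (partial_x f p) :: real \<Rightarrow>\<^sub>L real)"
      by (intro continuous_intros)
    moreover have "(\<lambda>(t, y). blinfun_scaleR_left (partial_x f (t, y))) =
        (\<lambda>p. blinfun_scaleR_left (partial_x f p) :: real \<Rightarrow>\<^sub>L real)"
      by auto
    ultimately show "continuous (at (t, x) within {0..} \<times> UNIV)
        (\<lambda>(t, y). blinfun_scaleR_left (partial_x f (t, y)) :: real \<Rightarrow>\<^sub>L real)"
      by metis
  qed auto
  moreover have "(\<lambda>(t, x). f (t, x)) = f" by auto
  moreover have "(\<lambda>(dt, dx). dt * partial_t f (t, x)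
        + blinfun_apply (blinfun_scaleR_left (partial_x f (t, x))) dx) =
      (\<lambda>d. fst d * partial_t f z + snd d * partial_x f z)"
    by (auto simp: z)
  ultimately show ?thesis unfolding z half_plane_def[symmetric] by simp
qed

text \<open>
  Both mixed derivatives are limits of the same double difference quotient; the squares on which it is
  taken lie to the right of the point, which makes the argument work on the boundary.
\<close>

lemma mixed_partials_eq:
  assumes "smooth_on half_plane f" "z \<in> half_plane"
  shows "partial_t (partial_x f) z =
         partial_x (partial_t f) z" (is "?A z = ?B z")
proof (rule ccontr)
  obtain t x where z: "z = (t, x)" by force
  have t: "0 \<le> t" using assms(2) z by (simp add: half_plane_iff)
  note B = Basis_real2
  have ft: "smooth_on half_plane (partial_t f)"
    and fx: "smooth_on half_plane (partial_x f)"
    by (intro smooth_on_partial assms; simp add: B)+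
  have ex: "partial_exists half_plane f"
    "partial_exists half_plane (partial_t f)"
    "partial_exists half_plane (partial_x f)"
    by (intro smooth_on_partial_exists assms ft fx)+
  have cA: "continuous_on half_plane ?A" and cB: "continuous_on half_plane ?B"
    by (intro smooth_on_continuous smooth_on_partial ft fx; simp add: B)+
  assume neq: "?A z \<noteq> ?B z"
  \<comment> \<open>Two errors below half of the gap cannot bridge it.\<close>
  define e where "e = \<bar>?A z - ?B z\<bar> / 2"
  have e: "e > 0" using neq by (simp add: e_def)
  obtain d1 where d1: "d1 > 0" "\<And>y. y \<in> half_plane \<Longrightarrow> dist y z < d1 \<Longrightarrow> dist (?A y) (?A z) < e"
    using cA assms(2) e unfolding continuous_on_iff by blast
  obtain d2 where d2: "d2 > 0" "\<And>y. y \<in> half_plane \<Longrightarrow> dist y z < d2 \<Longrightarrow> dist (?B y) (?B z) < e"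
    using cB assms(2) e unfolding continuous_on_iff by blast
  \<comment> \<open>Halved because the distance to a point of the square is at most the sum of two
    coordinate differences, each below \<open>k\<close>.\<close>
  define k where "k = min d1 d2 / 2"
  have k: "k > 0" "2 * k \<le> d1" "2 * k \<le> d2" using d1 d2 by (auto simp: k_def)
  have near: "(t', x') \<in> half_plane \<and> dist (t', x') z < 2 * k"
    if "t < t'" "t' < t + k" "x < x'" "x' < x + k" for t' x'
  proof -
    have "dist (t', x') (t, x) \<le> dist t' t + dist x' x"
      unfolding dist_prod_def by (simp add: sqrt_sum_squares_le_sum)
    then show ?thesis using that t z by (auto simp: dist_real_def half_plane_iff)
  qed
  define \<Delta> where "\<Delta> = f (t + k, x + k) - f (t + k, x) - (f (t, x + k) - f (t, x))"
  have dert: "(g has_derivative (*) (g' s)) (at s within {t..t+k})"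
    if "(g has_real_derivative g' s) (at s within {0..})" for g g' :: "real \<Rightarrow> real" and s
    by (rule has_derivative_subset[OF that[unfolded has_field_derivative_def]]) (use t in auto)
  have derx: "(g has_derivative (*) (g' s)) (at s within {x..x+k})"
    if "(g has_real_derivative g' s) (at s)" for g g' :: "real \<Rightarrow> real" and s
    using that unfolding has_field_derivative_def by (rule has_derivative_at_withinI)
  \<comment> \<open>Mean value theorem first in \<open>t\<close>, then in \<open>x\<close>. The
    opposite order further below yields the other mixed derivative from the same double
    difference.\<close>
  have "\<exists>t'\<in>{t<..<t+k}. \<exists>x'\<in>{x<..<x+k}. \<Delta> = k * k * ?B (t', x')"
  proof -
    have "\<exists>s\<in>{t<..<t+k}. (f (t + k, x + k) - f (t + k, x)) - (f (t, x + k) - f (t, x)) =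
       (partial_t f (s, x + k) - partial_t f (s, x)) * (t + k - t)"
      using k t by (intro mvt_simple dert DERIV_diff partial_t_has_derivative ex) auto
    then obtain s where s: "s \<in> {t<..<t+k}" "\<Delta> =
       (partial_t f (s, x + k) - partial_t f (s, x)) * k"
      by (auto simp: \<Delta>_def)
    have "\<exists>y\<in>{x<..<x+k}. partial_t f (s, x + k) - partial_t f (s, x)
        = ?B (s, y) * (x + k - x)"
      using k t s by (intro mvt_simple derx partial_x_has_derivative ex) auto
    then show ?thesis using s by force
  qed
  then obtain t1 x1 where 1: "t1\<in>{t<..<t+k}" "x1\<in>{x<..<x+k}" "\<Delta> = k * k * ?B (t1, x1)" by blast
  have "\<exists>t'\<in>{t<..<t+k}. \<exists>x'\<in>{x<..<x+k}. \<Delta> = k * k * ?A (t', x')"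
  proof -
    have "\<exists>y\<in>{x<..<x+k}. (f (t + k, x + k) - f (t, x + k)) - (f (t + k, x) - f (t, x)) =
       (partial_x f (t + k, y) - partial_x f (t, y)) * (x + k - x)"
      using k t by (intro mvt_simple derx DERIV_diff partial_x_has_derivative ex) auto
    then obtain y where y: "y \<in> {x<..<x+k}" "\<Delta> =
       (partial_x f (t + k, y) - partial_x f (t, y)) * k"
      by (auto simp: \<Delta>_def algebra_simps)
    have "\<exists>s\<in>{t<..<t+k}. partial_x f (t + k, y) - partial_x f (t, y)
        = ?A (s, y) * (t + k - t)"
      using k t y by (intro mvt_simple dert partial_t_has_derivative ex) auto
    then show ?thesis using y by force
  qed
  then obtain t2 x2 where 2: "t2\<in>{t<..<t+k}" "x2\<in>{x<..<x+k}" "\<Delta> = k * k * ?A (t2, x2)" by blast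
  have "?A (t2, x2) = ?B (t1, x1)" using 1(3) 2(3) k by simp
  moreover have "dist (?A (t2, x2)) (?A z) < e" using near[of t2 x2] 2 d1(2) k by auto
  moreover have "dist (?B (t1, x1)) (?B z) < e" using near[of t1 x1] 1 d2(2) k by auto
  ultimately show False unfolding e_def dist_real_def by (simp add: abs_if split: if_splits)
qed

section \<open>Functions of time alone and traces on the initial line\<close>

lemma partial_on_real_has_derivative:
  assumes "partial_exists UNIV a"
  shows "(a has_real_derivative partial_on UNIV 1 a t) (at t)"
proof -
  have "((\<lambda>s. a (t + s *\<^sub>R 1)) has_vector_derivative partial_on UNIV 1 a t) (at 0)"
    using partial_exists_has_vector_derivative[OF assms, of 1 t] by simp
  then have "((\<lambda>s. a (s + t)) has_real_derivative partial_on UNIV 1 a t) (at 0)"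
    by (simp add: has_real_derivative_iff_has_vector_derivative add.commute)
  then show ?thesis using DERIV_shift[of a _ 0 t] by simp
qed

lemma partial_on_realI:
  assumes "(a has_real_derivative d) (at t)"
  shows "partial_on UNIV 1 a t = d"
proof (rule partial_on_eqI)
  have "((\<lambda>s. a (s + t)) has_real_derivative d) (at 0)"
    using assms DERIV_shift[of a _ 0 t] by simp
  then show "((\<lambda>s. a (t + s *\<^sub>R 1)) has_vector_derivative d) (at 0 within {s. t + s *\<^sub>R 1 \<in> UNIV})"
    by (simp add: has_real_derivative_iff_has_vector_derivative add.commute)
qed (auto simp: direction_limits_UNIV)

lemma time_function_partials:
  fixes a :: "real \<Rightarrow> real"
  assumes "partial_exists UNIV a" "z \<in> half_plane"
  shows "((\<lambda>s. a (fst (z + s *\<^sub>R (1, 0)))) has_vector_derivative partial_on UNIV 1 a (fst z))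
           (at 0 within {s. z + s *\<^sub>R (1, 0) \<in> half_plane})"
    and "((\<lambda>s. a (fst (z + s *\<^sub>R (0, 1)))) has_vector_derivative 0)
           (at 0 within {s. z + s *\<^sub>R (0, 1) \<in> half_plane})"
    and "partial_t (\<lambda>z. a (fst z)) z = partial_on UNIV 1 a (fst z)"
    and "partial_x (\<lambda>z. a (fst z)) z = 0"
proof -
  have "((\<lambda>s. a (s + fst z)) has_real_derivative partial_on UNIV 1 a (fst z)) (at 0)"
    using partial_on_real_has_derivative[OF assms(1), of "fst z"] DERIV_shift[of a _ 0 "fst z"] by simp
  then have "((\<lambda>s. a (s + fst z)) has_vector_derivative partial_on UNIV 1 a (fst z)) (at 0 within S)" for S
    by (simp add: has_real_derivative_iff_has_vector_derivative has_vector_derivative_at_within)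
  then show 1: "((\<lambda>s. a (fst (z + s *\<^sub>R (1, 0)))) has_vector_derivative partial_on UNIV 1 a (fst z))
           (at 0 within {s. z + s *\<^sub>R (1, 0) \<in> half_plane})"
    by (simp add: add.commute)
  show 2: "((\<lambda>s. a (fst (z + s *\<^sub>R (0, 1)))) has_vector_derivative 0)
           (at 0 within {s. z + s *\<^sub>R (0, 1) \<in> half_plane})"
    by simp
  show "partial_t (\<lambda>z. a (fst z)) z = partial_on UNIV 1 a (fst z)"
    "partial_x (\<lambda>z. a (fst z)) z = 0"
    using 1 2 assms(2) by (auto intro!: partial_on_eqI direction_limits_half_plane simp: Basis_real2)
qed

lemma smooth_on_time_function:
  fixes a :: "real \<Rightarrow> real"
  assumes "smooth_on UNIV a"
  shows "smooth_on half_plane (\<lambda>z. a (fst z))"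
proof -
  have "ck_on n half_plane (\<lambda>z. a (fst z))" if "smooth_on UNIV a" for n a
    using that
  proof (induction n arbitrary: a)
    case 0
    then have "continuous_on UNIV a" by (rule smooth_on_continuous)
    then show ?case unfolding ck_on.simps by (intro continuous_on_compose2[of UNIV a half_plane fst] continuous_intros) auto
  next
    case (Suc n)
    have cont: "continuous_on half_plane (\<lambda>z. a (fst z))"
      using smooth_on_continuous[OF Suc.prems]
      by (intro continuous_on_compose2[of UNIV a half_plane fst] continuous_intros) auto
    have ex: "partial_exists UNIV a" by (rule smooth_on_partial_exists[OF Suc.prems])
    have "partial_exists half_plane (\<lambda>z. a (fst z))"
    proof (rule partial_existsI)
      fix b z :: "real \<times> real" assume b: "b \<in> Basis" and z: "z \<in> half_plane"
      consider "b = (1, 0)" | "b = (0, 1)" using b by (auto simp: Basis_real2)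
      then show "((\<lambda>s. a (fst (z + s *\<^sub>R b))) has_vector_derivative
          (if b = (1, 0) then partial_on UNIV 1 a (fst z) else 0))
          (at 0 within {s. z + s *\<^sub>R b \<in> half_plane})"
      proof cases
        case 1
        show ?thesis unfolding 1 if_P[OF refl] by (rule time_function_partials(1)[OF ex z])
      next
        case 2
        then have ne: "b \<noteq> (1, 0)" by simp
        show ?thesis unfolding if_not_P[OF ne] unfolding 2 by (rule time_function_partials(2)[OF ex z])
      qed
    qed
    moreover have "ck_on n half_plane (\<lambda>z. partial_on UNIV 1 a (fst z))"
      by (intro Suc.IH smooth_on_partial Suc.prems) simp
    then have "ck_on n half_plane (partial_t (\<lambda>z. a (fst z)))"
      using ck_on_cong[OF time_function_partials(3)[OF ex], of half_plane "\<lambda>z. z" n] by metis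
    moreover have "ck_on n half_plane (partial_x (\<lambda>z. a (fst z)))"
      using ck_on_cong[OF time_function_partials(4)[OF ex], of half_plane "\<lambda>z. z" n]
        ck_on_const[OF direction_limits_half_plane, of n 0] by metis
    ultimately show ?case using cont by (simp add: Basis_real2)
  qed
  then show ?thesis using assms by (simp add: smooth_on_iff_ck)
qed

text \<open>The derivative is minus \<open>a'\<close> times two copies of \<open>1 / a\<close>, so
  order \<open>n\<close> of the reciprocal gives order \<open>Suc n\<close>.\<close>

lemma smooth_on_inverse_real:
  fixes a :: "real \<Rightarrow> real"
  assumes "smooth_on UNIV a" "\<And>t. a t \<noteq> 0"
  shows "smooth_on UNIV (\<lambda>t. 1 / a t)"
proof -
  have "ck_on n UNIV (\<lambda>t. 1 / a t)" for n
  proof (induction n)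
    case 0
    then show ?case using smooth_on_continuous[OF assms(1)] assms(2)
      by (auto intro!: continuous_intros)
  next
    case (Suc n)
    have d: "((\<lambda>t. 1 / a t) has_real_derivative - partial_on UNIV 1 a t * (1 / a t) * (1 / a t)) (at t)" for t
      using partial_on_real_has_derivative[OF smooth_on_partial_exists[OF assms(1)], of t] assms(2)
      by (auto intro!: derivative_eq_intros)
    have "((\<lambda>s. 1 / a (t + s)) has_real_derivative - partial_on UNIV 1 a t * (1 / a t) * (1 / a t)) (at 0)" for t
      using DERIV_shift[of "\<lambda>t. 1 / a t" "- partial_on UNIV 1 a t * (1 / a t) * (1 / a t)" 0 t] d[of t]
      by (simp add: add.commute)
    then have "partial_exists UNIV (\<lambda>t. 1 / a t)"
      by (auto intro!: partial_existsI simp: has_real_derivative_iff_has_vector_derivative)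
    moreover have "ck_on n UNIV (\<lambda>t. -1 * partial_on UNIV 1 a t * (1 / a t) * (1 / a t))"
      using smooth_on_partial[OF assms(1)] smooth_on_iff_ck
      by (intro ck_on_mult ck_on_const direction_limits_UNIV Suc) auto
    then have "ck_on n UNIV (partial_on UNIV 1 (\<lambda>t. 1 / a t))"
      using ck_on_cong[of UNIV "partial_on UNIV 1 (\<lambda>t. 1 / a t)"] partial_on_realI[OF d] by simp
    moreover have "continuous_on UNIV (\<lambda>t. 1 / a t)"
      using smooth_on_continuous[OF assms(1)] assms(2) by (auto intro!: continuous_intros)
    ultimately show ?case by simp
  qed
  then show ?thesis by (simp add: smooth_on_iff_ck)
qed

text \<open>A step in direction \<open>x\<close> never leaves the half plane, so at each order both
  sides are the same choice of a derivative.\<close>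

lemma partials_on_initial_line:
  assumes "bs \<in> lists Basis"
  shows "partials_on UNIV bs (\<lambda>x. f (0, x)) x = partials_on half_plane (map (Pair 0) bs) f (0, x :: real)"
proof -
  have "partial_on UNIV 1 (\<lambda>x. g (0, x)) x = partial_x g (0, x)"
    for g :: "real \<times> real \<Rightarrow> real" and x
    by (simp add: partial_on_def half_plane_def)
  then have "partials_on UNIV bs (\<lambda>x. f (0, x)) = (\<lambda>x. partials_on half_plane (map (Pair 0) bs) f (0, x))"
    using assms
    by (induction bs rule: list.induct) (auto intro!: ext)
  then show ?thesis by metis
qed

lemma smooth_on_initial_line:
  assumes "smooth_on half_plane f"
  shows "smooth_on UNIV (\<lambda>x. f (0, x :: real))"
  unfolding smooth_on_alt
proof (intro ballI)
  fix bs :: "real list" assume bs: "bs \<in> lists Basis"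
  define g where "g = partials_on half_plane (map (Pair 0) bs) f"
  have g: "smooth_on half_plane g"
    using bs unfolding g_def by (intro smooth_on_partials assms) (auto simp: Basis_real2)
  have eq: "partials_on UNIV bs (\<lambda>x. f (0, x)) = (\<lambda>x. g (0, x))"
    using partials_on_initial_line[OF bs] by (auto simp: g_def)
  have "continuous_on UNIV (\<lambda>x. g (0, x))"
    using smooth_on_continuous[OF g]
    by (rule continuous_on_compose2) (auto intro: continuous_intros simp: half_plane_def)
  moreover have "partial_exists UNIV (\<lambda>x. g (0, x))"
    using smooth_on_partial_exists[OF g]
    by (auto simp: partial_exists_def half_plane_def Basis_real2)
  ultimately show "continuous_on UNIV (partials_on UNIV bs (\<lambda>x. f (0, x))) \<and>
        partial_exists UNIV (partials_on UNIV bs (\<lambda>x. f (0, x)))"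
    unfolding eq by blast
qed

section \<open>The differential ring of smooth nets\<close>

text \<open>
  A net is normalised to vanish for parameters outside \<open>{0<..1}\<close> and for points outside the half
  plane, so that the ring and derivation laws hold as equations.
\<close>

definition restrict_net :: "(real \<times> real) net \<Rightarrow> (real \<times> real) net" where
  "restrict_net f = (\<lambda>e z. if e \<in> {0<..1} \<and> z \<in> half_plane then f e z else 0)"

definition smooth_net :: "(real \<times> real) net \<Rightarrow> bool" where
  "smooth_net f \<longleftrightarrow> (\<forall>e\<in>{0<..1}. smooth_on half_plane (f e))"

lemma smooth_net_restrict: "smooth_net (restrict_net f) \<longleftrightarrow> smooth_net f"
  unfolding smooth_net_def restrict_net_def
  by (intro ball_cong refl smooth_on_cong) auto

lemma smooth_net_const: "smooth_net (\<lambda>e z. r)"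
  and smooth_net_add: "smooth_net f \<Longrightarrow> smooth_net g \<Longrightarrow> smooth_net (\<lambda>e z. f e z + g e z)"
  and smooth_net_diff: "smooth_net f \<Longrightarrow> smooth_net g \<Longrightarrow> smooth_net (\<lambda>e z. f e z - g e z)"
  and smooth_net_minus: "smooth_net f \<Longrightarrow> smooth_net (\<lambda>e z. - f e z)"
  and smooth_net_mult: "smooth_net f \<Longrightarrow> smooth_net g \<Longrightarrow> smooth_net (\<lambda>e z. f e z * g e z)"
  and smooth_net_partial:
    "b \<in> Basis \<Longrightarrow> smooth_net f \<Longrightarrow> smooth_net (\<lambda>e. partial_on half_plane b (f e))"
  using smooth_on_diff[OF direction_limits_half_plane smooth_on_const[OF direction_limits_half_plane], of _ 0]
  by (auto simp: smooth_net_def smooth_on_const smooth_on_add smooth_on_diff smooth_on_mult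
      smooth_on_partial direction_limits_half_plane)

declare greaterThanAtMost_iff [simp del]

text \<open>A type instead of a set of nets allows an instance of \<open>comm_ring_1\<close>, so
  operator identities can be left to ring normalisation.\<close>

typedef snet = "{f. smooth_net f \<and> restrict_net f = f}"
  morphisms ev Abs_snet
proof
  show "(\<lambda>e z. 0) \<in> {f. smooth_net f \<and> restrict_net f = f}"
    by (auto simp: smooth_net_const restrict_net_def)
qed

setup_lifting type_definition_snet

lemma restrict_net_idem: "restrict_net (restrict_net f) = restrict_net f"
  by (simp add: restrict_net_def fun_eq_iff)

lemma smooth_net_ev: "smooth_net (ev f)"
  using ev[of f] by auto

lemma smooth_on_ev: "e \<in> {0<..1} \<Longrightarrow> smooth_on half_plane (ev f e)"
  using smooth_net_ev[of f] by (auto simp: smooth_net_def)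

lemma ev_eq_restrict: "ev f = restrict_net (ev f)"
  using ev[of f] by auto

lemma ev_outside: "e \<notin> {0<..1} \<or> z \<notin> half_plane \<Longrightarrow> ev f e z = 0"
  by (subst ev_eq_restrict) (auto simp: restrict_net_def)

lemma snet_eqI:
  assumes "\<And>e z. e \<in> {0<..1} \<Longrightarrow> z \<in> half_plane \<Longrightarrow> ev f e z = ev g e z"
  shows "f = g"
proof -
  have "ev f e z = ev g e z" for e z
    using assms ev_outside[of e z] by (cases "e \<in> {0<..1} \<and> z \<in> half_plane") auto
  then show ?thesis by (simp add: ev_inject[symmetric] fun_eq_iff)
qed

definition snet_of :: "(real \<times> real) net \<Rightarrow> snet" where
  "snet_of f = Abs_snet (restrict_net f)"

lemma ev_snet_of: "smooth_net f \<Longrightarrow> ev (snet_of f) = restrict_net f"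
  unfolding snet_of_def by (simp add: Abs_snet_inverse smooth_net_restrict restrict_net_idem)

lemma ev_snet_of_apply:
  "smooth_net f \<Longrightarrow> e \<in> {0<..1} \<Longrightarrow> z \<in> half_plane \<Longrightarrow> ev (snet_of f) e z = f e z"
  by (simp add: ev_snet_of restrict_net_def)

instantiation snet :: comm_ring_1
begin

definition "0 = snet_of (\<lambda>e z. 0)"
definition "1 = snet_of (\<lambda>e z. 1)"
definition "f + g = snet_of (\<lambda>e z. ev f e z + ev g e z)"
definition "f - g = snet_of (\<lambda>e z. ev f e z - ev g e z)"
definition "- f = snet_of (\<lambda>e z. - ev f e z)"
definition "f * g = snet_of (\<lambda>e z. ev f e z * ev g e z)"

lemma ev_simps_raw:
  assumes "e \<in> {0<..1}" "z \<in> half_plane"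
  shows "ev 0 e z = 0" "ev 1 e z = 1" "ev (f + g) e z = ev f e z + ev g e z"
    "ev (f - g) e z = ev f e z - ev g e z" "ev (- f) e z = - ev f e z"
    "ev (f * g) e z = ev f e z * ev g e z"
  using assms
  by (simp_all add: zero_snet_def one_snet_def plus_snet_def minus_snet_def uminus_snet_def
      times_snet_def ev_snet_of_apply smooth_net_const smooth_net_add smooth_net_diff smooth_net_minus
      smooth_net_mult       smooth_net_ev)

instance
proof
  show "(0::snet) \<noteq> 1"
  proof
    assume "(0::snet) = 1"
    then have "ev 0 1 (0, 0) = ev 1 1 (0, 0)" by simp
    then show False by (simp add: ev_simps_raw half_plane_iff greaterThanAtMost_iff)
  qed
qed (rule snet_eqI; simp add: ev_simps_raw algebra_simps)+

end

lemma ev_zero: "ev 0 e z = 0"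
  by (cases "e \<in> {0<..1} \<and> z \<in> half_plane") (auto simp: ev_simps_raw ev_outside)

lemma ev_add: "ev (f + g) e z = ev f e z + ev g e z"
  and ev_diff: "ev (f - g) e z = ev f e z - ev g e z"
  and ev_minus: "ev (- f) e z = - ev f e z"
  and ev_mult: "ev (f * g) e z = ev f e z * ev g e z"
  by (cases "e \<in> {0<..1} \<and> z \<in> half_plane"; auto simp: ev_simps_raw ev_outside)+

lemmas ev_simps = ev_zero ev_add ev_diff ev_minus ev_mult

definition cst :: "real \<Rightarrow> snet" where
  "cst r = snet_of (\<lambda>e z. r)"

lemma ev_cst: "e \<in> {0<..1} \<Longrightarrow> z \<in> half_plane \<Longrightarrow> ev (cst r) e z = r"
  by (simp add: cst_def ev_snet_of_apply smooth_net_const)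

definition D :: "real \<times> real \<Rightarrow> snet \<Rightarrow> snet" where
  "D b f = snet_of (\<lambda>e. partial_on half_plane b (ev f e))"

lemma ev_D:
  assumes "b \<in> Basis" "e \<in> {0<..1}" "z \<in> half_plane"
  shows "ev (D b f) e z = partial_on half_plane b (ev f e) z"
  using assms by (simp add: D_def ev_snet_of_apply smooth_net_partial smooth_net_ev)

abbreviation "Dt \<equiv> D (1, 0)"
abbreviation "Dx \<equiv> D (0, 1)"

lemma D_snet_of:
  assumes "b \<in> Basis" "smooth_net f"
  shows "D b (snet_of f) = snet_of (\<lambda>e. partial_on half_plane b (f e))"
proof (rule snet_eqI)
  fix e :: real and z :: "real \<times> real" assume *: "e \<in> {0<..1}" "z \<in> half_plane"
  have "partial_on half_plane b (ev (snet_of f) e) z = partial_on half_plane b (f e) z"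
    using * assms by (intro partial_on_cong ev_snet_of_apply)
  then show "ev (D b (snet_of f)) e z = ev (snet_of (\<lambda>e. partial_on half_plane b (f e))) e z"
    by (simp add: ev_D ev_snet_of_apply smooth_net_partial assms *)
qed

lemma ev_fun_eq:
  assumes "e \<in> {0<..1}"
  shows "ev (f + g) e = (\<lambda>z. ev f e z + ev g e z)" "ev (f - g) e = (\<lambda>z. ev f e z - ev g e z)"
    "ev (f * g) e = (\<lambda>z. ev f e z * ev g e z)"
  by (auto simp: ev_simps)

lemma D_add: "b \<in> Basis \<Longrightarrow> D b (f + g) = D b f + D b g"
  by (rule snet_eqI) (simp add: ev_D ev_fun_eq ev_add partial_on_add direction_limits_half_plane
      smooth_on_partial_exists smooth_on_ev)

lemma D_mult: "b \<in> Basis \<Longrightarrow> D b (f * g) = D b f * g + f * D b g"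
  by (rule snet_eqI) (simp add: ev_D ev_fun_eq ev_add ev_mult partial_on_mult direction_limits_half_plane
      smooth_on_partial_exists smooth_on_ev)

lemma D_cst: "b \<in> Basis \<Longrightarrow> D b (cst r) = 0"
  using D_snet_of[of b "\<lambda>e z. r"]
  by (intro snet_eqI)
    (simp add: cst_def smooth_net_const partial_on_const direction_limits_half_plane ev_zero
      ev_snet_of_apply smooth_net_partial)

lemma cst_mult: "cst (r * s) = cst r * cst s"
  and cst_minus: "cst (- r) = - cst r"
  and cst_add: "cst (r + s) = cst r + cst s"
  and cst_one: "cst 1 = 1"
  by (rule snet_eqI; simp add: ev_cst ev_simps_raw)+

lemma D_commute: "Dt (Dx f) = Dx (Dt f)"
proof (rule snet_eqI)
  fix e :: real and z :: "real \<times> real" assume *: "e \<in> {0<..1}" "z \<in> half_plane"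
  have B: "(1, 0) \<in> (Basis :: (real \<times> real) set)" "(0, 1) \<in> (Basis :: (real \<times> real) set)"
    by (auto simp: Basis_real2)
  have "partial_t (ev (Dx f) e) z =
        partial_t (partial_x (ev f e)) z"
    using * B by (intro partial_on_cong ev_D)
  moreover have "partial_x (ev (Dt f) e) z =
        partial_x (partial_t (ev f e)) z"
    using * B by (intro partial_on_cong ev_D)
  ultimately show "ev (Dt (Dx f)) e z = ev (Dx (Dt f)) e z"
    using mixed_partials_eq[OF smooth_on_ev[OF *(1)] *(2)] * B
    by (simp add: ev_D)
qed

abbreviation Ds :: "(real \<times> real) list \<Rightarrow> snet \<Rightarrow> snet" where
  "Ds bs \<equiv> foldr D bs"

lemma ev_Ds:
  assumes "bs \<in> lists Basis" "e \<in> {0<..1}" "z \<in> half_plane"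
  shows "ev (Ds bs f) e z = partials_on half_plane bs (ev f e) z"
  using assms(1,3)
proof (induction bs arbitrary: z rule: list.induct)
  case (Cons b bs)
  have "partial_on half_plane b (ev (Ds bs f) e) z =
        partial_on half_plane b (partials_on half_plane bs (ev f e)) z"
    using Cons by (intro partial_on_cong) auto
  then show ?case using Cons.prems assms by (simp add: ev_D)
qed auto

lemma ev_Ds_snet_of:
  assumes "smooth_net f" "bs \<in> lists Basis" "e \<in> {0<..1}" "z \<in> half_plane"
  shows "ev (Ds bs (snet_of f)) e z = partials_on half_plane bs (f e) z"
proof -
  have "partials_on half_plane bs (ev (snet_of f) e) z = partials_on half_plane bs (f e) z"
    using assms by (intro partials_on_cong ev_snet_of_apply)
  then show ?thesis using ev_Ds[OF assms(2-4)] by simp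
qed

declare greaterThanAtMost_iff [simp]

section \<open>Derivations of a commutative ring\<close>

definition derivation :: "('a::comm_ring_1 \<Rightarrow> 'a) \<Rightarrow> bool" where
  "derivation E \<longleftrightarrow> (\<forall>f g. E (f + g) = E f + E g) \<and> (\<forall>f g. E (f * g) = E f * g + f * E g)"

lemma derivation_add: "derivation E \<Longrightarrow> E (f + g) = E f + E g"
  and derivation_mult: "derivation E \<Longrightarrow> E (f * g) = E f * g + f * E g"
  by (auto simp: derivation_def)

lemma derivation_zero: "derivation E \<Longrightarrow> E 0 = 0"
  using derivation_add[of E 0 0] by simp

lemma derivation_one: "derivation E \<Longrightarrow> E 1 = 0"
  using derivation_mult[of E 1 1] by simp

lemma derivation_minus: "derivation E \<Longrightarrow> E (- f) = - E f"
  using derivation_add[of E f "- f"] derivation_zero[of E] by (simp add: eq_neg_iff_add_eq_0 add.commute)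

lemma derivation_diff: "derivation E \<Longrightarrow> E (f - g) = E f - E g"
  using derivation_add[of E f "- g"] derivation_minus[of E g] by simp

lemma derivation_D: "b \<in> Basis \<Longrightarrow> derivation (D b)"
  by (simp add: derivation_def D_add D_mult)

lemma Ds_add: "bs \<in> lists Basis \<Longrightarrow> Ds bs (f + g) = Ds bs f + Ds bs g"
  by (induction bs rule: list.induct) (auto simp: D_add)

lemma Ds_minus: "bs \<in> lists Basis \<Longrightarrow> Ds bs (- f) = - Ds bs f"
  by (induction bs rule: list.induct) (auto simp: derivation_minus derivation_D)

section \<open>Growth in the regularisation parameter\<close>

text \<open>
  The exponent \<open>p\<close> is only required up to an arbitrarily small loss; this absorbs constants and slow
  scale factors. The domain \<open>A e\<close> may move with the parameter.
\<close>

definition grows :: "(real \<Rightarrow> 'a set) \<Rightarrow> real \<Rightarrow> 'a net \<Rightarrow> bool" where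
  "grows A p f \<longleftrightarrow> (\<forall>q>p. \<forall>\<^sub>F e in at_right 0. \<forall>z\<in>A e. \<bar>f e z\<bar> \<le> e powr (- q))"

lemma growsD:
  "grows A p f \<Longrightarrow> p < q \<Longrightarrow> \<forall>\<^sub>F e in at_right 0. \<forall>z\<in>A e. \<bar>f e z\<bar> \<le> e powr (- q)"
  by (auto simp: grows_def)

lemma eventually_unit: "\<forall>\<^sub>F e in at_right (0::real). e \<in> {0<..1}"
  using eventually_at_right_less[of "0::real"] eventually_at_right_field[of _ "0::real"]
  by (metis (mono_tags, lifting) greaterThanAtMost_iff less_eq_real_def zero_less_one)

text \<open>The quotient of the two sides is \<open>K * e powr (q - p)\<close>, which tends to
  0.\<close>

lemma eventually_powr_absorb:
  fixes p q K :: real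
  assumes "p < q"
  shows "\<forall>\<^sub>F e in at_right 0. K * e powr (- p) \<le> e powr (- q)"
proof -
  have "((\<lambda>e::real. e powr (q - p)) \<longlongrightarrow> 0) (at_right 0)"
    using assms eventually_at_right_less[of "0::real"]
    by (intro tendsto_zero_powrI[where b = "q - p"])
      (auto intro: tendsto_ident_at elim: eventually_mono)
  then have "((\<lambda>e::real. K * e powr (q - p)) \<longlongrightarrow> 0) (at_right 0)"
    by (auto intro: tendsto_mult_right_zero)
  then have "\<forall>\<^sub>F e in at_right 0. K * e powr (q - p) < 1"
    by (rule order_tendstoD) simp
  then show ?thesis using eventually_unit
  proof eventually_elim
    case (elim e)
    have "K * e powr (- p) = (K * e powr (q - p)) * e powr (- q)"
      by (simp add: powr_add[symmetric])
    also have "\<dots> \<le> 1 * e powr (- q)"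
      using elim by (intro mult_right_mono) auto
    finally show ?case by simp
  qed
qed

lemma grows_mono:
  assumes "grows A p f" "p \<le> q" "\<forall>\<^sub>F e in at_right 0. B e \<subseteq> A e"
  shows "grows B q f"
  unfolding grows_def
proof (intro allI impI)
  fix r assume "q < r"
  then have "\<forall>\<^sub>F e in at_right 0. \<forall>z\<in>A e. \<bar>f e z\<bar> \<le> e powr (- r)"
    using assms(2) by (intro growsD[OF assms(1)]) auto
  then show "\<forall>\<^sub>F e in at_right 0. \<forall>z\<in>B e. \<bar>f e z\<bar> \<le> e powr (- r)"
    using assms(3) by eventually_elim auto
qed

lemma grows_cong:
  assumes "grows A p f" "\<forall>\<^sub>F e in at_right 0. \<forall>z\<in>A e. \<bar>g e z\<bar> \<le> \<bar>f e z\<bar>"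
  shows "grows A p g"
  unfolding grows_def
proof (intro allI impI)
  fix r assume "p < r"
  then have "\<forall>\<^sub>F e in at_right 0. \<forall>z\<in>A e. \<bar>f e z\<bar> \<le> e powr (- r)"
    using assms by (intro growsD) auto
  then show "\<forall>\<^sub>F e in at_right 0. \<forall>z\<in>A e. \<bar>g e z\<bar> \<le> e powr (- r)"
    using assms(2) by eventually_elim (use order_trans in blast)
qed

lemma growsI_bound:
  assumes "\<forall>\<^sub>F e in at_right 0. \<forall>z\<in>A e. \<bar>f e z\<bar> \<le> K * e powr (- p)"
  shows "grows A p f"
  unfolding grows_def
proof (intro allI impI)
  fix q assume "p < q"
  show "\<forall>\<^sub>F e in at_right 0. \<forall>z\<in>A e. \<bar>f e z\<bar> \<le> e powr (- q)"
    using assms eventually_powr_absorb[OF \<open>p < q\<close>, of K]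
    by eventually_elim (use order_trans in blast)
qed

text \<open>Allows a preliminary loss: bounds with constants are proved for each
  \<open>q > p\<close>, and the midpoint between \<open>p\<close> and \<open>q\<close> leaves room
  for both losses.\<close>

lemma growsI_limit:
  assumes "\<And>q. q > p \<Longrightarrow> grows A q f"
  shows "grows A p f"
  unfolding grows_def
proof (intro allI impI)
  fix q assume "p < q"
  then show "\<forall>\<^sub>F e in at_right 0. \<forall>z\<in>A e. \<bar>f e z\<bar> \<le> e powr (- q)"
    by (intro growsD[OF assms[of "(p + q) / 2"]]) auto
qed

lemma grows_add:
  assumes "grows A p f" "grows A p g"
  shows "grows A p (\<lambda>e z. f e z + g e z)"
proof (rule growsI_limit)
  fix q assume "p < q"
  show "grows A q (\<lambda>e z. f e z + g e z)"
  proof (rule growsI_bound)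
    show "\<forall>\<^sub>F e in at_right 0. \<forall>z\<in>A e. \<bar>f e z + g e z\<bar> \<le> 2 * e powr (- q)"
      using growsD[OF assms(1) \<open>p < q\<close>] growsD[OF assms(2) \<open>p < q\<close>]
      by eventually_elim fastforce
  qed
qed

lemma grows_mult:
  assumes "grows A p f" "grows A q g"
  shows "grows A (p + q) (\<lambda>e z. f e z * g e z)"
  unfolding grows_def
proof (intro allI impI)
  fix r assume r: "p + q < r"
  define d where "d = (r - p - q) / 2"
  have d: "d > 0" "p + d + (q + d) = r" using r by (auto simp: d_def field_simps)
  have "\<forall>\<^sub>F e in at_right 0. \<forall>z\<in>A e. \<bar>f e z\<bar> \<le> e powr (- (p + d))"
    using d by (intro growsD[OF assms(1)]) auto
  moreover have "\<forall>\<^sub>F e in at_right 0. \<forall>z\<in>A e. \<bar>g e z\<bar> \<le> e powr (- (q + d))"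
    using d by (intro growsD[OF assms(2)]) auto
  ultimately show "\<forall>\<^sub>F e in at_right 0. \<forall>z\<in>A e. \<bar>f e z * g e z\<bar> \<le> e powr (- r)"
  proof eventually_elim
    case (elim e)
    have "e powr (- r) = e powr (- (p + d)) * e powr (- (q + d))"
      unfolding powr_add[symmetric] using d(2) by (intro arg_cong[of _ _ "\<lambda>x. e powr x"]) simp
    then show ?case using elim by (auto simp: abs_mult intro!: mult_mono)
  qed
qed

lemma grows_minus: "grows A p f \<Longrightarrow> grows A p (\<lambda>e z. - f e z)"
  by (simp add: grows_def)

lemma grows_zero: "grows A p (\<lambda>e z. 0)"
  by (simp add: grows_def)

lemma grows_bounded: "(\<And>e z. e \<in> {0<..1} \<Longrightarrow> z \<in> A e \<Longrightarrow> \<bar>f e z\<bar> \<le> K) \<Longrightarrow> grows A 0 f"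
  by (rule growsI_bound[of _ _ K]) (rule eventually_mono[OF eventually_unit], auto)

section \<open>Slow scale coefficients and spans\<close>

definition strip :: "real \<Rightarrow> (real \<times> real) set" where
  "strip T = {0..T} \<times> UNIV"

text \<open>Exponent 0 up to an arbitrarily small loss is the slow scale property. Uniformity in
  \<open>x\<close>, natural for functions of time, makes it available on every moving region inside
  a strip.\<close>

definition slow :: "snet \<Rightarrow> bool" where
  "slow a \<longleftrightarrow> (\<forall>bs\<in>lists Basis. \<forall>T. grows (\<lambda>e. strip T) 0 (ev (Ds bs a)))"

definition in_strip :: "(real \<Rightarrow> (real \<times> real) set) \<Rightarrow> bool" where
  "in_strip A \<longleftrightarrow> (\<exists>T. \<forall>\<^sub>F e in at_right 0. A e \<subseteq> strip T)"

lemma in_stripI: "(\<And>e t x. (t, x) \<in> A e \<Longrightarrow> 0 \<le> t \<and> t \<le> T) \<Longrightarrow> in_strip A"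
  unfolding in_strip_def strip_def by (rule exI[of _ T], rule always_eventually) auto

lemma slow_grows: "slow a \<Longrightarrow> in_strip A \<Longrightarrow> grows A 0 (ev a)"
proof -
  assume a: "slow a" and "in_strip A"
  then obtain T where T: "\<forall>\<^sub>F e in at_right 0. A e \<subseteq> strip T" by (auto simp: in_strip_def)
  have "grows (\<lambda>e. strip T) 0 (ev (Ds [] a))" using a unfolding slow_def by blast
  then show ?thesis using grows_mono[OF _ order_refl T] by simp
qed

lemma slow_D: "slow a \<Longrightarrow> b \<in> Basis \<Longrightarrow> slow (D b a)"
  unfolding slow_def
proof (intro ballI allI)
  fix bs :: "(real \<times> real) list" and T assume *: "\<forall>bs\<in>lists Basis. \<forall>T. grows (\<lambda>e. strip T) 0 (ev (Ds bs a))"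
    "b \<in> Basis" "bs \<in> lists Basis"
  then have "bs @ [b] \<in> lists Basis" by auto
  then have "grows (\<lambda>e. strip T) 0 (ev (Ds (bs @ [b]) a))" using * by blast
  then show "grows (\<lambda>e. strip T) 0 (ev (Ds bs (D b a)))" by simp
qed

lemma grows_ev_add: "grows A p (ev f) \<Longrightarrow> grows A p (ev g) \<Longrightarrow> grows A p (ev (f + g))"
  using grows_add[of A p "ev f" "ev g"] by (simp add: ev_add[abs_def])

lemma grows_ev_minus: "grows A p (ev f) \<Longrightarrow> grows A p (ev (- f))"
  using grows_minus[of A p "ev f"] by (simp add: ev_minus[abs_def])

lemma grows_ev_diff: "grows A p (ev f) \<Longrightarrow> grows A p (ev g) \<Longrightarrow> grows A p (ev (f - g))"
  using grows_ev_add[of A p f "- g"] grows_ev_minus[of A p g] by simp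

lemma grows_ev_zero: "grows A p (ev 0)"
  using grows_zero by (simp add: ev_zero[abs_def])

lemma grows_ev_mult: "grows A p (ev f) \<Longrightarrow> grows A q (ev g) \<Longrightarrow> grows A (p + q) (ev (f * g))"
  using grows_mult[of A p "ev f" q "ev g"] by (simp add: ev_mult[abs_def])

lemma slow_add: "slow a \<Longrightarrow> slow b \<Longrightarrow> slow (a + b)"
  by (auto simp: slow_def Ds_add intro!: grows_ev_add)

lemma slow_minus: "slow a \<Longrightarrow> slow (- a)"
  by (auto simp: slow_def Ds_minus intro!: grows_ev_minus)

lemma slow_mult:
  assumes "slow a" "slow b"
  shows "slow (a * b)"
proof -
  have "\<forall>T. grows (\<lambda>e. strip T) 0 (ev (Ds bs (a * b)))"
    if "bs \<in> lists Basis" "slow a" "slow b" for bs a b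
    using that
  proof (induction bs arbitrary: a b rule: rev_induct)
    case Nil
    have "in_strip (\<lambda>e. strip T)" for T by (auto simp: in_strip_def)
    then show ?case
      using Nil slow_grows[of a] slow_grows[of b] grows_ev_mult[of _ 0 a 0 b] by auto
  next
    case (snoc d bs)
    then have "Ds (bs @ [d]) (a * b) = Ds bs (D d a * b) + Ds bs (a * D d b)"
      by (simp add: D_mult Ds_add)
    moreover have "\<forall>T. grows (\<lambda>e. strip T) 0 (ev (Ds bs (D d a * b)))"
      "\<forall>T. grows (\<lambda>e. strip T) 0 (ev (Ds bs (a * D d b)))"
      using snoc by (auto intro!: slow_D)
    ultimately show ?case using grows_ev_add by simp
  qed
  then show ?thesis using assms by (simp add: slow_def)
qed

lemma slow_zero: "slow 0"
proof -
  have "Ds bs 0 = 0" if "bs \<in> lists Basis" for bs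
    using that by (induction bs rule: list.induct) (auto simp: derivation_zero derivation_D)
  then show ?thesis by (simp add: slow_def grows_ev_zero)
qed

lemma slow_cst: "slow (cst r)"
  unfolding slow_def
proof (intro ballI allI)
  fix bs :: "(real \<times> real) list" and T assume bs: "bs \<in> lists Basis"
  show "grows (\<lambda>e. strip T) 0 (ev (Ds bs (cst r)))"
  proof (cases bs rule: rev_cases)
    case Nil
    then show ?thesis
      by (auto intro!: grows_bounded[of _ _ "\<bar>r\<bar>"] simp: ev_cst strip_def half_plane_def
          simp del: greaterThanAtMost_iff)
  next
    case (snoc bs' b)
    then show ?thesis using bs slow_zero by (simp add: D_cst slow_def)
  qed
qed

lemma slow_one: "slow 1"
  using slow_cst[of 1] by (simp add: cst_one)

text \<open>The module generated by \<open>G\<close> over the slow nets. A growth exponent common to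
  the generators passes to the whole module, so estimates reduce to recording which generators
  occur.\<close>

inductive_set slow_span :: "snet set \<Rightarrow> snet set" for G where
  base: "g \<in> G \<Longrightarrow> g \<in> slow_span G"
| zero: "0 \<in> slow_span G"
| add: "f \<in> slow_span G \<Longrightarrow> g \<in> slow_span G \<Longrightarrow> f + g \<in> slow_span G"
| mult: "slow a \<Longrightarrow> f \<in> slow_span G \<Longrightarrow> a * f \<in> slow_span G"

lemma slow_span_minus: "f \<in> slow_span G \<Longrightarrow> - f \<in> slow_span G"
  using slow_span.mult[OF slow_minus[OF slow_one], of f G] by simp

lemma slow_span_diff: "f \<in> slow_span G \<Longrightarrow> g \<in> slow_span G \<Longrightarrow> f - g \<in> slow_span G"
  using slow_span.add[of f G "- g"] slow_span_minus by simp

lemma slow_span_subset: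
  assumes "G \<subseteq> slow_span G'" "f \<in> slow_span G"
  shows "f \<in> slow_span G'"
  using assms(2) by induction (use assms(1) in \<open>auto intro: slow_span.intros\<close>)

lemma slow_span_mono: "G \<subseteq> G' \<Longrightarrow> f \<in> slow_span G \<Longrightarrow> f \<in> slow_span G'"
  by (rule slow_span_subset) (auto intro: slow_span.base)

lemma slow_span_mono_set: "G \<subseteq> G' \<Longrightarrow> slow_span G \<subseteq> slow_span G'"
  using slow_span_mono by blast

text \<open>The product rule on \<open>a * f\<close> leaves the term \<open>E a * f\<close> with
  \<open>f\<close> undifferentiated, which is why \<open>G'\<close> has to contain
  \<open>G\<close>.\<close>

lemma slow_span_derivation:
  assumes E: "derivation E" "\<And>a. slow a \<Longrightarrow> slow (E a)"
    and G: "\<And>g. g \<in> G \<Longrightarrow> E g \<in> slow_span G'" "G \<subseteq> G'"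
  shows "f \<in> slow_span G \<Longrightarrow> E f \<in> slow_span G'"
proof (induction rule: slow_span.induct)
  case (base g)
  then show ?case by (rule G)
next
  case zero
  then show ?case by (simp add: derivation_zero E slow_span.zero)
next
  case (add f g)
  then show ?case by (simp add: derivation_add E slow_span.add)
next
  case (mult a f)
  have "f \<in> slow_span G'" using mult(2) G(2) by (rule slow_span_mono[rotated])
  then show ?case using mult by (simp add: derivation_mult E slow_span.add slow_span.mult)
qed

lemma slow_span_grows:
  assumes "in_strip A" "\<And>g. g \<in> G \<Longrightarrow> grows A p (ev g)"
  shows "f \<in> slow_span G \<Longrightarrow> grows A p (ev f)"
proof (induction rule: slow_span.induct)
  case (mult a f)
  then show ?case using grows_ev_mult[OF slow_grows[OF _ assms(1)], of a p f] by simp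
qed (auto intro: assms(2) grows_ev_zero grows_ev_add)

text \<open>Uniformity in the order of differentiation becomes a closure property: once the basis
  derivatives of the generators stay in the module, no iterated derivative leaves it, so
  \<open>p\<close> serves for every \<open>bs\<close>.\<close>

lemma slow_span_grows_Ds:
  assumes A: "in_strip A" "\<And>g. g \<in> G \<Longrightarrow> grows A p (ev g)"
    and G: "\<And>g b. g \<in> G \<Longrightarrow> b \<in> Basis \<Longrightarrow> D b g \<in> slow_span G"
    and f: "f \<in> slow_span G" and bs: "bs \<in> lists Basis"
  shows "grows A p (ev (Ds bs f))"
proof -
  have "D b f \<in> slow_span G" if "f \<in> slow_span G" "b \<in> Basis" for b f
    using slow_span_derivation[of "D b" G G f] derivation_D slow_D G that by blast
  then have "Ds bs f \<in> slow_span G"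
    using bs f by (induction bs rule: list.induct) auto
  with slow_span_grows[of A G p "Ds bs f"] A show ?thesis by blast
qed

section \<open>The wave operator as a product of transport operators\<close>

lemma basis_t: "(1, 0) \<in> (Basis :: (real \<times> real) set)"
  and basis_x: "(0, 1) \<in> (Basis :: (real \<times> real) set)"
  by (auto simp: Basis_real2)

lemma slow_span_cst: "f \<in> slow_span G \<Longrightarrow> cst r * f \<in> slow_span G"
  by (rule slow_span.mult[OF slow_cst])

lemmas derivation_X = derivation_D[OF basis_x]

text \<open>For the negligible residual of the equation these generators grow with every exponent,
  so they are harmless in any span. Applied to \<open>u\<close>, the same set expresses
  regularity.\<close>

definition words :: "snet \<Rightarrow> snet set" where
  "words n = {Ds bs n | bs. bs \<in> lists Basis}"

lemma words_self: "n \<in> words n"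
  unfolding words_def using lists.Nil by (force intro: exI[of _ "[]"])

lemma words_D: "g \<in> words n \<Longrightarrow> b \<in> Basis \<Longrightarrow> D b g \<in> words n"
proof -
  assume "g \<in> words n" and b: "b \<in> Basis"
  then obtain bs where "g = Ds bs n" "bs \<in> lists Basis" by (auto simp: words_def)
  then have "D b g = Ds (b # bs) n" "b # bs \<in> lists Basis" using b by auto
  then show ?thesis unfolding words_def by blast
qed

lemma words_X_pow: "(Dx ^^ k) n \<in> words n"
  by (induction k) (auto intro: words_self words_D basis_x)

lemma X_pow_add: "(Dx ^^ k) (f + g) = (Dx ^^ k) f + (Dx ^^ k) g"
  by (induction k) (auto simp: derivation_add derivation_X)

lemma X_pow_diff: "(Dx ^^ k) (f - g) = (Dx ^^ k) f - (Dx ^^ k) g"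
  by (induction k) (auto simp: derivation_diff derivation_X)

lemma X_pow_const_mult: "Dx a = 0 \<Longrightarrow> (Dx ^^ k) (a * f) = a * (Dx ^^ k) f"
  by (induction k) (auto simp: derivation_mult derivation_X)

text \<open>The net \<open>n\<close> is the residual of the wave equation for a representative. The
  assumption \<open>wave\<close> is that equation divided by the squared speed; the term with
  \<open>b\<close> arises from moving \<open>ci\<close> past \<open>Dt\<close>.\<close>

locale wave_algebra =
  fixes u c ci b n :: snet
  assumes slow: "slow c" "slow ci" "slow b"
    and inv: "c * ci = 1"
    and X_coeff: "Dx c = 0" "Dx ci = 0" "Dx b = 0"
    and wave: "ci * Dt (ci * Dt u)
       = Dx (Dx u) - b * (ci * Dt u + ci * Dt u) + ci * ci * n"
begin

definition T :: "snet \<Rightarrow> snet" where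
  "T f = ci * Dt f"

definition P :: "real \<Rightarrow> snet \<Rightarrow> snet" where
  "P r f = T f + cst r * Dx f"

lemma derivation_T: "derivation T"
  by (simp add: derivation_def T_def D_add D_mult basis_t algebra_simps)

lemma derivation_P: "derivation (P r)"
  by (simp add: derivation_def P_def derivation_add[OF derivation_T] derivation_add[OF derivation_X]
      derivation_mult[OF derivation_T] derivation_mult[OF derivation_X] algebra_simps)

lemma X_T: "Dx (T f) = T (Dx f)"
  by (simp add: T_def derivation_mult[OF derivation_X] X_coeff D_commute)

lemma X_P: "Dx (P r f) = P r (Dx f)"
  by (simp add: P_def derivation_add[OF derivation_X] derivation_mult[OF derivation_X] D_cst basis_x X_T)

lemma X_pow_P: "(Dx ^^ k) (P r f) = P r ((Dx ^^ k) f)"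
  by (induction k) (auto simp: X_P)

lemma X_pow_T: "(Dx ^^ k) (T f) = T ((Dx ^^ k) f)"
  by (induction k) (auto simp: X_T)

lemma T_cst: "T (cst r) = 0"
  by (simp add: T_def D_cst basis_t)

lemma wave_T: "T (T u) = Dx (Dx u) - b * (T u + T u) + ci * ci * n"
  using wave by (simp add: T_def)

text \<open>The mixed terms cancel because \<open>T\<close> and \<open>Dx\<close> commute. The right
  side does not see the sign of \<open>r\<close>, so \<open>P r\<close> and \<open>P (- r)\<close>
  commute as well.\<close>

lemma P_P:
  assumes "r * r = 1"
  shows "P r (P (- r) f) = T (T f) - Dx (Dx f)"
proof -
  have "cst r * cst r = 1" using assms by (simp add: cst_mult[symmetric] cst_one)
  then have 1: "cst r * (cst r * g) = g" for g by (simp add: mult.assoc[symmetric])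
  show ?thesis
    by (simp add: P_def derivation_add[OF derivation_X] derivation_mult[OF derivation_X]
        derivation_add[OF derivation_T] derivation_mult[OF derivation_T] D_cst basis_x X_T T_cst
        cst_minus derivation_diff[OF derivation_T] derivation_diff[OF derivation_X] algebra_simps 1)
qed

text \<open>The first order term splits evenly since \<open>T u + T u = P r u + P (- r) u\<close>.
  One half becomes the zero order term of the transport equation, the other couples it to the
  opposite factor.\<close>

lemma P_P_u: "r * r = 1 \<Longrightarrow> P r (P (- r) u) = ci * ci * n - b * (P r u + P (- r) u)"
  by (subst P_P) (auto simp: wave_T P_def cst_minus)

lemma slow_P: "slow a \<Longrightarrow> slow (P r a)"
  by (auto simp: P_def T_def intro!: slow_add slow_mult slow slow_cst slow_D basis_t basis_x)

lemma slow_span_P: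
  assumes "\<And>d g. d \<in> Basis \<Longrightarrow> g \<in> G \<Longrightarrow> D d g \<in> slow_span G"
  shows "f \<in> slow_span G \<Longrightarrow> P r f \<in> slow_span G"
proof -
  have "P r g \<in> slow_span G" if "g \<in> G" for g
    using assms that by (auto simp: P_def T_def intro!: slow_span.add slow_span.mult slow slow_cst basis_t basis_x)
  then show "f \<in> slow_span G \<Longrightarrow> P r f \<in> slow_span G"
    using slow_span_derivation[of "P r" G G f] derivation_P slow_P by blast
qed

lemma words_P: "g \<in> words n \<Longrightarrow> P r g \<in> slow_span (words n)"
  by (rule slow_span_P) (auto intro: words_D slow_span.base)

lemma wave_source: "ci * ci * n \<in> slow_span (words n)"
  unfolding mult.assoc by (intro slow_span.mult slow slow_span.base words_self)

text \<open>
  The commutator of the transport operator with powers of its counterpart: one power of the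
  counterpart is gained, up to the term with coefficient \<open>b\<close>.
\<close>

definition lower :: "real \<Rightarrow> nat \<Rightarrow> snet set" where
  "lower r k = {(P (- r) ^^ i) u | i. i \<le> k} \<union> {P r u} \<union> words n"

lemma transport_commutator:
  assumes r: "r * r = 1"
  shows "P r ((P (- r) ^^ Suc k) u) + b * (P (- r) ^^ Suc k) u \<in> slow_span (lower r k)"
proof (induction k)
  case 0
  have "P r (P (- r) u) + b * P (- r) u = ci * ci * n + (- b) * P r u"
    by (simp add: P_P_u[OF r] algebra_simps)
  moreover have "ci * ci * n \<in> slow_span (lower r 0)"
    by (rule slow_span_mono[OF _ wave_source]) (auto simp: lower_def)
  moreover have "(- b) * P r u \<in> slow_span (lower r 0)"
    by (intro slow_span.mult slow_minus slow slow_span.base) (simp add: lower_def)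
  ultimately have "P r (P (- r) u) + b * P (- r) u \<in> slow_span (lower r 0)" by (simp only: slow_span.add)
  then show ?case by simp
next
  case (Suc k)
  let ?L = "P (- r)" and ?z = "(P (- r) ^^ Suc k) u"
  have comm: "P r (?L f) = ?L (P r f)" for f
    using P_P[OF r, of f] P_P[of "- r" f] r by simp
  have sub: "lower r k \<subseteq> lower r (Suc k)" by (auto simp: lower_def)
  have 0: "P r u \<in> slow_span (lower r (Suc k))" "?L u \<in> slow_span (lower r (Suc k))"
    by (auto simp: lower_def intro!: slow_span.base exI[of _ 1])
  have n: "slow_span (words n) \<subseteq> slow_span (lower r (Suc k))"
    by (rule slow_span_mono_set) (auto simp: lower_def)
  \<comment> \<open>One more application of the counterpart raises the admissible power by one; this
    is the only growth of the generating set.\<close>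
  have G: "?L g \<in> slow_span (lower r (Suc k))" if "g \<in> lower r k" for g
    using that[unfolded lower_def]
  proof (elim UnE)
    assume "g \<in> {(?L ^^ i) u | i. i \<le> k}"
    then obtain i where "g = (?L ^^ i) u" "i \<le> k" by blast
    then have "?L g = (?L ^^ Suc i) u" "Suc i \<le> Suc k" by auto
    then show ?thesis unfolding lower_def by (blast intro: slow_span.base)
  next
    assume "g \<in> {P r u}"
    \<comment> \<open>For the generator \<open>P r u\<close> the mixed second order product is
      returned to first order by the equation itself.\<close>
    then have eq: "?L g = ci * ci * n - b * (P r u + ?L u)" by (simp add: comm[symmetric] P_P_u[OF r])
    have src: "ci * ci * n \<in> slow_span (lower r (Suc k))" using n wave_source by blast
    show ?thesis unfolding eq by (rule slow_span_diff[OF src]) (intro slow_span.mult slow_span.add slow 0)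
  next
    assume "g \<in> words n"
    then show ?thesis using words_P n by blast
  qed
  have "?L (P r ?z + b * ?z) \<in> slow_span (lower r (Suc k))"
    using slow_span_derivation[of ?L "lower r k" "lower r (Suc k)", OF derivation_P slow_P G sub] Suc by blast
  \<comment> \<open>Left over when the counterpart is applied to \<open>b * ?z\<close>. It is a slow
    multiple of a power that now counts as lower.\<close>
  moreover have "?L b * ?z \<in> slow_span (lower r (Suc k))"
  proof (intro slow_span.mult slow_P slow slow_span.base)
    show "?z \<in> lower r (Suc k)" unfolding lower_def by blast
  qed
  moreover have "P r ((?L ^^ Suc (Suc k)) u) + b * (?L ^^ Suc (Suc k)) u =
      ?L (P r ?z + b * ?z) - ?L b * ?z"
    by (simp add: derivation_add[OF derivation_P] derivation_mult[OF derivation_P] comm)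
  ultimately show ?case by (simp only: slow_span_diff)
qed

section \<open>All derivatives from the two families of powers\<close>

definition both_powers :: "snet set" where
  "both_powers = {(P r ^^ i) u | r i. r = 1 \<or> r = -1} \<union> words n"

lemma words_both_powers: "slow_span (words n) \<subseteq> slow_span both_powers"
  by (rule slow_span_mono_set) (simp add: both_powers_def)

text \<open>Pure powers suffice as generators: an operator of the same sign raises the power, and
  one of the opposite sign is replaced by lower terms through
  \<open>transport_commutator\<close>.\<close>

lemma both_powers_P:
  assumes g: "g \<in> both_powers" and r: "r = 1 \<or> r = -1"
  shows "P r g \<in> slow_span both_powers"
proof -
  have pow: "(P r' ^^ i) u \<in> both_powers" if "r' = 1 \<or> r' = -1" for r' i
    using that unfolding both_powers_def by blast
  have r2: "r * r = 1" and mr: "- r = 1 \<or> - r = -1" using r by auto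
  show ?thesis
    using g[unfolded both_powers_def]
  proof (elim UnE)
    assume "g \<in> words n"
    then show ?thesis using words_P words_both_powers by blast
  next
    assume "g \<in> {(P r ^^ i) u | r i. r = 1 \<or> r = -1}"
    then obtain r' i where g: "g = (P r' ^^ i) u" "r' = 1 \<or> r' = -1" by blast
    then have "r' = r \<or> r' = - r" using r by auto
    then show ?thesis
    proof
      assume "r' = r"
      then have "P r g = (P r ^^ Suc i) u" using g by simp
      then show ?thesis using slow_span.base[OF pow[OF r, of "Suc i"]] by simp
    next
      assume r': "r' = - r"
      show ?thesis
      proof (cases i)
        case 0
        then have "P r g = (P r ^^ 1) u" using g by simp
        then show ?thesis using slow_span.base[OF pow[OF r, of 1]] by simp
      next
        case (Suc k)
        have "lower r k \<subseteq> both_powers"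
          using pow[OF mr] pow[OF r, of 1] by (auto simp: lower_def both_powers_def)
        from slow_span_mono[OF this transport_commutator[OF r2, of k]]
        have "P r g + b * g \<in> slow_span both_powers"
          unfolding g(1) r' Suc .
        moreover have "b * g \<in> slow_span both_powers"
          unfolding g(1) by (intro slow_span.mult slow slow_span.base pow g(2))
        ultimately have "P r g + b * g - b * g \<in> slow_span both_powers" by (rule slow_span_diff)
        then show ?thesis by simp
      qed
    qed
  qed
qed

lemma halves: "cst (1/2) * (f + f) = f"
proof -
  have "cst (1/2) + cst (1/2) = 1" by (simp add: cst_add[symmetric] cst_one)
  then have "(cst (1/2) + cst (1/2)) * f = f" by simp
  then show ?thesis by (simp add: algebra_simps)
qed

text \<open>\<open>T\<close> and \<open>Dx\<close> are the half sum and the half difference of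
  \<open>P 1\<close> and \<open>P (-1)\<close>; multiplication by \<open>c\<close> turns
  \<open>T\<close> into \<open>Dt\<close>.\<close>

lemma both_powers_D:
  assumes g: "g \<in> both_powers" and d: "d \<in> Basis"
  shows "D d g \<in> slow_span both_powers"
proof -
  have pp: "P 1 g \<in> slow_span both_powers" "P (-1) g \<in> slow_span both_powers"
    using both_powers_P[OF g] by auto
  consider "d = (1, 0)" | "d = (0, 1)" using d by (auto simp: Basis_real2)
  then show ?thesis
  proof cases
    case 1
    have "P 1 g + P (-1) g = T g + T g" by (simp add: P_def cst_minus[of 1, simplified])
    then have "D d g = c * (cst (1/2) * (P 1 g + P (-1) g))"
      using halves[of "T g"] by (simp only: 1) (simp add: T_def mult.assoc[symmetric] inv)
    then show ?thesis using pp by (auto intro!: slow_span.mult slow slow_span.add slow_cst)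
  next
    case 2
    have "P 1 g - P (-1) g = Dx g + Dx g" by (simp add: P_def cst_minus[of 1, simplified] cst_one)
    then have "D d g = cst (1/2) * (P 1 g - P (-1) g)" by (simp only: 2 halves)
    then show ?thesis using pp by (auto intro!: slow_span.mult slow_span_diff slow_cst)
  qed
qed

lemma regular_from_powers:
  assumes "in_strip A"
    and "\<And>r k. r = 1 \<or> r = -1 \<Longrightarrow> grows A p (ev ((P r ^^ k) u))"
    and "\<And>g. g \<in> words n \<Longrightarrow> grows A p (ev g)"
    and "bs \<in> lists Basis"
  shows "grows A p (ev (Ds bs u))"
proof (rule slow_span_grows_Ds[where G = both_powers])
  have "(P 1 ^^ 0) u \<in> both_powers" unfolding both_powers_def by blast
  then show "u \<in> slow_span both_powers" by (auto intro: slow_span.base)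
  show "grows A p (ev g)" if "g \<in> both_powers" for g
    using that assms(2,3) unfolding both_powers_def by blast
qed (use assms both_powers_D in auto)

text \<open>The span of \<open>words u\<close> is mapped into itself by \<open>P r\<close>, whose
  coefficients are slow.\<close>

lemma powers_from_regular:
  assumes "in_strip A" "\<And>bs. bs \<in> lists Basis \<Longrightarrow> grows A p (ev (Ds bs u))"
  shows "grows A p (ev ((P r ^^ k) u))"
proof (rule slow_span_grows[where G = "words u"])
  have "P r f \<in> slow_span (words u)" if "f \<in> slow_span (words u)" for f
    using slow_span_P[OF _ that] words_D slow_span.base by blast
  then show "(P r ^^ k) u \<in> slow_span (words u)"
    by (induction k) (auto intro: slow_span.base words_self)
qed (use assms in \<open>auto simp: words_def\<close>)

section \<open>All derivatives from the initial data\<close>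

definition initial_terms :: "snet set" where
  "initial_terms = {(Dx ^^ k) u | k. True} \<union> {(Dx ^^ k) (T u) | k. True} \<union> words n"

text \<open>The equation trades a second \<open>T\<close> for two \<open>Dx\<close> plus lower
  terms, so one time derivative is all that the generators have to contain. The remaining
  derivatives run along the initial line.\<close>

lemma initial_terms_D:
  assumes g: "g \<in> initial_terms" and d: "d \<in> Basis"
  shows "D d g \<in> slow_span initial_terms"
proof -
  have in0: "(Dx ^^ k) u \<in> initial_terms" "(Dx ^^ k) (T u) \<in> initial_terms" for k
    by (auto simp: initial_terms_def)
  have sub: "slow_span (words n) \<subseteq> slow_span initial_terms"
    by (rule slow_span_mono_set) (simp add: initial_terms_def)
  have DT: "Dt f = c * T f" for f
    by (simp add: T_def mult.assoc[symmetric] inv)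
  have d': "d = (1, 0) \<or> d = (0, 1)" using d by (auto simp: Basis_real2)
  show ?thesis
    using g[unfolded initial_terms_def]
  proof (elim UnE)
    assume "g \<in> {(Dx ^^ k) u | k. True}"
    then obtain k where k: "g = (Dx ^^ k) u" by blast
    from d' show ?thesis
    proof
      assume "d = (1, 0)"
      then have "D d g = c * (Dx ^^ k) (T u)" by (simp add: k DT X_pow_T)
      then show ?thesis by (simp add: slow_span.mult slow slow_span.base in0)
    next
      assume "d = (0, 1)"
      then have "D d g = (Dx ^^ Suc k) u" by (simp add: k)
      then show ?thesis by (simp only: slow_span.base in0)
    qed
  next
    assume "g \<in> {(Dx ^^ k) (T u) | k. True}"
    then obtain k where k: "g = (Dx ^^ k) (T u)" by blast
    from d' show ?thesis
    proof
      assume "d = (1, 0)"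
      then have "D d g = c * (Dx ^^ k) (T (T u))" by (simp add: k DT X_pow_T)
      moreover have "(Dx ^^ k) (Dx (Dx u)) = (Dx ^^ (Suc (Suc k))) u" by (simp add: funpow_swap1)
      ultimately have eq: "D d g = c * ((Dx ^^ Suc (Suc k)) u
          - b * ((Dx ^^ k) (T u) + (Dx ^^ k) (T u)) + (Dx ^^ k) (ci * ci * n))"
        by (simp only: wave_T X_pow_add X_pow_diff X_pow_const_mult X_coeff)
      have src: "(Dx ^^ k) (ci * ci * n) \<in> slow_span initial_terms"
        using sub slow_span.mult[OF slow(2) slow_span.mult[OF slow(2) slow_span.base[OF words_X_pow]]]
        by (auto simp: mult.assoc X_pow_const_mult X_coeff)
      show ?thesis
        unfolding eq by (intro slow_span.mult slow_span.add slow_span_diff slow src slow_span.base in0)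
    next
      assume "d = (0, 1)"
      then have "D d g = (Dx ^^ Suc k) (T u)" by (simp add: k)
      then show ?thesis by (simp only: slow_span.base in0)
    qed
  next
    assume "g \<in> words n"
    then show ?thesis using words_D d sub slow_span.base by blast
  qed
qed

lemma regular_from_initial:
  assumes "in_strip A"
    and "\<And>k. grows A p (ev ((Dx ^^ k) u))" "\<And>k. grows A p (ev ((Dx ^^ k) (Dt u)))"
    and "\<And>g. g \<in> words n \<Longrightarrow> grows A p (ev g)"
    and "bs \<in> lists Basis"
  shows "grows A p (ev (Ds bs u))"
proof (rule slow_span_grows_Ds[where G = initial_terms])
  show "u \<in> slow_span initial_terms"
    by (rule slow_span.base) (auto simp: initial_terms_def intro!: exI[of _ 0])
  have "grows A p (ev ((Dx ^^ k) (T u)))" for k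
    using grows_ev_mult[OF slow_grows[OF slow(2) assms(1)] assms(3)[of k]]
    by (simp add: T_def X_pow_const_mult X_coeff)
  then show "grows A p (ev g)" if "g \<in> initial_terms" for g
    using that assms(2,4) unfolding initial_terms_def by blast
qed (use assms initial_terms_D in auto)

text \<open>
  Modulo lower order terms, the counterpart operator acts on its own powers as a multiple of \<open>Dx\<close>.
\<close>

definition velocity_lower :: "real \<Rightarrow> nat \<Rightarrow> snet set" where
  "velocity_lower r k =
     {(Dx ^^ j) (P (- r) u) | j. j < k} \<union> {(Dx ^^ j) (P r u) | j. j < k} \<union> words n"

lemma power_as_velocity:
  assumes r: "r * r = 1"
  shows "(P (- r) ^^ Suc k) u - cst ((- 2 * r) ^ k) * (Dx ^^ k) (P (- r) u) \<in> slow_span (velocity_lower r k)"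
proof (induction k)
  case 0
  then show ?case by (simp add: cst_one slow_span.zero)
next
  case (Suc k)
  let ?L = "P (- r)"
  have comm: "P r (?L f) = ?L (P r f)" for f
    using P_P[OF r, of f] P_P[of "- r" f] r by simp
  have sub: "velocity_lower r k \<subseteq> velocity_lower r (Suc k)" by (auto simp: velocity_lower_def)
  have n: "slow_span (words n) \<subseteq> slow_span (velocity_lower r (Suc k))"
    by (rule slow_span_mono_set) (simp add: velocity_lower_def)
  have in0: "(Dx ^^ j) (?L u) \<in> slow_span (velocity_lower r (Suc k))"
      "(Dx ^^ j) (P r u) \<in> slow_span (velocity_lower r (Suc k))" if "j < Suc k" for j
    using that unfolding velocity_lower_def by (blast intro: slow_span.base)+
  \<comment> \<open>The mixed product is of first order in \<open>u\<close> by the equation, so it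
    counts as a lower term.\<close>
  have XML: "(Dx ^^ j) (P r (?L u)) \<in> slow_span (velocity_lower r (Suc k))" if "j \<le> k" for j
  proof -
    have "(Dx ^^ j) (P r (?L u)) =
        ci * (ci * (Dx ^^ j) n) - b * ((Dx ^^ j) (P r u) + (Dx ^^ j) (?L u))"
      by (simp add: P_P_u[OF r] X_pow_add X_pow_diff X_pow_const_mult X_coeff mult.assoc)
    moreover have "ci * (ci * (Dx ^^ j) n) \<in> slow_span (velocity_lower r (Suc k))"
      using n slow_span.mult[OF slow(2) slow_span.mult[OF slow(2) slow_span.base[OF words_X_pow]]] by blast
    ultimately show ?thesis using that in0[of j]
      by (auto intro!: slow_span_diff slow_span.mult slow slow_span.add)
  qed
  \<comment> \<open>The origin of the constant: up to \<open>P r\<close>, which produces lower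
    terms, each further application acts as \<open>- 2 * r\<close> times \<open>Dx\<close>.\<close>
  have LP: "?L f = P r f - cst (2 * r) * Dx f" for f
  proof -
    have "cst (2 * r) = cst r + cst r" by (simp add: cst_add[symmetric])
    then show ?thesis by (simp add: P_def cst_minus algebra_simps)
  qed
  have LXL: "?L ((Dx ^^ j) (?L u)) = (Dx ^^ j) (P r (?L u)) - cst (2 * r) * (Dx ^^ Suc j) (?L u)" for j
    by (subst LP) (simp add: X_pow_P)
  have G: "?L g \<in> slow_span (velocity_lower r (Suc k))" if "g \<in> velocity_lower r k" for g
    using that[unfolded velocity_lower_def]
  proof (elim UnE)
    assume "g \<in> {(Dx ^^ j) (?L u) | j. j < k}"
    then obtain j where j: "g = (Dx ^^ j) (?L u)" "j < k" by blast
    then show ?thesis using XML[of j] in0(1)[of "Suc j"]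
      unfolding j(1) LXL by (intro slow_span_diff slow_span_cst) auto
  next
    assume "g \<in> {(Dx ^^ j) (P r u) | j. j < k}"
    then obtain j where j: "g = (Dx ^^ j) (P r u)" "j < k" by blast
    then have "?L g = (Dx ^^ j) (P r (?L u))" by (simp add: X_pow_P[symmetric] comm)
    then show ?thesis using XML[of j] j by simp
  next
    assume "g \<in> words n"
    then show ?thesis using words_P n by blast
  qed
  \<comment> \<open>The remainder at order \<open>k\<close>. Applying the counterpart gives the
    remainder at order \<open>Suc k\<close> up to a mixed product, as the constant in front is
    annihilated.\<close>
  define w where "w = (?L ^^ Suc k) u - cst ((- 2 * r) ^ k) * (Dx ^^ k) (?L u)"
  have w: "?L w \<in> slow_span (velocity_lower r (Suc k))"
    using slow_span_derivation[of ?L "velocity_lower r k" "velocity_lower r (Suc k)", OF derivation_P slow_P G sub]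
      Suc unfolding w_def by blast
  have cstP: "?L (cst s) = 0" for s by (simp add: P_def T_cst D_cst basis_x)
  have "?L w = (?L ^^ Suc (Suc k)) u - cst ((- 2 * r) ^ k) * ?L ((Dx ^^ k) (?L u))"
    by (simp add: w_def derivation_diff[OF derivation_P] derivation_mult[OF derivation_P] cstP)
  also have "\<dots> = (?L ^^ Suc (Suc k)) u - cst ((- 2 * r) ^ Suc k) * (Dx ^^ Suc k) (?L u)
      - cst ((- 2 * r) ^ k) * (Dx ^^ k) (P r (?L u))"
    unfolding LXL by (simp add: algebra_simps cst_mult cst_minus)
  finally have "(?L ^^ Suc (Suc k)) u - cst ((- 2 * r) ^ Suc k) * (Dx ^^ Suc k) (?L u) =
      ?L w + cst ((- 2 * r) ^ k) * (Dx ^^ k) (P r (?L u))" by simp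
  then show ?case using w XML[of k] by (simp only: slow_span.add slow_span_cst order_refl)
qed

text \<open>\<open>power_as_velocity\<close> is inverted by dividing by its nonzero constant. The
  lower terms contain both first order factors; they differ by \<open>cst (2 * r) * Dx u\<close>,
  which the assumption on \<open>u\<close> controls, so strong induction on the order closes. Then
  \<open>T u\<close> is \<open>P (- r) u\<close> plus a multiple of \<open>Dx u\<close>.\<close>

lemma velocity_from_powers:
  assumes r: "r * r = 1" and A: "in_strip A"
    and L: "\<And>k. grows A p (ev ((P (- r) ^^ k) u))"
    and Xu: "\<And>k. grows A p (ev ((Dx ^^ k) u))"
    and n: "\<And>g. g \<in> words n \<Longrightarrow> grows A p (ev g)"
  shows "grows A p (ev ((Dx ^^ k) (Dt u)))"
proof -
  have mult: "grows A p (ev (a * f))" if "slow a" "grows A p (ev f)" for a f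
    using grows_ev_mult[OF slow_grows[OF that(1) A] that(2)] by simp
  have XL: "grows A p (ev ((Dx ^^ k) (P (- r) u)))" for k
  proof (induction k rule: less_induct)
    case (less k)
    have "P r u = P (- r) u + cst (2 * r) * Dx u"
    proof -
      have "cst (2 * r) = cst r + cst r" by (simp add: cst_add[symmetric])
      then show ?thesis by (simp add: P_def cst_minus algebra_simps)
    qed
    then have "(Dx ^^ j) (P r u) = (Dx ^^ j) (P (- r) u) + cst (2 * r) * (Dx ^^ Suc j) u" for j
      by (simp add: X_pow_add X_pow_const_mult D_cst basis_x funpow_swap1)
    then have "grows A p (ev ((Dx ^^ j) (P r u)))" if "j < k" for j
      using less[OF that] Xu[of "Suc j"] by (auto intro!: grows_ev_add mult slow_cst simp del: funpow.simps)
    then have "grows A p (ev g)" if "g \<in> velocity_lower r k" for g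
      using that n less unfolding velocity_lower_def by blast
    from slow_span_grows[OF A this power_as_velocity[OF r, of k]]
    have 0: "grows A p (ev ((P (- r) ^^ Suc k) u - cst ((- 2 * r) ^ k) * (Dx ^^ k) (P (- r) u)))"
      by blast
    have "grows A p (ev ((P (- r) ^^ Suc k) u -
       ((P (- r) ^^ Suc k) u - cst ((- 2 * r) ^ k) * (Dx ^^ k) (P (- r) u))))"
      by (rule grows_ev_diff[OF L 0])
    then have "grows A p (ev (cst ((- 2 * r) ^ k) * (Dx ^^ k) (P (- r) u)))"
      by (simp only: diff_diff_eq2 add_diff_cancel_left' diff_add_cancel)
    then have 1: "grows A p (ev (cst (inverse ((- 2 * r) ^ k)) * (cst ((- 2 * r) ^ k) * (Dx ^^ k) (P (- r) u))))"
      by (rule mult[OF slow_cst])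
    have "cst (inverse ((- 2 * r) ^ k)) * cst ((- 2 * r) ^ k) = 1"
    proof -
      have "r \<noteq> 0" using r by auto
      then have "inverse ((- 2 * r) ^ k) * (- 2 * r) ^ k = 1" by simp
      then show ?thesis by (simp only: cst_mult[symmetric] cst_one)
    qed
    then have "cst (inverse ((- 2 * r) ^ k)) * (cst ((- 2 * r) ^ k) * f) = f" for f
      by (simp only: mult.assoc[symmetric] mult_1_left)
    then show ?case using 1 by (simp only:)
  qed
  have "P (- r) u + cst r * Dx u = T u" by (simp add: P_def cst_minus)
  then have "(Dx ^^ k) (T u) = (Dx ^^ k) (P (- r) u) + cst r * (Dx ^^ Suc k) u"
    by (simp add: X_pow_add[symmetric] X_pow_const_mult[symmetric] D_cst basis_x funpow_swap1)
  then have "grows A p (ev ((Dx ^^ k) (T u)))"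
    using XL[of k] Xu[of "Suc k"] by (auto intro!: grows_ev_add mult slow_cst simp del: funpow.simps)
  moreover have "(Dx ^^ k) (Dt u) = c * (Dx ^^ k) (T u)"
    by (simp add: T_def X_pow_const_mult X_coeff mult.assoc[symmetric] inv)
  ultimately show ?thesis by (simp add: mult slow)
qed

end

section \<open>Transport along characteristics\<close>

text \<open>
  The lower order coefficient is chosen such that multiplication by the square root of the speed
  removes it.
\<close>

lemma transport_bound:
  fixes c dc \<theta> :: "real \<Rightarrow> real"
  assumes f: "smooth_on half_plane f" and r: "r = 1 \<or> r = -1"
    and c: "\<And>t. 0 \<le> t \<Longrightarrow> m \<le> c t \<and> c t \<le> M" "0 < m"
    and dc: "\<And>t. 0 \<le> t \<Longrightarrow> (c has_real_derivative dc t) (at t within {0..})"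
    and \<theta>: "\<And>t. 0 \<le> t \<Longrightarrow> (\<theta> has_real_derivative c t) (at t within {0..})"
    and t: "0 \<le> t1" "t1 \<le> T" "0 \<le> t2" "t2 \<le> T"
    and eq: "\<And>t. t \<in> closed_segment t1 t2 \<Longrightarrow>
       \<bar>partial_t f (t, x + r * \<theta> t) / c t
        + r * partial_x f (t, x + r * \<theta> t)
        + dc t / (2 * (c t)\<^sup>2) * f (t, x + r * \<theta> t)\<bar> \<le> B"
  shows "\<bar>f (t2, x + r * \<theta> t2)\<bar> \<le> sqrt M / sqrt m * (\<bar>f (t1, x + r * \<theta> t1)\<bar> + T * M * B)"
proof -
  define z where "z t = (t, x + r * \<theta> t)" for t
  define w where "w t = sqrt (c t) * f (z t)" for t
  define F where "F t = partial_t f (z t) / c t + r * partial_x f (z t)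
        + dc t / (2 * (c t)\<^sup>2) * f (z t)" for t
  \<comment> \<open>The segment is unordered, so one estimate serves transport forwards and
    backwards in time.\<close>
  let ?S = "closed_segment t1 t2"
  have S: "?S \<subseteq> {0..}" using t by (auto simp: closed_segment_eq_real_ivl split: if_splits)
  \<comment> \<open>Along the curve, differentiation is \<open>c\<close> times the transport
    operator. The derivative \<open>dc / (2 * sqrt c)\<close> of the weight is
    \<open>sqrt c * c\<close> times the zero order coefficient, so it completes
    \<open>F\<close>.\<close>
  have dw: "(w has_real_derivative sqrt (c t) * c t * F t) (at t within ?S)" if tS: "t \<in> ?S" for t
  proof -
    have t0: "0 \<le> t" using tS S by auto
    then have ct: "c t > 0" using c(1)[of t] c(2) by simp
    have 1: "((\<lambda>t. sqrt (c t)) has_real_derivative dc t / (2 * sqrt (c t))) (at t within ?S)"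
      using DERIV_subset[OF dc[OF t0] S] ct
      by (auto intro!: derivative_eq_intros simp: field_simps)
    have "(z has_derivative (\<lambda>h. (h, r * (h * c t)))) (at t within ?S)"
      unfolding z_def using DERIV_subset[OF \<theta>[OF t0] S]
      by (auto intro!: derivative_eq_intros simp: has_field_derivative_def mult.commute)
    moreover have "z ` ?S \<subseteq> half_plane" using S by (auto simp: z_def half_plane_iff)
    then have "(f has_derivative (\<lambda>d. fst d * partial_t f (z t)
         + snd d * partial_x f (z t))) (at (z t) within z ` ?S)"
      using t0 by (intro has_derivative_subset[OF smooth_on_half_plane_has_derivative[OF f]])
        (simp_all add: z_def half_plane_iff)
    ultimately have "((\<lambda>t. f (z t)) has_derivative
        (\<lambda>h. h * partial_t f (z t)
          + r * (h * c t) * partial_x f (z t))) (at t within ?S)"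
      by (rule has_derivative_in_compose[THEN has_derivative_eq_rhs]) simp
    then have 2: "((\<lambda>t. f (z t)) has_real_derivative partial_t f (z t)
        + r * c t * partial_x f (z t)) (at t within ?S)"
      unfolding has_field_derivative_def
      by (rule has_derivative_eq_rhs) (simp add: fun_eq_iff algebra_simps)
    have sq: "sqrt (c t) * sqrt (c t) = c t" using ct by simp
    have "(w has_real_derivative sqrt (c t) * (partial_t f (z t)
        + r * c t * partial_x f (z t)) + dc t / (2 * sqrt (c t)) * f (z t)) (at t within ?S)"
      unfolding w_def using DERIV_mult[OF 1 2] by (simp add: algebra_simps)
    moreover have "dc t / (2 * sqrt (c t)) = sqrt (c t) * c t * (dc t / (2 * (c t)\<^sup>2))"
      using ct sq by (simp add: field_simps power2_eq_square)
    then have "sqrt (c t) * (partial_t f (z t)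
        + r * c t * partial_x f (z t)) + dc t / (2 * sqrt (c t)) * f (z t)
      = sqrt (c t) * c t * F t"
      unfolding F_def using ct by (simp add: distrib_left)
    ultimately show ?thesis by simp
  qed
  have B: "0 \<le> B" using eq[of t1] by force
  have M: "0 < M" using c(1)[of 0] c(2) by simp
  have bound: "norm (sqrt (c t) * c t * F t) \<le> sqrt M * M * B" if "t \<in> ?S" for t
  proof -
    have t0: "0 \<le> t" using that S by auto
    have "\<bar>F t\<bar> \<le> B" using eq[OF that] by (simp add: F_def z_def)
    then show ?thesis using c(1)[OF t0] c(2) M unfolding real_norm_def abs_mult
      by (intro mult_mono) auto
  qed
  have "norm (w t2 - w t1) \<le> sqrt M * M * B * norm (t2 - t1)"
    by (rule field_differentiable_bound[OF _ dw bound]) auto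
  also have "\<dots> \<le> sqrt M * M * B * T"
    using t B M by (intro mult_left_mono) (auto simp: abs_if)
  finally have 1: "\<bar>w t2\<bar> \<le> \<bar>w t1\<bar> + sqrt M * M * B * T" by simp
  have "sqrt m * \<bar>f (z t2)\<bar> \<le> \<bar>w t2\<bar>"
    using c(1)[OF t(3)] c(2) by (simp add: w_def abs_mult mult_right_mono)
  moreover have "\<bar>w t1\<bar> \<le> sqrt M * \<bar>f (z t1)\<bar>"
    using c(1)[OF t(1)] c(2) by (simp add: w_def abs_mult mult_right_mono)
  ultimately have "sqrt m * \<bar>f (z t2)\<bar> \<le> sqrt M * (\<bar>f (z t1)\<bar> + T * M * B)"
    using 1 by (simp add: algebra_simps)
  then have "\<bar>f (z t2)\<bar> \<le> sqrt M * (\<bar>f (z t1)\<bar> + T * M * B) / sqrt m"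
    using c(2) by (simp add: pos_le_divide_eq mult.commute)
  then show ?thesis by (simp add: z_def)
qed

text \<open>The real functions behind the ring elements. Since \<theta> is an antiderivative of the
  speed, the curves \<open>x = y + r * \<theta> e t\<close> are the characteristics of
  \<open>P r\<close>. The bounds \<open>m\<close> and \<open>M\<close> are independent of
  \<open>e\<close>, hence so is the transport constant.\<close>

locale wave_flow = wave_algebra +
  fixes m M :: real and cc dcc \<theta> :: "real \<Rightarrow> real \<Rightarrow> real"
  assumes m: "0 < m"
    and cc_bounds: "\<And>e t. e \<in> {0<..1} \<Longrightarrow> 0 \<le> t \<Longrightarrow> m \<le> cc e t \<and> cc e t \<le> M"
    and cc_deriv: "\<And>e t. e \<in> {0<..1} \<Longrightarrow> 0 \<le> t \<Longrightarrow>
          (cc e has_real_derivative dcc e t) (at t within {0..})"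
    and \<theta>_deriv: "\<And>e t. e \<in> {0<..1} \<Longrightarrow> 0 \<le> t \<Longrightarrow>
          (\<theta> e has_real_derivative cc e t) (at t within {0..})"
    and \<theta>_0: "\<And>e. e \<in> {0<..1} \<Longrightarrow> \<theta> e 0 = 0"
    and ev_ci: "\<And>e t x. e \<in> {0<..1} \<Longrightarrow> 0 \<le> t \<Longrightarrow> ev ci e (t, x) = 1 / cc e t"
    and ev_b: "\<And>e t x. e \<in> {0<..1} \<Longrightarrow> 0 \<le> t \<Longrightarrow> ev b e (t, x) = dcc e t / (2 * (cc e t)\<^sup>2)"
begin

lemma M: "0 < M"
  using cc_bounds[of 1 0] m by auto

lemma \<theta>_bounds:
  assumes "e \<in> {0<..1}" "0 \<le> t"
  shows "\<bar>\<theta> e t\<bar> \<le> M * t"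
proof -
  have "norm (\<theta> e t - \<theta> e 0) \<le> M * norm (t - 0)"
  proof (rule field_differentiable_bound[where S = "{0..}" and f' = "cc e"])
    show "(\<theta> e has_real_derivative cc e z) (at z within {0..})" if "z \<in> {0..}" for z
      using \<theta>_deriv[OF assms(1)] that by auto
    show "norm (cc e z) \<le> M" if "z \<in> {0..}" for z
      using cc_bounds[OF assms(1), of z] that m by auto
  qed (use assms in auto)
  then show ?thesis using assms \<theta>_0 by simp
qed

text \<open>
  Bounds spread over a region \<open>A\<close> from a part \<open>S\<close> of it that is met by every characteristic in \<open>A\<close>.
\<close>

definition reachable :: "real \<Rightarrow> (real \<Rightarrow> (real \<times> real) set) \<Rightarrow> (real \<Rightarrow> (real \<times> real) set) \<Rightarrow> bool" where
  "reachable r S A \<longleftrightarrow> (\<forall>\<^sub>F e in at_right 0. \<forall>t x. (t, x) \<in> A e \<longrightarrow>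
     (\<exists>t1. (t1, x + r * (\<theta> e t1 - \<theta> e t)) \<in> S e \<and>
        (\<forall>s\<in>closed_segment t1 t. (s, x + r * (\<theta> e s - \<theta> e t)) \<in> A e)))"

lemma transport_net:
  assumes r: "r = 1 \<or> r = -1" and A: "in_strip A" and reach: "reachable r S A"
    and S: "grows S p (ev f)" and F: "grows A p (ev (P r f + b * f))"
  shows "grows A p (ev f)"
proof (rule growsI_limit)
  fix q assume q: "p < q"
  obtain T where T: "\<forall>\<^sub>F e in at_right 0. A e \<subseteq> strip T" using A by (auto simp: in_strip_def)
  \<comment> \<open>The quotient of roots is the price of the weight \<open>sqrt c\<close>; the
    summand 1 stands for the data on \<open>S\<close>, and \<open>T * M\<close> for the source
    integrated over time.\<close>
  define K where "K = sqrt M / sqrt m * (1 + T * M)"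
  show "grows A q (ev f)"
  proof (rule growsI_bound[where K = K])
    show "\<forall>\<^sub>F e in at_right 0. \<forall>z\<in>A e. \<bar>ev f e z\<bar> \<le> K * e powr (- q)"
      using eventually_unit T reach[unfolded reachable_def] growsD[OF S q] growsD[OF F q]
    proof eventually_elim
      case (elim e)
      show ?case
      proof (safe)
        fix t x assume tx: "(t, x) \<in> A e"
        obtain t1 where t1: "(t1, x + r * (\<theta> e t1 - \<theta> e t)) \<in> S e"
          "\<And>s. s \<in> closed_segment t1 t \<Longrightarrow> (s, x + r * (\<theta> e s - \<theta> e t)) \<in> A e"
          using elim(3) tx by blast
        \<comment> \<open>The foot at time 0 of the characteristic through the point, because
          \<theta> vanishes there.\<close>
        define y where "y = x - r * \<theta> e t"
        have y: "y + r * \<theta> e s = x + r * (\<theta> e s - \<theta> e t)" for s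
          by (simp add: y_def algebra_simps)
        have seg: "(s, y + r * \<theta> e s) \<in> A e" if "s \<in> closed_segment t1 t" for s
          using t1(2)[OF that] y by simp
        have str: "0 \<le> s \<and> s \<le> T" if "s \<in> closed_segment t1 t" for s
          using seg[OF that] elim(2) by (auto simp: strip_def)
        have tt: "0 \<le> t1" "t1 \<le> T" "0 \<le> t" "t \<le> T" using str[of t1] str[of t] by auto
        have "\<bar>ev f e (t, y + r * \<theta> e t)\<bar> \<le>
          sqrt M / sqrt m * (\<bar>ev f e (t1, y + r * \<theta> e t1)\<bar> + T * M * e powr (- q))"
        proof (rule transport_bound[OF _ r])
          show "smooth_on half_plane (ev f e)" by (rule smooth_on_ev[OF elim(1)])
          fix s assume s: "s \<in> closed_segment t1 t"
          have "ev (P r f + b * f) e (s, y + r * \<theta> e s) =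
             partial_t (ev f e) (s, y + r * \<theta> e s) / cc e s
            + r * partial_x (ev f e) (s, y + r * \<theta> e s)
            + dcc e s / (2 * (cc e s)\<^sup>2) * ev f e (s, y + r * \<theta> e s)"
            using elim(1) str[OF s]
            by (simp add: P_def T_def ev_add ev_mult ev_ci ev_b ev_D ev_cst half_plane_iff
                basis_t basis_x del: greaterThanAtMost_iff)
          then show "\<bar>partial_t (ev f e) (s, y + r * \<theta> e s) / cc e s
            + r * partial_x (ev f e) (s, y + r * \<theta> e s)
            + dcc e s / (2 * (cc e s)\<^sup>2) * ev f e (s, y + r * \<theta> e s)\<bar> \<le> e powr (- q)"
            using elim(5) seg[OF s] by metis
        qed (use cc_bounds[OF elim(1)] m cc_deriv[OF elim(1)] \<theta>_deriv[OF elim(1)] tt in auto)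
        also have "\<dots> \<le> sqrt M / sqrt m * (e powr (- q) + T * M * e powr (- q))"
          using elim(4) t1(1) m M by (intro mult_left_mono add_right_mono) (auto simp: y)
        also have "\<dots> = K * e powr (- q)" by (simp add: K_def algebra_simps add_divide_distrib)
        finally show "\<bar>ev f e (t, x)\<bar> \<le> K * e powr (- q)" by (simp add: y)
      qed
    qed
  qed
qed

text \<open>By strong induction the source of the equation for the \<open>k\<close>-th power is
  already bounded on \<open>A\<close> with the same exponent \<open>p\<close>; the data on
  \<open>S\<close> then supply the rest.\<close>

lemma propagation:
  assumes r: "r = 1 \<or> r = -1" and A: "in_strip A" and reach: "reachable r S A"
    and u: "grows A p (ev u)" "grows A p (ev (P r u))"
    and n: "\<And>g. g \<in> words n \<Longrightarrow> grows A p (ev g)"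
    and S: "\<And>k. grows S p (ev ((P (- r) ^^ k) u))"
  shows "grows A p (ev ((P (- r) ^^ k) u))"
proof (induction k rule: less_induct)
  case (less k)
  show ?case
  proof (cases k)
    case 0
    then show ?thesis using u by simp
  next
    case (Suc j)
    have r2: "r * r = 1" using r by auto
    have "grows A p (ev g)" if "g \<in> lower r j" for g
      using that less Suc u n unfolding lower_def by auto
    from slow_span_grows[OF A this transport_commutator[OF r2, of j]]
    have "grows A p (ev (P r ((P (- r) ^^ Suc j) u) + b * (P (- r) ^^ Suc j) u))" by blast
    then show ?thesis unfolding Suc by (intro transport_net[OF r A reach S])
  qed
qed

end

section \<open>The mollified speed\<close>

abbreviation nth_deriv :: "nat \<Rightarrow> (real \<Rightarrow> real) \<Rightarrow> real \<Rightarrow> real" where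
  "nth_deriv k f \<equiv> partials_on UNIV (replicate k 1) f"

lemma replicate_in_Basis: "replicate k (1::real) \<in> lists Basis"
  by (induction k) auto

lemma nth_deriv_has_derivative:
  assumes "smooth_on UNIV f"
  shows "(nth_deriv k f has_real_derivative nth_deriv (Suc k) f x) (at x)"
  using partial_on_real_has_derivative[of "nth_deriv k f" x] assms replicate_in_Basis[of k]
  by (simp add: smooth_on_alt)

text \<open>The initial order \<open>k\<^sub>0\<close> covers two cases: the scaled mollifier is a
  rescaling of \<phi> itself, whereas for the mollified speed only the first derivative is.\<close>

lemma nth_deriv_scaled_affine:
  assumes f: "smooth_on UNIV f"
    and eq: "\<And>x. nth_deriv k\<^sub>0 g x = a * f (s * x + d)"
  shows "nth_deriv (k + k\<^sub>0) g x = a * s ^ k * nth_deriv k f (s * x + d)"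
proof (induction k arbitrary: x)
  case 0
  then show ?case by (simp add: eq)
next
  case (Suc k)
  have "(nth_deriv (k + k\<^sub>0) g has_real_derivative a * s ^ Suc k * nth_deriv (Suc k) f (s * x + d)) (at x)"
    unfolding Suc[abs_def]
    by (rule derivative_eq_intros DERIV_chain2[OF nth_deriv_has_derivative[OF f]] refl | simp)+
  then show ?case using partial_on_realI by simp
qed

section \<open>Properties of the mollifier\<close>

lemma mollifier_zero:
  assumes "admissible_mollifier \<phi>" "1 < \<bar>x\<bar>"
  shows "nth_deriv k \<phi> x = 0"
  using assms(2)
proof (induction k arbitrary: x)
  case 0
  show ?case
  proof (rule ccontr)
    assume "nth_deriv 0 \<phi> x \<noteq> 0"
    then have "x \<in> closure {x. \<phi> x \<noteq> 0}" using closure_subset by fastforce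
    then have "x \<in> {-1..1}" using assms(1) unfolding admissible_mollifier_def by blast
    then show False using 0 by (auto simp: abs_if split: if_splits)
  qed
next
  case (Suc k)
  have op: "open {x::real. 1 < \<bar>x\<bar>}"
    by (intro open_Collect_less continuous_intros)
  have "(nth_deriv k \<phi> has_real_derivative 0) (at x)"
    by (rule has_field_derivative_transform_within_open[of "\<lambda>x. 0" _ _ "{x. 1 < \<bar>x\<bar>}"])
      (use op Suc in auto)
  then show ?case using partial_on_realI by simp
qed

lemma mollifier_smooth: "admissible_mollifier \<phi> \<Longrightarrow> smooth_on UNIV \<phi>"
  by (simp add: admissible_mollifier_def)

text \<open>On the left half axis \<phi> rises from its value 0 at -2, a point strictly outside the
  support; evenness gives the right half.\<close>

lemma mollifier_nonneg:
  assumes "admissible_mollifier \<phi>"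
  shows "0 \<le> \<phi> x"
proof -
  have neg: "0 \<le> \<phi> x" if "-1 \<le> x" "x \<le> 0" for x
  proof -
    have "\<phi> (-2) \<le> \<phi> x"
    proof (rule DERIV_nonneg_imp_nondecreasing[where f = \<phi> and a = "-2" and b = x])
      fix y assume y: "-2 \<le> y" "y \<le> x"
      have d: "(\<phi> has_real_derivative nth_deriv 1 \<phi> y) (at y)"
        using nth_deriv_has_derivative[OF mollifier_smooth[OF assms], of 0 y] by simp
      have "0 \<le> nth_deriv 1 \<phi> y"
      proof (cases "-1 \<le> y")
        case True
        then show ?thesis
          using assms y that unfolding admissible_mollifier_def DERIV_imp_deriv[OF d, symmetric] by auto
      qed (use mollifier_zero[OF assms, of y 1] in auto)
      then show "\<exists>d. (\<phi> has_real_derivative d) (at y) \<and> 0 \<le> d" using d by blast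
    qed (use that in simp)
    then show ?thesis using mollifier_zero[OF assms, of "-2" 0] by simp
  qed
  have even: "\<phi> (- x) = \<phi> x" for x using assms by (simp add: admissible_mollifier_def)
  consider "1 < \<bar>x\<bar>" | "-1 \<le> x" "x \<le> 0" | "-1 \<le> -x" "-x \<le> 0" by linarith
  then show ?thesis
  proof cases
    case 1
    then show ?thesis using mollifier_zero[OF assms, of x 0] by simp
  next
    case 2
    then show ?thesis by (rule neg)
  next
    case 3
    then show ?thesis using neg[of "- x"] even by simp
  qed
qed

lemma mollifier_nth_deriv_bounded:
  assumes "admissible_mollifier \<phi>"
  obtains K where "0 < K" "\<And>x. \<bar>nth_deriv k \<phi> x\<bar> \<le> K"
proof -
  have "continuous_on {-1..1} (nth_deriv k \<phi>)"
    using mollifier_smooth[OF assms] replicate_in_Basis continuous_on_subset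
    unfolding smooth_on_alt by blast
  then have "bounded (nth_deriv k \<phi> ` {-1..1})"
    by (intro compact_imp_bounded compact_continuous_image) auto
  then obtain K where K: "0 < K" "\<And>x. x \<in> {-1..1} \<Longrightarrow> \<bar>nth_deriv k \<phi> x\<bar> \<le> K"
    unfolding bounded_pos by auto
  have "\<bar>nth_deriv k \<phi> x\<bar> \<le> K" for x
    using K mollifier_zero[OF assms, of x k] by (cases "\<bar>x\<bar> \<le> 1") (auto simp: abs_le_iff)
  then show ?thesis using that K by blast
qed

text \<open>If a derivative vanished identically, the preceding one would be constant and equal to
  its value 0 at the point 2. Descending reaches \<phi>, whose integral is 1.\<close>

lemma mollifier_nth_deriv_nonzero:
  assumes "admissible_mollifier \<phi>"
  obtains y where "nth_deriv k \<phi> y \<noteq> 0"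
proof -
  have "\<exists>y. nth_deriv k \<phi> y \<noteq> 0"
  proof (induction k)
    case 0
    show ?case
    proof (rule ccontr)
      assume "\<nexists>y. nth_deriv 0 \<phi> y \<noteq> 0"
      then have "\<phi> = (\<lambda>x. 0)" by auto
      then have "(LINT x|lborel. \<phi> x) = 0" by simp
      then show False using assms by (simp add: admissible_mollifier_def)
    qed
  next
    case (Suc k)
    then obtain y where y: "nth_deriv k \<phi> y \<noteq> 0" by blast
    show ?case
    proof (rule ccontr)
      assume *: "\<nexists>y. nth_deriv (Suc k) \<phi> y \<noteq> 0"
      have "\<forall>x. (nth_deriv k \<phi> has_real_derivative 0) (at x)"
        using nth_deriv_has_derivative[OF mollifier_smooth[OF assms], of k] * by metis
      then have "nth_deriv k \<phi> y = nth_deriv k \<phi> 2" by (rule DERIV_isconst_all)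
      then show False using y mollifier_zero[OF assms, of 2 k] by simp
    qed
  qed
  then show ?thesis using that by blast
qed

section \<open>The distribution function of the mollifier and the mollified speed\<close>

definition cumulative :: "(real \<Rightarrow> real) \<Rightarrow> real \<Rightarrow> real" where
  "cumulative \<phi> y = (LINT s|lborel. indicator {..y} s * \<phi> s)"

text \<open>The integral of a function that is not integrable is 0 by convention, but here it equals
  1.\<close>

lemma mollifier_integrable:
  assumes "admissible_mollifier \<phi>"
  shows "integrable lborel \<phi>"
  using assms not_integrable_integral_eq[of lborel \<phi>] by (auto simp: admissible_mollifier_def)

lemma mollifier_integrable_indicator:
  assumes "admissible_mollifier \<phi>"
  shows "integrable lborel (\<lambda>s. indicator {..y} s * \<phi> s)"
  using integrable_mult_indicator[OF _ mollifier_integrable[OF assms], of "{..y}"] by simp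

lemma cumulative_bounds:
  assumes "admissible_mollifier \<phi>"
  shows "0 \<le> cumulative \<phi> y" "cumulative \<phi> y \<le> 1"
proof -
  show "0 \<le> cumulative \<phi> y" unfolding cumulative_def
    by (intro integral_nonneg_AE) (auto simp: mollifier_nonneg[OF assms])
  have "cumulative \<phi> y \<le> (LINT s|lborel. \<phi> s)" unfolding cumulative_def
    by (intro integral_mono mollifier_integrable_indicator mollifier_integrable assms)
      (auto simp: indicator_def mollifier_nonneg[OF assms])
  then show "cumulative \<phi> y \<le> 1" using assms by (simp add: admissible_mollifier_def)
qed

lemma cumulative_left:
  assumes "admissible_mollifier \<phi>" "y < -1"
  shows "cumulative \<phi> y = 0"
proof -
  have "indicator {..y} s * \<phi> s = 0" for s
    using mollifier_zero[OF assms(1), of s 0] assms(2) by (auto simp: indicator_def)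
  then show ?thesis unfolding cumulative_def by (simp only:) simp
qed

lemma cumulative_right:
  assumes "admissible_mollifier \<phi>" "1 \<le> y"
  shows "cumulative \<phi> y = 1"
proof -
  have "indicator {..y} s * \<phi> s = \<phi> s" for s
    using mollifier_zero[OF assms(1), of s 0] assms(2) by (auto simp: indicator_def)
  then show ?thesis
    using assms(1) unfolding cumulative_def admissible_mollifier_def by (simp only:)
qed

lemma cumulative_deriv:
  assumes "admissible_mollifier \<phi>"
  shows "(cumulative \<phi> has_real_derivative \<phi> y) (at y)"
proof -
  \<comment> \<open>The point \<open>a\<close> lies left of the support, so integrating from
    \<open>a\<close> loses nothing, and \<open>y\<close> is interior to \<open>{a..b}\<close>, so
    the derivative is two-sided.\<close>
  define a b where "a = - \<bar>y\<bar> - 2" and "b = \<bar>y\<bar> + 2"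
  have y: "y \<in> {a<..<b}" by (auto simp: a_def b_def)
  have cont: "continuous_on S \<phi>" for S
    using smooth_on_continuous[OF mollifier_smooth[OF assms]] continuous_on_subset by blast
  have eq: "cumulative \<phi> x = integral {a..x} \<phi>" for x
  proof -
    have "indicator {..x} s * \<phi> s = indicator {a..x} s *\<^sub>R \<phi> s" for s
    proof (cases "a \<le> s")
      case False
      then have "\<phi> s = 0" using mollifier_zero[OF assms, of s 0] by (simp add: a_def)
      then show ?thesis by simp
    qed (simp add: indicator_def)
    then have "cumulative \<phi> x = (LINT s:{a..x}|lborel. \<phi> s)"
      unfolding cumulative_def set_lebesgue_integral_def by (simp only:)
    also have "\<dots> = integral {a..x} \<phi>"
      by (intro set_borel_integral_eq_integral borel_integrable_atLeastAtMost')
        (rule cont)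
    finally show ?thesis .
  qed
  have "((\<lambda>x. integral {a..x} \<phi>) has_real_derivative \<phi> y) (at y within {a..b})"
    using y by (intro integral_has_real_derivative cont) auto
  then have "((\<lambda>x. integral {a..x} \<phi>) has_real_derivative \<phi> y) (at y)"
    using y at_within_interior[of y "{a..b}"] by (simp add: interior_atLeastAtMost_real)
  then show ?thesis by (simp add: eq[abs_def])
qed

definition molli_speed :: "real \<Rightarrow> real \<Rightarrow> (real \<Rightarrow> real) \<Rightarrow> real \<Rightarrow> real \<Rightarrow> real" where
  "molli_speed c0 c1 \<phi> \<eta> t = c0 + (c1 - c0) * cumulative \<phi> ((t - 1) / \<eta>)"

text \<open>Substituting \<eta> times \<open>s\<close> for \<open>s\<close> turns the jump into the
  indicator of a half line, whose integral against \<phi> is the distribution function.\<close>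

lemma convolve_jump_speed:
  assumes "admissible_mollifier \<phi>" "0 < \<eta>"
  shows "convolve (jump_speed c0 c1) (scaled \<phi> \<eta>) = molli_speed c0 c1 \<phi> \<eta>"
proof
  fix t
  have "convolve (jump_speed c0 c1) (scaled \<phi> \<eta>) t =
      \<bar>\<eta>\<bar> *\<^sub>R (LINT s|lborel. jump_speed c0 c1 (t - (0 + \<eta> * s)) * scaled \<phi> \<eta> (0 + \<eta> * s))"
    unfolding convolve_def using assms(2) by (intro lborel_integral_real_affine) auto
  also have "\<dots> = (LINT s|lborel. \<eta> * (jump_speed c0 c1 (t - \<eta> * s) * scaled \<phi> \<eta> (\<eta> * s)))"
    using assms(2) by simp
  also have "(\<lambda>s. \<eta> * (jump_speed c0 c1 (t - \<eta> * s) * scaled \<phi> \<eta> (\<eta> * s))) =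
      (\<lambda>s. c0 * \<phi> s + (c1 - c0) * (indicator {..(t - 1) / \<eta>} s * \<phi> s))"
  proof
    fix s
    \<comment> \<open>The value \<open>heaviside 0 = 1\<close> matches the closed half line in
      \<open>cumulative\<close>.\<close>
    have "0 \<le> t - \<eta> * s - 1 \<longleftrightarrow> s \<le> (t - 1) / \<eta>" using assms(2) by (simp add: field_simps)
    then show "\<eta> * (jump_speed c0 c1 (t - \<eta> * s) * scaled \<phi> \<eta> (\<eta> * s)) =
      c0 * \<phi> s + (c1 - c0) * (indicator {..(t - 1) / \<eta>} s * \<phi> s)"
      using assms(2) by (simp add: jump_speed_def heaviside_def scaled_def indicator_def algebra_simps)
  qed
  also have "(LINT s|lborel. c0 * \<phi> s + (c1 - c0) * (indicator {..(t - 1) / \<eta>} s * \<phi> s)) =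
      c0 * (LINT s|lborel. \<phi> s) + (c1 - c0) * (LINT s|lborel. indicator {..(t - 1) / \<eta>} s * \<phi> s)"
    using mollifier_integrable[OF assms(1)] mollifier_integrable_indicator[OF assms(1)] by simp
  finally show "convolve (jump_speed c0 c1) (scaled \<phi> \<eta>) t = molli_speed c0 c1 \<phi> \<eta> t"
    using assms(1) by (simp add: molli_speed_def cumulative_def admissible_mollifier_def)
qed

text \<open>The value of the distribution function is the weight of a convex combination of
  \<open>c0\<close> and \<open>c1\<close>.\<close>

lemma molli_speed_bounds:
  assumes "admissible_mollifier \<phi>"
  shows "min c0 c1 \<le> molli_speed c0 c1 \<phi> \<eta> t" "molli_speed c0 c1 \<phi> \<eta> t \<le> max c0 c1"
proof -
  define y where "y = cumulative \<phi> ((t - 1) / \<eta>)"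
  have y: "0 \<le> y" "y \<le> 1" using cumulative_bounds[OF assms] by (auto simp: y_def)
  have eq: "molli_speed c0 c1 \<phi> \<eta> t = (1 - y) * c0 + y * c1"
    by (simp add: molli_speed_def y_def algebra_simps)
  have "(1 - y) * min c0 c1 + y * min c0 c1 \<le> (1 - y) * c0 + y * c1"
    using y by (intro add_mono mult_left_mono) auto
  then show "min c0 c1 \<le> molli_speed c0 c1 \<phi> \<eta> t" unfolding eq by (simp add: algebra_simps)
  have "(1 - y) * c0 + y * c1 \<le> (1 - y) * max c0 c1 + y * max c0 c1"
    using y by (intro add_mono mult_left_mono) auto
  then show "molli_speed c0 c1 \<phi> \<eta> t \<le> max c0 c1" unfolding eq by (simp add: algebra_simps)
qed

lemma molli_speed_deriv:
  assumes "admissible_mollifier \<phi>" "0 < \<eta>"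
  shows "(molli_speed c0 c1 \<phi> \<eta> has_real_derivative (c1 - c0) * \<phi> ((t - 1) / \<eta>) / \<eta>) (at t)"
proof -
  have "((\<lambda>t. (t - 1) / \<eta>) has_real_derivative 1 / \<eta>) (at t)"
    using assms(2) by (auto intro!: derivative_eq_intros)
  from DERIV_chain2[OF cumulative_deriv[OF assms(1)] this]
  show ?thesis unfolding molli_speed_def by (auto intro!: derivative_eq_intros)
qed

lemma molli_speed_nth_deriv:
  assumes "admissible_mollifier \<phi>" "0 < \<eta>"
  shows "nth_deriv (Suc k) (molli_speed c0 c1 \<phi> \<eta>) t =
     (c1 - c0) * nth_deriv k \<phi> ((t - 1) / \<eta>) / \<eta> ^ Suc k"
proof -
  have "nth_deriv (k + 1) (molli_speed c0 c1 \<phi> \<eta>) t =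
     (c1 - c0) / \<eta> * (1 / \<eta>) ^ k * nth_deriv k \<phi> (1 / \<eta> * t + - 1 / \<eta>)"
  proof (rule nth_deriv_scaled_affine[OF mollifier_smooth[OF assms(1)]])
    fix x
    have "1 / \<eta> * x + - 1 / \<eta> = (x - 1) / \<eta>" by (simp add: diff_divide_distrib)
    then show "nth_deriv 1 (molli_speed c0 c1 \<phi> \<eta>) x = (c1 - c0) / \<eta> * \<phi> (1 / \<eta> * x + - 1 / \<eta>)"
      using partial_on_realI[OF molli_speed_deriv[OF assms]] by simp
  qed
  moreover have "1 / \<eta> * t + - 1 / \<eta> = (t - 1) / \<eta>" by (simp add: diff_divide_distrib)
  ultimately show ?thesis by (simp add: power_divide)
qed

lemma scaled_nth_deriv:
  assumes "admissible_mollifier \<phi>" "0 < \<eta>"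
  shows "nth_deriv k (scaled \<phi> \<eta>) x = nth_deriv k \<phi> (x / \<eta>) / \<eta> ^ Suc k"
proof -
  have "nth_deriv (k + 0) (scaled \<phi> \<eta>) x = 1 / \<eta> * (1 / \<eta>) ^ k * nth_deriv k \<phi> (1 / \<eta> * x + 0)"
    by (rule nth_deriv_scaled_affine[OF mollifier_smooth[OF assms(1)]]) (simp add: scaled_def)
  then show ?thesis by (simp add: power_divide)
qed

text \<open>
  The \<open>k\<close>-th derivative of the speed has size \<open>1 / h ^ k\<close>, so a bound with an exponent independent of
  \<open>k\<close> makes \<open>1 / h\<close> a slow scale net.
\<close>

lemma slow_scale_of_regular_speed:
  assumes \<phi>: "admissible_mollifier \<phi>" and h: "\<forall>e\<in>{0<..1}. 0 < h e" "(h \<longlongrightarrow> 0) (at_right 0)"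
    and c: "c0 \<noteq> c1"
    and reg: "\<And>bs. bs \<in> lists Basis \<Longrightarrow>
      grows (\<lambda>e. {0..2}) p (\<lambda>e. partials_on UNIV bs (molli_speed c0 c1 \<phi> (h e)))"
    and d: "0 < d"
  shows "\<forall>\<^sub>F e in at_right 0. 1 / h e \<le> e powr (- d)"
proof -
  \<comment> \<open>Large enough that the root of order \<open>Suc k\<close> of
    \<open>e powr (- (|p| + 2))\<close> is at most \<open>e powr (- d)\<close>.\<close>
  obtain k where k: "(\<bar>p\<bar> + 2) / d < real k" using reals_Archimedean2 by blast
  then have kd: "\<bar>p\<bar> + 2 \<le> real (Suc k) * d" using d by (simp add: field_simps)
  obtain y where y: "nth_deriv k \<phi> y \<noteq> 0" by (rule mollifier_nth_deriv_nonzero[OF \<phi>])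
  then have y1: "\<bar>y\<bar> \<le> 1" using mollifier_zero[OF \<phi>, of y k] by force
  define K where "K = \<bar>c1 - c0\<bar> * \<bar>nth_deriv k \<phi> y\<bar>"
  have K: "K > 0" using c y by (simp add: K_def)
  have "\<forall>\<^sub>F e in at_right 0. h e < 1" using h(2) by (rule order_tendstoD) simp
  moreover have "\<forall>\<^sub>F e in at_right 0. \<forall>z\<in>{0..2}.
      \<bar>nth_deriv (Suc k) (molli_speed c0 c1 \<phi> (h e)) z\<bar> \<le> e powr (- (\<bar>p\<bar> + 1))"
    by (rule growsD[OF reg[OF replicate_in_Basis]]) simp
  \<comment> \<open>Of the two units added to \<open>|p|\<close>, the first covers the loss
    permitted by \<open>grows\<close> and the second absorbs \<open>1 / K\<close>.\<close>
  moreover have "\<forall>\<^sub>F e in at_right 0. 1 / K * e powr (- (\<bar>p\<bar> + 1)) \<le> e powr (- (\<bar>p\<bar> + 2))"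
    by (rule eventually_powr_absorb) simp
  ultimately show ?thesis using eventually_unit
  proof eventually_elim
    case (elim e)
    have h0: "0 < h e" and e: "0 < e" "e \<le> 1" using h(1) elim(4) by auto
    \<comment> \<open>The time at which the rescaled argument is \<open>y\<close>, where the
      derivative of \<phi> does not vanish; it lies in \<open>{0..2}\<close> once
      \<open>h e < 1\<close>.\<close>
    define z where "z = 1 + h e * y"
    have "\<bar>h e * y\<bar> \<le> 1 * 1" unfolding abs_mult using h0 elim(1) y1 by (intro mult_mono) auto
    then have z: "z \<in> {0..2}" by (auto simp: z_def abs_le_iff)
    have "(z - 1) / h e = y" using h0 by (simp add: z_def)
    then have "\<bar>nth_deriv (Suc k) (molli_speed c0 c1 \<phi> (h e)) z\<bar> = K / h e ^ Suc k"
      unfolding molli_speed_nth_deriv[OF \<phi> h0] K_def using h0 by (simp add: abs_mult)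
    then have "K / h e ^ Suc k \<le> e powr (- (\<bar>p\<bar> + 1))" using elim(2) z by metis
    then have "(1 / h e) ^ Suc k \<le> 1 / K * e powr (- (\<bar>p\<bar> + 1))"
      using K h0 by (simp add: power_divide field_simps)
    also have "\<dots> \<le> e powr (- (\<bar>p\<bar> + 2))" by (rule elim(3))
    also have "\<dots> \<le> e powr (- (real (Suc k) * d))"
      using e kd by (intro powr_mono') auto
    also have "\<dots> = (e powr (- d)) ^ Suc k"
      using e by (simp add: powr_powr powr_realpow[symmetric] mult.commute del: of_nat_Suc power_Suc)
    finally show ?case by (rule power_le_imp_le_base) simp
  qed
qed

section \<open>Nets depending on time only\<close>

definition tnet :: "(real \<Rightarrow> real \<Rightarrow> real) \<Rightarrow> snet" where
  "tnet a = snet_of (\<lambda>e z. a e (fst z))"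

context
  fixes a :: "real \<Rightarrow> real \<Rightarrow> real"
  assumes a: "\<And>e. e \<in> {0<..1} \<Longrightarrow> smooth_on UNIV (a e)"
begin

lemma smooth_net_time: "smooth_net (\<lambda>e z. a e (fst z))"
  using a smooth_on_time_function by (auto simp: smooth_net_def)

lemma ev_tnet: "e \<in> {0<..1} \<Longrightarrow> 0 \<le> t \<Longrightarrow> ev (tnet a) e (t, x) = a e t"
  using ev_snet_of_apply[OF smooth_net_time, of e "(t, x)"] by (simp add: tnet_def half_plane_iff)

lemma ev_D_tnet:
  assumes "e \<in> {0<..1}" "0 \<le> t"
  shows "ev (Dt (tnet a)) e (t, x) = partial_on UNIV 1 (a e) t" "ev (Dx (tnet a)) e (t, x) = 0"
proof -
  have "partial_on half_plane b (ev (tnet a) e) (t, x) = partial_on half_plane b (\<lambda>z. a e (fst z)) (t, x)" for b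
    using assms by (intro partial_on_cong) (auto simp: ev_tnet half_plane_iff simp del: greaterThanAtMost_iff)
  then show "ev (Dt (tnet a)) e (t, x) = partial_on UNIV 1 (a e) t" "ev (Dx (tnet a)) e (t, x) = 0"
    using assms time_function_partials(3,4)[OF smooth_on_partial_exists[OF a], of e "(t, x)"]
    by (auto simp: ev_D basis_t basis_x half_plane_iff simp del: greaterThanAtMost_iff)
qed

lemma X_tnet: "Dx (tnet a) = 0"
proof (rule snet_eqI)
  fix e :: real and z :: "real \<times> real" assume *: "e \<in> {0<..1}" "z \<in> half_plane"
  then show "ev (Dx (tnet a)) e z = ev 0 e z"
    using ev_D_tnet(2)[of e "fst z" "snd z"] by (auto simp: ev_zero half_plane_def)
qed

end

lemma D_tnet:
  assumes "\<And>e. e \<in> {0<..1} \<Longrightarrow> smooth_on UNIV (a e)"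
  shows "Dt (tnet a) = tnet (\<lambda>e. partial_on UNIV 1 (a e))"
proof (rule snet_eqI)
  fix e :: real and z :: "real \<times> real" assume *: "e \<in> {0<..1}" "z \<in> half_plane"
  have sm: "smooth_on UNIV (partial_on UNIV 1 (a e))" if "e \<in> {0<..1}" for e
    using assms[OF that] by (rule smooth_on_partial) simp
  show "ev (Dt (tnet a)) e z = ev (tnet (\<lambda>e. partial_on UNIV 1 (a e))) e z"
    using ev_D_tnet(1)[of a e "fst z" "snd z", OF assms *(1)] *(2)
      ev_tnet[of "\<lambda>e. partial_on UNIV 1 (a e)" e "fst z" "snd z", OF sm *(1)]
    by (auto simp: half_plane_def)
qed

lemma D_pow_tnet:
  assumes "\<And>e. e \<in> {0<..1} \<Longrightarrow> smooth_on UNIV (a e)"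
  shows "(Dt ^^ k) (tnet a) = tnet (\<lambda>e. nth_deriv k (a e))"
proof (induction k)
  case (Suc k)
  have "smooth_on UNIV (nth_deriv k (a e))" if "e \<in> {0<..1}" for e
    using assms[OF that] replicate_in_Basis by (rule smooth_on_partials)
  from D_tnet[of "\<lambda>e. nth_deriv k (a e)", OF this] show ?case using Suc by simp
qed simp

lemma slow_of_nat: "slow (of_nat k)"
  by (induction k) (auto intro: slow_zero slow_add slow_one)

lemma derivation_power:
  assumes "derivation E"
  shows "E (f ^ Suc k) = of_nat (Suc k) * f ^ k * E f"
  by (induction k) (auto simp: derivation_mult[OF assms] algebra_simps)

lemma strip_in_strip: "in_strip (\<lambda>e. strip T)"
  by (auto simp: in_strip_def)

text \<open>Differentiating \<open>c * ci = 1\<close> gives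
  \<open>D b ci = - D b c * (ci * ci)\<close>. Hence the powers of \<open>ci\<close> span a module
  closed under derivatives, and a bound on \<open>ci\<close> alone passes to all of them.\<close>

lemma slow_inverse:
  assumes c: "slow c" and inv: "c * ci = 1" and bd: "\<And>T. grows (\<lambda>e. strip T) 0 (ev ci)"
  shows "slow ci"
  unfolding slow_def
proof (intro ballI allI)
  fix bs :: "(real \<times> real) list" and T assume bs: "bs \<in> lists Basis"
  let ?G = "range (\<lambda>j. ci ^ j)"
  show "grows (\<lambda>e. strip T) 0 (ev (Ds bs ci))"
  proof (rule slow_span_grows_Ds[OF strip_in_strip, where G = ?G])
    show "ci \<in> slow_span ?G" by (rule slow_span.base) (metis power_one_right rangeI)
    fix g assume "g \<in> ?G"
    then obtain j where g: "g = ci ^ j" by blast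
    have "grows (\<lambda>e. strip T) 0 (ev (ci ^ j))"
    proof (induction j)
      case 0
      then show ?case using slow_grows[OF slow_one strip_in_strip] by simp
    next
      case (Suc j)
      then show ?case using grows_ev_mult[OF bd Suc] by simp
    qed
    then show "grows (\<lambda>e. strip T) 0 (ev g)" using g by simp
    fix b :: "real \<times> real" assume b: "b \<in> Basis"
    note der = derivation_D[OF b]
    have "D b c * ci + c * D b ci = 0"
      using derivation_mult[OF der, of c ci] inv derivation_one[OF der] by simp
    then have "ci * (D b c * ci + c * D b ci) = 0" by simp
    then have "D b ci + D b c * ci * ci = (1 - c * ci) * D b ci"
      by (simp add: algebra_simps)
    then have Dci: "D b ci = - D b c * (ci * ci)"
      using inv by (simp add: algebra_simps eq_neg_iff_add_eq_0)
    show "D b g \<in> slow_span ?G"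
    proof (cases j)
      case 0
      then show ?thesis by (simp add: g derivation_one[OF der] slow_span.zero)
    next
      case (Suc i)
      have "D b g = of_nat (Suc i) * (- D b c * ci ^ (i + 2))"
        unfolding g Suc derivation_power[OF der] Dci by (simp add: algebra_simps)
      then show ?thesis
        by (simp only:) (intro slow_span.mult slow_of_nat slow_minus slow_D[OF c b] slow_span.base rangeI)
    qed
  qed (rule bs)
qed

section \<open>Regularity off and singularity on the two characteristics\<close>

text \<open>The integral of the jump speed from 0 to \<open>t\<close> in closed form; its only kink,
  at time 1, is the exceptional point in the fundamental theorem below.\<close>

definition travel :: "real \<Rightarrow> real \<Rightarrow> real \<Rightarrow> real" where
  "travel c0 c1 t = c0 * t + (c1 - c0) * max 0 (t - 1)"

lemma jump_speed_has_integral: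
  assumes "0 \<le> t"
  shows "(jump_speed c0 c1 has_integral travel c0 c1 t) {0..t}"
proof -
  have "(jump_speed c0 c1 has_integral travel c0 c1 t - travel c0 c1 0) {0..t}"
  proof (rule fundamental_theorem_of_calculus_interior_strong[of "{1}"])
    show "continuous_on {0..t} (travel c0 c1)"
      unfolding travel_def by (intro continuous_intros)
    fix s assume s: "s \<in> {0<..<t} - {1}"
    have "(travel c0 c1 has_real_derivative jump_speed c0 c1 s) (at s)"
    proof (cases "s < 1")
      case True
      have "((\<lambda>t. c0 * t) has_real_derivative c0) (at s)" by (auto intro!: derivative_eq_intros)
      then have "(travel c0 c1 has_real_derivative c0) (at s)"
        by (rule has_field_derivative_transform_within_open[of _ _ _ "{..<1}"])
          (use True in \<open>auto simp: travel_def max_def\<close>)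
      then show ?thesis using True by (simp add: jump_speed_def heaviside_def)
    next
      case False
      have "((\<lambda>t. c0 * t + (c1 - c0) * (t - 1)) has_real_derivative c1) (at s)"
        by (auto intro!: derivative_eq_intros)
      then have "(travel c0 c1 has_real_derivative c1) (at s)"
        by (rule has_field_derivative_transform_within_open[of _ _ _ "{1<..}"])
          (use False s in \<open>auto simp: travel_def max_def\<close>)
      then show ?thesis using False by (simp add: jump_speed_def heaviside_def)
    qed
    then show "(travel c0 c1 has_vector_derivative jump_speed c0 c1 s) (at s)"
      by (simp add: has_real_derivative_iff_has_vector_derivative)
  qed (use assms in auto)
  then show ?thesis by (simp add: travel_def)
qed

text \<open>\<open>h_slow\<close> has the form of the conclusion of
  \<open>slow_scale_of_regular_speed\<close>. Smoothness of the mollified speed will come from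
  moderateness of the representative of \<open>C\<close>.\<close>

locale mollified_speed =
  fixes c0 c1 :: real and \<phi> h :: "real \<Rightarrow> real"
  assumes c0: "0 < c0" and c1: "0 < c1"
    and \<phi>: "admissible_mollifier \<phi>"
    and h: "\<And>e. e \<in> {0<..1} \<Longrightarrow> 0 < h e" and h_lim: "(h \<longlongrightarrow> 0) (at_right 0)"
    and h_slow: "\<And>d. 0 < d \<Longrightarrow> \<forall>\<^sub>F e in at_right 0. 1 / h e \<le> e powr (- d)"
    and smooth_speed: "\<And>e. e \<in> {0<..1} \<Longrightarrow> smooth_on UNIV (molli_speed c0 c1 \<phi> (h e))"
begin

definition cc :: "real \<Rightarrow> real \<Rightarrow> real" where
  "cc e = molli_speed c0 c1 \<phi> (h e)"

definition c :: snet where "c = tnet cc"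
definition ci :: snet where "ci = tnet (\<lambda>e t. 1 / cc e t)"
definition b :: snet where "b = cst (1/2) * (ci * ci * Dt c)"
definition \<theta> :: "real \<Rightarrow> real \<Rightarrow> real" where "\<theta> e t = integral {0..t} (cc e)"

lemma speed_bounds: "min c0 c1 \<le> cc e t \<and> cc e t \<le> max c0 c1"
  using molli_speed_bounds[OF \<phi>] by (simp add: cc_def)

lemma cc_pos: "0 < cc e t"
  using speed_bounds[of e t] c0 c1 by linarith

lemma smooth_cc: "e \<in> {0<..1} \<Longrightarrow> smooth_on UNIV (cc e)"
  unfolding cc_def by (rule smooth_speed)

lemma smooth_inverse_cc: "e \<in> {0<..1} \<Longrightarrow> smooth_on UNIV (\<lambda>t. 1 / cc e t)"
  using smooth_on_inverse_real[OF smooth_cc, of e] cc_pos[of e] less_irrefl by metis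

lemma X_c: "Dx c = 0" and X_ci: "Dx ci = 0"
  unfolding c_def ci_def by (intro X_tnet smooth_cc smooth_inverse_cc; assumption)+

lemma ev_c: "e \<in> {0<..1} \<Longrightarrow> 0 \<le> t \<Longrightarrow> ev c e (t, x) = cc e t"
  unfolding c_def by (intro ev_tnet smooth_cc)

lemma ev_inverse_speed: "e \<in> {0<..1} \<Longrightarrow> 0 \<le> t \<Longrightarrow> ev ci e (t, x) = 1 / cc e t"
  unfolding ci_def by (intro ev_tnet smooth_inverse_cc)

lemma c_ci: "c * ci = 1"
proof (rule snet_eqI)
  fix e :: real and z :: "real \<times> real" assume *: "e \<in> {0<..1}" "z \<in> half_plane"
  moreover obtain t x where "z = (t, x)" by force
  ultimately show "ev (c * ci) e z = ev 1 e z"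
    using cc_pos[of e t]
    by (simp add: ev_mult ev_c ev_inverse_speed half_plane_iff ev_simps_raw(2) del: greaterThanAtMost_iff)
qed

text \<open>Since \<open>Dx c = 0\<close>, the pure time derivatives of \<open>c\<close> already
  span a module closed under both derivatives.\<close>

lemma slow_c: "slow c"
  unfolding slow_def
proof (intro ballI allI)
  fix bs :: "(real \<times> real) list" and T assume bs: "bs \<in> lists Basis"
  let ?G = "range (\<lambda>k. (Dt ^^ k) c)"
  show "grows (\<lambda>e. strip T) 0 (ev (Ds bs c))"
  proof (rule slow_span_grows_Ds[OF strip_in_strip, where G = ?G])
    show "c \<in> slow_span ?G" by (rule slow_span.base) (auto intro: image_eqI[of _ _ 0])
    fix g assume "g \<in> ?G"
    then obtain k where g: "g = (Dt ^^ k) c" by blast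
    have Dk: "(Dt ^^ k) (tnet cc) = tnet (\<lambda>e. nth_deriv k (cc e))"
      by (rule D_pow_tnet) (rule smooth_cc)
    have sm: "smooth_on UNIV (nth_deriv k (cc e))" if "e \<in> {0<..1}" for e
      by (rule smooth_on_partials[OF smooth_cc[OF that] replicate_in_Basis])
    have ev_g: "ev g e (t, x) = nth_deriv k (cc e) t" if "e \<in> {0<..1}" "0 \<le> t" for e t x
      unfolding g c_def Dk
      by (rule ev_tnet[of "\<lambda>e. nth_deriv k (cc e)", OF sm that])
    show "grows (\<lambda>e. strip T) 0 (ev g)"
    proof (cases k)
      case 0
      show ?thesis
        by (rule grows_bounded[where K = "max c0 c1"])
          (use speed_bounds cc_pos 0 ev_g in \<open>auto simp: strip_def less_imp_le simp del: greaterThanAtMost_iff\<close>)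
    next
      case (Suc j)
      obtain K where K: "0 < K" "\<And>x. \<bar>nth_deriv j \<phi> x\<bar> \<le> K"
        using mollifier_nth_deriv_bounded[OF \<phi>] by blast
      show ?thesis
      proof (rule growsI_limit)
        fix q :: real assume q: "0 < q"
        \<comment> \<open>The bound on the \<open>k\<close>-th derivative contains
          \<open>(1 / h e) ^ k\<close>; a share of \<open>q / k\<close> for each factor adds up to
          \<open>q\<close>.\<close>
        define d where "d = q / real k"
        have d: "0 < d" "real k * d = q" using q Suc by (auto simp: d_def)
        show "grows (\<lambda>e. strip T) q (ev g)"
        proof (rule growsI_bound[where K = "\<bar>c1 - c0\<bar> * K"])
          show "\<forall>\<^sub>F e in at_right 0. \<forall>z\<in>strip T. \<bar>ev g e z\<bar> \<le> \<bar>c1 - c0\<bar> * K * e powr (- q)"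
            using eventually_unit h_slow[OF d(1)]
          proof eventually_elim
            case (elim e)
            note h0 = h[OF elim(1)]
            have "(1 / h e) ^ k \<le> (e powr (- d)) ^ k"
              using elim(2) h0 by (intro power_mono) auto
            also have "\<dots> = e powr (- q)"
              using elim(1) d(2) by (simp add: powr_powr powr_realpow[symmetric] mult.commute)
            finally have hk: "(1 / h e) ^ k \<le> e powr (- q)" .
            show ?case
            proof (clarify)
              fix t x assume tx: "(t, x) \<in> strip T"
              have "ev g e (t, x) = (c1 - c0) * nth_deriv j \<phi> ((t - 1) / h e) * (1 / h e) ^ k"
                using ev_g[OF elim(1), of t x] tx
                unfolding Suc cc_def molli_speed_nth_deriv[OF \<phi> h0]
                by (simp add: strip_def power_divide)
              then have "\<bar>ev g e (t, x)\<bar> = \<bar>c1 - c0\<bar> * \<bar>nth_deriv j \<phi> ((t - 1) / h e)\<bar> * (1 / h e) ^ k"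
                using h0 by (simp add: abs_mult)
              also have "\<dots> \<le> \<bar>c1 - c0\<bar> * K * e powr (- q)"
                using K h0 hk by (intro mult_mono) auto
              finally show "\<bar>ev g e (t, x)\<bar> \<le> \<bar>c1 - c0\<bar> * K * e powr (- q)" .
            qed
          qed
        qed
      qed
    qed
    fix d :: "real \<times> real" assume "d \<in> Basis"
    then consider "d = (1, 0)" | "d = (0, 1)" by (auto simp: Basis_real2)
    then show "D d g \<in> slow_span ?G"
    proof cases
      case 1
      then have "D d g = (Dt ^^ Suc k) c" by (simp add: g)
      then show ?thesis by (metis rangeI slow_span.base)
    next
      case 2
      have "Dx ((Dt ^^ k) c) = 0"
        by (induction k) (auto simp: X_c D_commute[symmetric] derivation_zero derivation_D basis_t)
      then show ?thesis by (simp add: g 2 slow_span.zero)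
    qed
  qed (rule bs)
qed

lemma slow_ci: "slow ci"
proof (rule slow_inverse[OF slow_c c_ci])
  fix T
  show "grows (\<lambda>e. strip T) 0 (ev ci)"
  proof (rule grows_bounded[where K = "1 / min c0 c1"])
    fix e :: real and z assume "e \<in> {0<..1}" "z \<in> strip T"
    moreover obtain t x where "z = (t, x)" by force
    ultimately show "\<bar>ev ci e z\<bar> \<le> 1 / min c0 c1"
      using speed_bounds[of e t] cc_pos[of e t] c0 c1
      by (auto simp: ev_inverse_speed strip_def intro!: divide_left_mono simp del: greaterThanAtMost_iff)
  qed
qed

lemma slow_b: "slow b"
  unfolding b_def by (intro slow_mult slow_cst slow_ci slow_D slow_c basis_t)

lemma speed_deriv: "e \<in> {0<..1} \<Longrightarrow> (cc e has_real_derivative nth_deriv 1 (cc e) t) (at t within S)"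
  using nth_deriv_has_derivative[OF smooth_cc, of e 0 t] has_field_derivative_at_within by fastforce

lemma cc_continuous: "e \<in> {0<..1} \<Longrightarrow> continuous_on S (cc e)"
  using smooth_on_continuous[OF smooth_cc] continuous_on_subset by blast

lemma clock_deriv:
  assumes "e \<in> {0<..1}" "0 \<le> t"
  shows "(\<theta> e has_real_derivative cc e t) (at t within {0..})"
proof -
  have "(\<theta> e has_real_derivative cc e t) (at t within {0..t+1})"
    unfolding \<theta>_def by (rule integral_has_real_derivative[OF cc_continuous]) (use assms in auto)
  moreover have "at t within {0..t+1} = at t within {0..}"
    by (rule at_within_nhd[of t "{..<t+1}"]) auto
  ultimately show ?thesis by simp
qed

end

text \<open>The Cauchy problem read off from one representative. Of the initial velocity only its
  difference from the mollifier is negligible. Data are assumed only with their derivatives along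
  the initial line; time derivatives follow from the equation.\<close>

locale mollified_wave = mollified_speed +
  fixes u :: snet
  assumes moderate: "\<And>K bs. compact K \<Longrightarrow> K \<subseteq> half_plane \<Longrightarrow> bs \<in> lists Basis \<Longrightarrow>
       \<exists>p. grows (\<lambda>e. K) p (ev (Ds bs u))"
    and negligible: "\<And>K bs p. compact K \<Longrightarrow> K \<subseteq> half_plane \<Longrightarrow> bs \<in> lists Basis \<Longrightarrow>
       grows (\<lambda>e. K) p (ev (Ds bs (Dt (Dt u)
         - c * c * Dx (Dx u))))"
    and initial_value: "\<And>R k p. grows (\<lambda>e. {0} \<times> {-R..R}) p (ev ((Dx ^^ k) u))"
    and initial_velocity: "\<And>R k p. grows (\<lambda>e. {0} \<times> {-R..R}) p
       (\<lambda>e z. ev ((Dx ^^ k) (Dt u)) e z - nth_deriv k (scaled \<phi> e) (snd z))"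
begin

definition n :: snet where "n = Dt (Dt u) - c * c * Dx (Dx u)"

text \<open>Moving \<open>ci\<close> past \<open>Dt\<close> costs
  \<open>Dt ci = - (ci * ci * Dt c)\<close>. Its contribution is
  \<open>- (b + b) * (ci * Dt u)\<close>, which explains the factor 1/2 in \<open>b\<close>.\<close>

lemma wave_identity:
  "ci * Dt (ci * Dt u)
     = Dx (Dx u) - b * (ci * Dt u + ci * Dt u) + ci * ci * n"
proof -
  note der = derivation_D[OF basis_t]
  have "Dt c * ci + c * Dt ci = 0"
    using derivation_mult[OF der, of c ci] c_ci derivation_one[OF der] by simp
  then have "ci * (Dt c * ci + c * Dt ci) = 0" by simp
  then have "Dt ci + ci * ci * Dt c = (1 - c * ci) * Dt ci"
    by (simp add: algebra_simps)
  then have Dci: "Dt ci = - (ci * ci * Dt c)"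
    using c_ci by (simp add: algebra_simps eq_neg_iff_add_eq_0)
  have "cst (1/2) + cst (1/2) = 1" by (simp add: cst_add[symmetric] cst_one)
  then have "(cst (1/2) + cst (1/2)) * (ci * ci * Dt c) = ci * ci * Dt c" by simp
  then have bb: "b + b = ci * ci * Dt c" by (simp add: b_def algebra_simps)
  have cc4: "ci * ci * (c * c) = 1"
  proof -
    have "ci * ci * (c * c) = (c * ci) * (c * ci)" by (simp add: algebra_simps)
    then show ?thesis by (simp add: c_ci)
  qed
  have "ci * Dt (ci * Dt u) = ci * ci * Dt (Dt u) - (b + b) * (ci * Dt u)"
    by (simp add: derivation_mult[OF der] Dci bb algebra_simps)
  moreover have "Dt (Dt u) = c * c * Dx (Dx u) + n" by (simp add: n_def)
  moreover have "ci * ci * (c * c * Dx (Dx u) + n) = Dx (Dx u) + ci * ci * n"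
    using cc4 by (simp add: distrib_left mult.assoc[symmetric])
  ultimately show ?thesis by (simp add: algebra_simps)
qed

sublocale wave_flow u c ci b n "min c0 c1" "max c0 c1" cc "\<lambda>e. nth_deriv 1 (cc e)" \<theta>
proof
  show "Dx b = 0"
    by (simp add: b_def derivation_mult[OF derivation_X] X_ci D_cst basis_x D_commute[symmetric] X_c
        derivation_zero derivation_D basis_t)
  show "\<theta> e 0 = 0" for e by (simp add: \<theta>_def)
  show "ev b e (t, x) = nth_deriv 1 (cc e) t / (2 * (cc e t)\<^sup>2)" if "e \<in> {0<..1}" "0 \<le> t" for e t x
    using that ev_D_tnet(1)[of cc e t x, OF smooth_cc]
    by (simp add: b_def ev_mult ev_cst ev_inverse_speed half_plane_iff power2_eq_square c_def
        del: greaterThanAtMost_iff)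
qed (use slow_c slow_ci slow_b c_ci X_c X_ci wave_identity c0 c1 speed_bounds speed_deriv clock_deriv ev_inverse_speed in auto)

text \<open>The two speeds differ only within \<open>h e\<close> of the jump time, and there by at
  most \<open>|c1 - c0|\<close>; so the bound is uniform in \<open>t\<close>.\<close>

lemma \<theta>_travel:
  assumes "e \<in> {0<..1}" "0 \<le> t"
  shows "\<bar>\<theta> e t - travel c0 c1 t\<bar> \<le> 2 * \<bar>c1 - c0\<bar> * h e"
proof -
  note h0 = h[OF assms(1)]
  define f where "f s = cc e s - jump_speed c0 c1 s" for s
  have int: "(f has_integral \<theta> e t - travel c0 c1 t) {0..t}"
    unfolding f_def \<theta>_def
    by (intro has_integral_diff jump_speed_has_integral integrable_integral
        integrable_continuous_real cc_continuous assms)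
  have f0: "f s = 0" if "s \<notin> {1 - h e..1 + h e}" for s
  proof (cases "s < 1")
    case True
    then have "(s - 1) / h e < -1" using that h0 by (simp add: field_simps)
    then show ?thesis using True
      by (simp add: f_def cc_def molli_speed_def cumulative_left[OF \<phi>] jump_speed_def heaviside_def)
  next
    case False
    then have "1 \<le> (s - 1) / h e" using that h0 by (simp add: field_simps)
    then show ?thesis using False
      by (simp add: f_def cc_def molli_speed_def cumulative_right[OF \<phi>] jump_speed_def heaviside_def)
  qed
  have fb: "\<bar>f s\<bar> \<le> \<bar>c1 - c0\<bar>" for s
    using speed_bounds[of e s] by (auto simp: f_def jump_speed_def heaviside_def abs_if min_def max_def split: if_splits)
  define lo hi where "lo = max (1 - h e) 0" and "hi = min (1 + h e) t"
  have I: "{1 - h e..1 + h e} \<inter> {0..t} = {lo..hi}" by (auto simp: lo_def hi_def)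
  have "\<theta> e t - travel c0 c1 t = integral {0..t} f" using int by (simp add: integral_unique)
  also have "\<dots> = integral {0..t} (\<lambda>s. if s \<in> {1 - h e..1 + h e} then f s else 0)"
    using f0 by (intro integral_cong) auto
  also have "\<dots> = integral {lo..hi} f"
    unfolding I[symmetric] by (rule integral_restrict_Int)
  finally have eq: "\<theta> e t - travel c0 c1 t = integral {lo..hi} f" .
  have "f integrable_on {lo..hi}"
  proof (rule integrable_on_subinterval)
    show "f integrable_on {0..t}" using int by blast
    show "{lo..hi} \<subseteq> {0..t}" by (auto simp: lo_def hi_def)
  qed
  then have "(f has_integral integral {lo..hi} f) {lo..hi}" by (rule integrable_integral)
  from has_integral_bound_real[OF _ _ this, of "\<bar>c1 - c0\<bar>" "{}"] fb
  have "norm (integral {lo..hi} f) \<le> \<bar>c1 - c0\<bar> * measure lborel {lo..hi}" by simp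
  also have "\<dots> \<le> \<bar>c1 - c0\<bar> * (2 * h e)"
    using h0 by (intro mult_left_mono) (auto simp: lo_def hi_def content_real_if)
  finally show ?thesis using eq by simp
qed

lemma \<theta>_near_travel:
  assumes "0 < \<delta>"
  shows "\<forall>\<^sub>F e in at_right 0. \<forall>t\<ge>0. \<bar>\<theta> e t - travel c0 c1 t\<bar> \<le> \<delta>"
proof -
  have "((\<lambda>e. 2 * \<bar>c1 - c0\<bar> * h e) \<longlongrightarrow> 0) (at_right 0)"
    using h_lim by (rule tendsto_mult_right_zero)
  then have "\<forall>\<^sub>F e in at_right 0. 2 * \<bar>c1 - c0\<bar> * h e < \<delta>"
    using assms by (rule order_tendstoD)
  then show ?thesis using eventually_unit
    by eventually_elim (use \<theta>_travel in fastforce)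
qed

lemma n_words:
  assumes "g \<in> words n" "compact K" "K \<subseteq> half_plane" "\<forall>\<^sub>F e in at_right 0. A e \<subseteq> K"
  shows "grows A p (ev g)"
proof -
  obtain bs where "g = Ds bs n" "bs \<in> lists Basis" using assms(1) by (auto simp: words_def)
  then have "grows (\<lambda>e. K) p (ev g)"
    using negligible[OF assms(2,3), of bs p] by (simp add: n_def)
  then show ?thesis using assms(4) by (rule grows_mono[OF _ order_refl])
qed

lemma compact_box: "compact ({0..tm} \<times> {-R..R} :: (real \<times> real) set)"
  by (intro compact_Times) auto

lemma box_half_plane: "{0..tm} \<times> {-R..R} \<subseteq> half_plane"
  by (auto simp: half_plane_def)

text \<open>Every \<open>P r u\<close> is a slow combination of \<open>Dt u\<close> and
  \<open>Dx u\<close>, so the exponents of three nets suffice. Including 0 in the maximum yields the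
  nonnegative exponent that regularity asks for.\<close>

lemma moderate_first_order:
  obtains p where "0 \<le> p" "grows (\<lambda>e. {0..tm} \<times> {-R..R}) p (ev u)"
    "\<And>r. grows (\<lambda>e. {0..tm} \<times> {-R..R}) p (ev (P r u))"
proof -
  let ?K = "{0..tm} \<times> {-R..R} :: (real \<times> real) set"
  have st: "in_strip (\<lambda>e. ?K)" by (auto simp: in_strip_def strip_def)
  obtain p0 where p0: "grows (\<lambda>e. ?K) p0 (ev u)"
    using moderate[OF compact_box box_half_plane, of "[]"] by auto
  obtain p1 where p1: "grows (\<lambda>e. ?K) p1 (ev (Dt u))"
    using moderate[OF compact_box box_half_plane, of "[(1, 0)]"] by (auto simp: basis_t)
  obtain p2 where p2: "grows (\<lambda>e. ?K) p2 (ev (Dx u))"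
    using moderate[OF compact_box box_half_plane, of "[(0, 1)]"] by (auto simp: basis_x)
  define p where "p = max (max p0 p1) (max p2 0)"
  have mono: "grows (\<lambda>e. ?K) p f" if "grows (\<lambda>e. ?K) q f" "q \<le> p" for f q
    using that by (rule grows_mono) auto
  have g: "grows (\<lambda>e. ?K) p (ev u)" "grows (\<lambda>e. ?K) p (ev (Dt u))" "grows (\<lambda>e. ?K) p (ev (Dx u))"
    using mono[OF p0] mono[OF p1] mono[OF p2] by (auto simp: p_def)
  have mult: "grows (\<lambda>e. ?K) p (ev (a * f))" if "slow a" "grows (\<lambda>e. ?K) p (ev f)" for a f
    using grows_ev_mult[OF slow_grows[OF that(1) st] that(2)] by simp
  have "grows (\<lambda>e. ?K) p (ev (P r u))" for r
    unfolding P_def T_def by (intro grows_ev_add mult slow slow_cst g)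
  moreover have "0 \<le> p" by (simp add: p_def)
  ultimately show ?thesis using that g(1) by blast
qed

lemma continuous_on_travel: "continuous_on S (travel c0 c1)"
  unfolding travel_def[abs_def] by (intro continuous_intros)

definition characteristics :: "(real \<times> real) set" where
  "characteristics = {(t, x). 0 \<le> t \<and> (x = travel c0 c1 t \<or> x = - travel c0 c1 t)}"

lemma regular_off_characteristics:
  assumes K: "compact K" "K \<subseteq> half_plane - characteristics" "K \<noteq> {}"
  shows "\<exists>p\<ge>0. \<forall>bs\<in>lists Basis. grows (\<lambda>e. K) p (ev (Ds bs u))"
proof -
  define g where "g z = min \<bar>snd z - travel c0 c1 (fst z)\<bar> \<bar>snd z + travel c0 c1 (fst z)\<bar>"
    for z :: "real \<times> real"
  have "continuous_on K g"
    unfolding g_def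
    by (intro continuous_intros continuous_on_compose2[OF continuous_on_travel[of UNIV]]) auto
  then obtain z0 where z0: "z0 \<in> K" "\<And>z. z \<in> K \<Longrightarrow> g z0 \<le> g z"
    using continuous_attains_inf[OF K(1,3), of g] by blast
  have "0 < g z0" using z0(1) K(2) by (auto simp: g_def characteristics_def half_plane_def)
  \<comment> \<open>\<open>K\<close> keeps twice this distance from the limit curves. One \<delta>
    is spent on replacing \<open>travel\<close> by \<theta>; the other remains as a gap around the
    support of the initial velocity.\<close>
  define \<delta> where "\<delta> = g z0 / 2"
  have \<delta>: "0 < \<delta>" using \<open>0 < g z0\<close> by (simp add: \<delta>_def)
  have away: "2 * \<delta> \<le> \<bar>x - r * travel c0 c1 t\<bar>" if "(t, x) \<in> K" "r = 1 \<or> r = -1" for t x r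
    using z0(2)[OF that(1)] that(2) by (auto simp: g_def \<delta>_def)
  obtain tm where tm: "0 < tm" "\<And>z. z \<in> K \<Longrightarrow> norm z \<le> tm"
    using compact_imp_bounded[OF K(1)] by (auto simp: bounded_pos)
  have tx: "0 \<le> t \<and> t \<le> tm \<and> \<bar>x\<bar> \<le> tm" if "(t, x) \<in> K" for t x
    using tm(2)[OF that] norm_fst_le[of t x] norm_snd_le[of x t] K(2) that
    by (auto simp: half_plane_def)
  define M where "M = max c0 c1"
  have M: "0 < M" using c0 by (simp add: M_def)
  \<comment> \<open>On \<open>K\<close>, \<open>|x|\<close> is at most \<open>tm\<close> and
    \<open>|\<theta>|\<close> at most \<open>M * tm\<close>, so \<open>R\<close> bounds the feet of
    the characteristics. Returning from feet to positions costs \<open>M * tm\<close> again, which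
    gives \<open>R'\<close> and a fixed box around the moving region.\<close>
  define R where "R = tm + M * tm"
  define R' where "R' = R + M * tm"
  \<comment> \<open>\<open>x - r * \<theta> e t\<close> is constant along a characteristic of
    \<open>P r\<close> and equals its foot. The region thus consists of whole characteristic
    segments issuing from \<open>S\<close>, and it may cross the curve of opposite sign.\<close>
  define A where "A r e = {(t, x). 0 \<le> t \<and> t \<le> tm \<and> \<delta> \<le> \<bar>x - r * \<theta> e t\<bar> \<and> \<bar>x - r * \<theta> e t\<bar> \<le> R}"
    for r e
  define S where "S = {0::real} \<times> {x. \<delta> \<le> \<bar>x\<bar> \<and> \<bar>x\<bar> \<le> R}"
  have \<theta>b: "\<bar>r * \<theta> e t\<bar> \<le> M * tm" if "e \<in> {0<..1}" "0 \<le> t" "t \<le> tm" "r = 1 \<or> r = -1" for e t r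
  proof -
    have "\<bar>r * \<theta> e t\<bar> \<le> M * t" using \<theta>_bounds[OF that(1,2)] that(4) by (auto simp: M_def)
    also have "\<dots> \<le> M * tm" using that M by (intro mult_left_mono) auto
    finally show ?thesis .
  qed
  have AB: "\<forall>\<^sub>F e in at_right 0. A r e \<subseteq> {0..tm} \<times> {-R'..R'}" if r: "r = 1 \<or> r = -1" for r
    using eventually_unit
  proof eventually_elim
    case (elim e)
    show ?case
    proof
      fix z assume "z \<in> A r e"
      then obtain t x where z: "z = (t, x)" "0 \<le> t" "t \<le> tm" "\<bar>x - r * \<theta> e t\<bar> \<le> R" by (auto simp: A_def)
      show "z \<in> {0..tm} \<times> {-R'..R'}" using z \<theta>b[OF elim z(2,3) r] by (auto simp: R'_def)
    qed
  qed
  have strA: "in_strip (A r)" for r by (rule in_stripI[of _ tm]) (auto simp: A_def)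
  have "0 \<le> M * tm" using tm M by simp
  then have SB: "S \<subseteq> {0..tm} \<times> {-R'..R'}" using tm by (auto simp: S_def R'_def)
  have strS: "in_strip (\<lambda>e. S)" by (rule in_stripI[of _ tm]) (use tm in \<open>auto simp: S_def\<close>)
  have reach: "reachable r (\<lambda>e. S) (A r)" for r
    unfolding reachable_def using eventually_unit
  proof eventually_elim
    case (elim e)
    have "(0, x + r * (\<theta> e 0 - \<theta> e t)) \<in> S \<and>
        (\<forall>s\<in>closed_segment 0 t. (s, x + r * (\<theta> e s - \<theta> e t)) \<in> A r e)"
      if "(t, x) \<in> A r e" for t x
      using that \<theta>_0[OF elim]
      by (auto simp: S_def A_def closed_segment_eq_real_ivl algebra_simps split: if_splits)
    then show ?case by blast
  qed
  obtain p where p: "0 \<le> p" "grows (\<lambda>e. {0..tm} \<times> {-R'..R'}) p (ev u)"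
    "\<And>r. grows (\<lambda>e. {0..tm} \<times> {-R'..R'}) p (ev (P r u))"
    using moderate_first_order by blast
  have S0: "S \<subseteq> {0} \<times> {-R..R}" by (auto simp: S_def)
  have S_words: "grows (\<lambda>e. S) p (ev (Ds bs u))" if "bs \<in> lists Basis" for bs
  proof (rule regular_from_initial[OF strS])
    show "grows (\<lambda>e. S) p (ev ((Dx ^^ k) u))" for k
      using initial_value by (rule grows_mono[OF _ order_refl]) (use S0 in auto)
    show "grows (\<lambda>e. S) p (ev ((Dx ^^ k) (Dt u)))" for k
    proof (rule grows_cong)
      show "grows (\<lambda>e. S) p (\<lambda>e z. ev ((Dx ^^ k) (Dt u)) e z - nth_deriv k (scaled \<phi> e) (snd z))"
        using initial_velocity by (rule grows_mono[OF _ order_refl]) (use S0 in auto)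
      \<comment> \<open>From here on the support of \<open>scaled \<phi> e\<close> fits into the gap
        left by \<open>S\<close>, so the velocity has only negligible derivatives on
        \<open>S\<close>.\<close>
      have "\<forall>\<^sub>F e in at_right 0. e < \<delta>"
        using \<delta> by (intro order_tendstoD(2)[OF tendsto_ident_at])
      then show "\<forall>\<^sub>F e in at_right 0. \<forall>z\<in>S. \<bar>ev ((Dx ^^ k) (Dt u)) e z\<bar>
          \<le> \<bar>ev ((Dx ^^ k) (Dt u)) e z - nth_deriv k (scaled \<phi> e) (snd z)\<bar>"
        using eventually_unit
      proof eventually_elim
        case (elim e)
        have "nth_deriv k (scaled \<phi> e) (snd z) = 0" if "z \<in> S" for z
        proof -
          have "1 < \<bar>snd z / e\<bar>" using that elim by (auto simp: S_def abs_divide)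
          then show ?thesis using elim by (simp add: scaled_nth_deriv[OF \<phi>] mollifier_zero[OF \<phi>])
        qed
        then show ?case by simp
      qed
    qed
    show "grows (\<lambda>e. S) p (ev g)" if "g \<in> words n" for g
      by (rule n_words[OF that compact_box box_half_plane]) (use SB in auto)
  qed (rule that)
  have AL: "grows (A r) p (ev ((P (- r) ^^ k) u))" if r: "r = 1 \<or> r = -1" for r k
  proof (rule propagation[OF r strA reach])
    show "grows (A r) p (ev u)" "grows (A r) p (ev (P r u))"
      using p(2,3) by (auto intro: grows_mono[OF _ order_refl AB[OF r]])
    show "grows (A r) p (ev g)" if "g \<in> words n" for g
      by (rule n_words[OF that compact_box box_half_plane AB[OF r]])
    show "grows (\<lambda>e. S) p (ev ((P (- r) ^^ k) u))" for k
      by (rule powers_from_regular[OF strS S_words])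
  qed
  have KA: "\<forall>\<^sub>F e in at_right 0. K \<subseteq> A r e" if r: "r = 1 \<or> r = -1" for r
    using eventually_unit \<theta>_near_travel[OF \<delta>]
  proof eventually_elim
    case (elim e)
    show ?case
    proof (safe)
      fix t x assume z: "(t, x) \<in> K"
      note tx = tx[OF z]
      have "\<bar>r * \<theta> e t - r * travel c0 c1 t\<bar> \<le> \<delta>"
        using elim(2) tx r by (auto simp: abs_minus_commute)
      then show "(t, x) \<in> A r e"
        using away[OF z r] tx \<theta>b[OF elim(1) _ _ r, of t] by (auto simp: A_def R_def)
    qed
  qed
  have KK: "K \<subseteq> half_plane" using K by auto
  have "grows (\<lambda>e. K) p (ev (Ds bs u))" if "bs \<in> lists Basis" for bs
  proof (rule regular_from_powers)
    show "in_strip (\<lambda>e. K)" by (rule in_stripI[of _ tm]) (use tx in auto)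
    \<comment> \<open>Powers of \<open>P r\<close> are controlled on the region of opposite sign,
      \<open>A (- r)\<close>. Since \<open>K\<close> avoids both curves, it lies in both
      regions.\<close>
    show "grows (\<lambda>e. K) p (ev ((P r ^^ k) u))" if "r = 1 \<or> r = -1" for r k
      using grows_mono[OF AL[of "- r" k] order_refl KA[of "- r"]] that by auto
    show "grows (\<lambda>e. K) p (ev g)" if "g \<in> words n" for g
      by (rule n_words[OF that K(1) KK]) auto
  qed (rule that)
  then show ?thesis using p(1) by blast
qed

lemma mollifier_irregular:
  assumes "0 < \<delta>"
    and "\<And>k. grows (\<lambda>e. {0::real} \<times> {-\<delta>..\<delta>}) p (\<lambda>e z. nth_deriv k (scaled \<phi> e) (snd z))"
  shows False
proof -
  obtain k where k: "p + 1 < real k" using reals_Archimedean2 by blast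
  obtain y where y: "nth_deriv k \<phi> y \<noteq> 0" by (rule mollifier_nth_deriv_nonzero[OF \<phi>])
  then have y1: "\<bar>y\<bar> \<le> 1" using mollifier_zero[OF \<phi>, of y k] by force
  define Y where "Y = \<bar>nth_deriv k \<phi> y\<bar>"
  have Y: "0 < Y" using y by (simp add: Y_def)
  have "\<forall>\<^sub>F e in at_right 0. e < \<delta>"
    using assms(1) by (intro order_tendstoD(2)[OF tendsto_ident_at])
  moreover have "\<forall>\<^sub>F e in at_right 0. \<forall>z\<in>{0::real} \<times> {-\<delta>..\<delta>}.
      \<bar>nth_deriv k (scaled \<phi> e) (snd z)\<bar> \<le> e powr (- (p + 1))"
    by (rule growsD[OF assms(2)]) simp
  \<comment> \<open>The 2 in the factor makes the exact size of the derivative at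
    \<open>e * y\<close> contradict its upper bound strictly.\<close>
  moreover have "\<forall>\<^sub>F e in at_right 0. 2 / Y * e powr (- (p + 1)) \<le> e powr (- real (Suc k))"
    using k by (intro eventually_powr_absorb) simp
  ultimately have "\<forall>\<^sub>F e in at_right (0::real). False" using eventually_unit
  proof eventually_elim
    case (elim e)
    then have e: "0 < e" "e < \<delta>" by auto
    have "\<bar>e * y\<bar> \<le> e * 1" unfolding abs_mult using e y1 by (intro mult_mono) auto
    then have z: "(0, e * y) \<in> {0::real} \<times> {-\<delta>..\<delta>}" using e by auto
    have "\<bar>nth_deriv k (scaled \<phi> e) (e * y)\<bar> = Y / e ^ Suc k"
      using e by (simp add: scaled_nth_deriv[OF \<phi>] Y_def)
    also have "\<dots> = Y * e powr (- real (Suc k))"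
      using e by (simp only: powr_minus powr_realpow divide_inverse)
    finally have "Y * e powr (- real (Suc k)) \<le> e powr (- (p + 1))"
      using elim(2) z by force
    moreover have "2 * e powr (- (p + 1)) \<le> Y * e powr (- real (Suc k))"
      using elim(3) Y by (simp add: field_simps)
    ultimately have "2 * e powr (- (p + 1)) \<le> e powr (- (p + 1))" by linarith
    moreover have "0 < e powr (- (p + 1))" using e by simp
    ultimately show False by linarith
  qed
  then show False by simp
qed

lemma singular_on_characteristics:
  assumes r: "r = 1 \<or> r = -1" and t0: "0 \<le> t0" and x0: "x0 = r * travel c0 c1 t0"
    and \<Omega>: "openin (top_of_set half_plane) \<Omega>" "(t0, x0) \<in> \<Omega>"
    and reg: "\<And>K. compact K \<Longrightarrow> K \<subseteq> \<Omega> \<Longrightarrow> K \<noteq> {} \<Longrightarrow>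
       \<exists>p. \<forall>bs\<in>lists Basis. grows (\<lambda>e. K) p (ev (Ds bs u))"
  shows False
proof -
  obtain e where e: "e > 0" "ball (t0, x0) e \<inter> half_plane \<subseteq> \<Omega>"
    using \<Omega> by (meson openin_contains_ball)
  \<comment> \<open>The slice \<open>S\<close> lies within \<delta> of the regularised curve, which
    lies within \<delta> of the limit curve; a closed ball of radius \<open>2 * \<delta>\<close>
    still fits into the ball of radius \<open>e\<close>.\<close>
  define \<delta> where "\<delta> = e / 4"
  have \<delta>: "0 < \<delta>" using e by (simp add: \<delta>_def)
  define K where "K = half_plane \<inter> cball (t0, x0) (2 * \<delta>)"
  have "closed half_plane" unfolding half_plane_def by (intro closed_Times) auto
  then have K: "compact K" "K \<subseteq> half_plane" unfolding K_def by (auto intro: closed_Int_compact)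
  have K1: "K \<subseteq> \<Omega>" using e by (auto simp: K_def \<delta>_def)
  have K2: "K \<noteq> {}" 
  proof -
    have "(t0, x0) \<in> K" using t0 \<delta> by (simp add: K_def half_plane_iff)
    then show ?thesis by blast
  qed
  obtain p1 where p1: "\<And>bs. bs \<in> lists Basis \<Longrightarrow> grows (\<lambda>e. K) p1 (ev (Ds bs u))"
    using reg[OF K(1) K1 K2] by blast
  define M where "M = max c0 c1"
  have M: "0 < M" using c0 by (simp add: M_def)
  define R where "R = \<delta> + M * t0"
  obtain p2 where p2: "0 \<le> p2" "grows (\<lambda>e. {0..t0} \<times> {-R..R}) p2 (ev u)"
    "\<And>r. grows (\<lambda>e. {0..t0} \<times> {-R..R}) p2 (ev (P r u))"
    using moderate_first_order by blast
  \<comment> \<open>One exponent comes from the assumed regularity near the point, the other from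
    moderateness along the whole tube; neither depends on the power \<open>k\<close>.\<close>
  define p where "p = max p1 p2"
  \<comment> \<open>A tube of characteristics of \<open>P r\<close> around the regularised curve.
    Bounds enter on the slice \<open>S\<close> at time \<open>t0\<close> and travel backwards to the
    slice \<open>A0\<close> at time 0.\<close>
  define A where "A e = {(t, x). 0 \<le> t \<and> t \<le> t0 \<and> \<bar>x - r * \<theta> e t\<bar> \<le> \<delta>}" for e
  define S where "S e = {t0} \<times> {x. \<bar>x - r * \<theta> e t0\<bar> \<le> \<delta>}" for e
  define A0 where "A0 = {0::real} \<times> {-\<delta>..\<delta>}"
  have strA: "in_strip A" by (rule in_stripI[of _ t0]) (auto simp: A_def)
  have strK: "in_strip (\<lambda>e. K)"
  proof -
    have "t \<le> t0 + 2 * \<delta>" if "(t, x) \<in> K" for t x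
      using that dist_fst_le[of "(t0, x0)" "(t, x)"] by (auto simp: K_def dist_real_def)
    then show ?thesis using K(2)
      by (intro in_stripI[of _ "t0 + 2 * \<delta>"]) (auto simp: half_plane_def)
  qed
  have AB: "\<forall>\<^sub>F e in at_right 0. A e \<subseteq> {0..t0} \<times> {-R..R}"
    using eventually_unit
  proof eventually_elim
    case (elim e)
    show ?case
    proof (safe)
      fix t x assume "(t, x) \<in> A e"
      then have z: "0 \<le> t" "t \<le> t0" "\<bar>x - r * \<theta> e t\<bar> \<le> \<delta>" by (auto simp: A_def)
      have "\<bar>r * \<theta> e t\<bar> \<le> M * t" using \<theta>_bounds[OF elim z(1)] r by (auto simp: M_def)
      also have "\<dots> \<le> M * t0" using z M by (intro mult_left_mono) auto
      finally show "t \<in> {0..t0}" "x \<in> {-R..R}" using z by (auto simp: R_def)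
    qed
  qed
  have reach: "reachable r S A"
    unfolding reachable_def using eventually_unit
  proof eventually_elim
    case (elim e)
    have "(t0, x + r * (\<theta> e t0 - \<theta> e t)) \<in> S e \<and>
        (\<forall>s\<in>closed_segment t0 t. (s, x + r * (\<theta> e s - \<theta> e t)) \<in> A e)"
      if "(t, x) \<in> A e" for t x
      using that
      by (auto simp: S_def A_def closed_segment_eq_real_ivl algebra_simps split: if_splits)
    then show ?case by blast
  qed
  have SK: "\<forall>\<^sub>F e in at_right 0. S e \<subseteq> K"
    using \<theta>_near_travel[OF \<delta>]
  proof eventually_elim
    case (elim e)
    have "\<bar>r * \<theta> e t0 - x0\<bar> \<le> \<delta>" using elim t0 r x0 by (auto simp: abs_minus_commute)
    then have "\<bar>x - x0\<bar> \<le> 2 * \<delta>" if "\<bar>x - r * \<theta> e t0\<bar> \<le> \<delta>" for x using that by linarith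
    then show ?case using t0
      by (auto simp: S_def K_def half_plane_iff dist_prod_def dist_real_def abs_minus_commute)
  qed
  have AL: "grows A p (ev ((P (- r) ^^ k) u))" for k
  proof (rule propagation[OF r strA reach])
    have p12: "p1 \<le> p" "p2 \<le> p" by (auto simp: p_def)
    from p12(2) show "grows A p (ev u)" "grows A p (ev (P r u))"
      by (rule grows_mono[OF p2(2) _ AB], rule grows_mono[OF p2(3) _ AB])
    show "grows A p (ev g)" if "g \<in> words n" for g
      by (rule n_words[OF that compact_box box_half_plane AB])
    show "grows S p (ev ((P (- r) ^^ k) u))" for k
      by (rule grows_mono[OF powers_from_regular[OF strK p1] p12(1) SK])
  qed
  have A0A: "\<forall>\<^sub>F e in at_right 0. A0 \<subseteq> A e"
    using eventually_unit
    by eventually_elim (use t0 \<theta>_0 in \<open>auto simp: A0_def A_def\<close>)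
  have str0: "in_strip (\<lambda>e. A0)" by (rule in_stripI[of _ 0]) (auto simp: A0_def)
  have r2: "r * r = 1" using r by auto
  have V: "grows (\<lambda>e. A0) p (ev ((Dx ^^ k) (Dt u)))" for k
  proof (rule velocity_from_powers[OF r2 str0])
    show "grows (\<lambda>e. A0) p (ev ((P (- r) ^^ k) u))" for k
      by (rule grows_mono[OF AL order_refl A0A])
    show "grows (\<lambda>e. A0) p (ev ((Dx ^^ k) u))" for k
      unfolding A0_def by (rule initial_value)
    show "grows (\<lambda>e. A0) p (ev g)" if "g \<in> words n" for g
      by (rule n_words[OF that compact_box[of t0 \<delta>] box_half_plane]) (use t0 in \<open>auto simp: A0_def\<close>)
  qed
  have "grows (\<lambda>e. A0) p (\<lambda>e z. nth_deriv k (scaled \<phi> e) (snd z))" for k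
  proof -
    have "grows (\<lambda>e. A0) p (\<lambda>e z. ev ((Dx ^^ k) (Dt u)) e z +
        - (ev ((Dx ^^ k) (Dt u)) e z - nth_deriv k (scaled \<phi> e) (snd z)))"
      using V[of k] initial_velocity[of \<delta> p k] unfolding A0_def by (intro grows_add grows_minus)
    then show ?thesis by simp
  qed
  then show False using mollifier_irregular[OF \<delta>] unfolding A0_def by blast
qed

end

section \<open>Representatives of generalized functions\<close>

lemma sup_on_bigo_imp_grows:
  assumes K: "compact K" and f: "\<And>e. e \<in> {0<..1} \<Longrightarrow> continuous_on K (f e)"
    and O: "(\<lambda>e. sup_on K (f e)) \<in> O[at_right 0](\<lambda>e. e powr (- p))"
  shows "grows (\<lambda>e. K) p f"
proof -
  obtain B where B: "\<forall>\<^sub>F e in at_right 0. norm (sup_on K (f e)) \<le> B * norm (e powr (- p))"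
    using O by (elim landau_o.bigE)
  show ?thesis
  proof (rule growsI_bound)
    show "\<forall>\<^sub>F e in at_right 0. \<forall>z\<in>K. \<bar>f e z\<bar> \<le> B * e powr (- p)"
      using B eventually_unit
    proof eventually_elim
      case (elim e)
      have "compact ((\<lambda>z. \<bar>f e z\<bar>) ` K)"
        using f[OF elim(2)] by (intro compact_continuous_image continuous_intros K)
      then have bdd: "bdd_above ((\<lambda>z. \<bar>f e z\<bar>) ` K)"
        by (intro bounded_imp_bdd_above compact_imp_bounded)
      show ?case
      proof
        fix z assume "z \<in> K"
        then have "\<bar>f e z\<bar> \<le> sup_on K (f e)" unfolding sup_on_def using bdd by (rule cSUP_upper)
        then show "\<bar>f e z\<bar> \<le> B * e powr (- p)" using elim(1) by simp
      qed
    qed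
  qed
qed

text \<open>The strict inequality \<open>p < q\<close> pays for the loss in \<open>grows\<close>;
  the Landau constant is then 1.\<close>

lemma grows_imp_sup_on_bigo:
  assumes K: "K \<noteq> {}" and f: "grows (\<lambda>e. K) p f" and q: "p < q"
  shows "(\<lambda>e. sup_on K (f e)) \<in> O[at_right 0](\<lambda>e. e powr (- q))"
proof (rule landau_o.bigI[of 1])
  show "\<forall>\<^sub>F e in at_right 0. norm (sup_on K (f e)) \<le> 1 * norm (e powr (- q))"
    using growsD[OF f q]
  proof eventually_elim
    case (elim e)
    have "sup_on K (f e) \<le> e powr (- q)" unfolding sup_on_def
      by (rule cSUP_least[OF K]) (use elim in auto)
    moreover obtain z where z: "z \<in> K" using K by blast
    have "\<bar>f e z\<bar> \<le> sup_on K (f e)" unfolding sup_on_def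
      by (rule cSUP_upper[OF z]) (use elim in \<open>auto intro!: bdd_aboveI2[of _ _ "e powr (- q)"]\<close>)
    then have "0 \<le> sup_on K (f e)" by linarith
    ultimately show ?case by simp
  qed
qed simp

abbreviation partials_net :: "'a::euclidean_space set \<Rightarrow> 'a list \<Rightarrow> 'a net \<Rightarrow> 'a net" where
  "partials_net X bs u \<equiv> \<lambda>e. partials_on X bs (u e)"

lemma partials_continuous:
  assumes "smooth_on X f" "K \<subseteq> X" "bs \<in> lists Basis"
  shows "continuous_on K (partials_on X bs f)"
  using assms continuous_on_subset unfolding smooth_on_alt by blast

lemma grows_empty: "grows (\<lambda>e. {}) p f"
  by (simp add: grows_def)

lemma moderate_nets_iff:
  "u \<in> moderate_nets X \<longleftrightarrow> (\<forall>e\<in>{0<..1}. smooth_on X (u e)) \<and>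
     (\<forall>K bs. compact K \<longrightarrow> K \<subseteq> X \<longrightarrow> bs \<in> lists Basis \<longrightarrow> (\<exists>p. grows (\<lambda>e. K) p (partials_net X bs u)))"
    (is "?L \<longleftrightarrow> ?R")
proof
  assume L: ?L
  show ?R
  proof (intro conjI allI impI)
    show sm: "\<forall>e\<in>{0<..1}. smooth_on X (u e)" using L by (simp add: moderate_nets_def)
    fix K bs assume *: "compact K" "K \<subseteq> X" "bs \<in> lists (Basis :: 'a set)"
    show "\<exists>p. grows (\<lambda>e. K) p (partials_net X bs u)"
    proof (cases "K = {}")
      case False
      then obtain p where "(\<lambda>e. sup_on K (partials_on X bs (u e))) \<in> O[at_right 0](\<lambda>e. e powr (- p))"
        using L * unfolding moderate_nets_def by blast
      then have "grows (\<lambda>e. K) p (partials_net X bs u)"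
        using sm * by (intro sup_on_bigo_imp_grows partials_continuous) auto
      then show ?thesis by blast
    qed (simp add: grows_empty)
  qed
next
  assume R: ?R
  show ?L unfolding moderate_nets_def
  proof (intro CollectI conjI allI impI ballI)
    fix K bs assume *: "compact K \<and> K \<subseteq> X \<and> K \<noteq> {}" "bs \<in> lists (Basis :: 'a set)"
    then obtain p where "grows (\<lambda>e. K) p (partials_net X bs u)" using R by blast
    \<comment> \<open>\<open>|p| + 1\<close> is nonnegative, as the definition demands, and strictly
      above \<open>p\<close>.\<close>
    then have "(\<lambda>e. sup_on K (partials_on X bs (u e))) \<in> O[at_right 0](\<lambda>e. e powr (- (\<bar>p\<bar> + 1)))"
      using * by (intro grows_imp_sup_on_bigo) auto
    then show "\<exists>p\<ge>0. (\<lambda>e. sup_on K (partials_on X bs (u e))) \<in> O[at_right 0](\<lambda>e. e powr (- p))"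
      by (intro exI[of _ "\<bar>p\<bar> + 1"]) simp
  qed (use R in auto)
qed

lemma negligible_nets_iff:
  "u \<in> negligible_nets X \<longleftrightarrow> (\<forall>e\<in>{0<..1}. smooth_on X (u e)) \<and>
     (\<forall>K bs p. compact K \<longrightarrow> K \<subseteq> X \<longrightarrow> bs \<in> lists Basis \<longrightarrow> grows (\<lambda>e. K) p (partials_net X bs u))"
    (is "?L \<longleftrightarrow> ?R")
proof
  assume L: ?L
  show ?R
  proof (intro conjI allI impI)
    show sm: "\<forall>e\<in>{0<..1}. smooth_on X (u e)" using L by (simp add: negligible_nets_def)
    fix K bs p assume *: "compact K" "K \<subseteq> X" "bs \<in> lists (Basis :: 'a set)"
    show "grows (\<lambda>e. K) p (partials_net X bs u)"
    proof (cases "K = {}")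
      case False
      then have "\<forall>q\<ge>0. (\<lambda>e. sup_on K (partials_on X bs (u e))) \<in> O[at_right 0](\<lambda>e. e powr q)"
        using L * unfolding negligible_nets_def by blast
      then have "(\<lambda>e. sup_on K (partials_on X bs (u e))) \<in> O[at_right 0](\<lambda>e. e powr (- (- \<bar>p\<bar>)))"
        by simp
      then have "grows (\<lambda>e. K) (- \<bar>p\<bar>) (partials_net X bs u)"
        using sm * by (intro sup_on_bigo_imp_grows partials_continuous) auto
      then show ?thesis by (rule grows_mono) auto
    qed (simp add: grows_empty)
  qed
next
  assume R: ?R
  show ?L unfolding negligible_nets_def
  proof (intro CollectI conjI allI impI ballI)
    fix K bs q assume *: "compact K \<and> K \<subseteq> X \<and> K \<noteq> {}" "bs \<in> lists (Basis :: 'a set)"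
    then have "grows (\<lambda>e. K) (- q - 1) (partials_net X bs u)" using R by blast
    then have "(\<lambda>e. sup_on K (partials_on X bs (u e))) \<in> O[at_right 0](\<lambda>e. e powr (- (- q)))"
      using * by (intro grows_imp_sup_on_bigo) auto
    then show "(\<lambda>e. sup_on K (partials_on X bs (u e))) \<in> O[at_right 0](\<lambda>e. e powr q)" by simp
  qed (use R in auto)
qed

lemma moderate_smooth: "u \<in> moderate_nets X \<Longrightarrow> e \<in> {0<..1} \<Longrightarrow> smooth_on X (u e)"
  by (simp add: moderate_nets_def)

lemma negligible_smooth: "u \<in> negligible_nets X \<Longrightarrow> e \<in> {0<..1} \<Longrightarrow> smooth_on X (u e)"
  by (simp add: negligible_nets_def)

lemma moderate_grows:
  "u \<in> moderate_nets X \<Longrightarrow> compact K \<Longrightarrow> K \<subseteq> X \<Longrightarrow> bs \<in> lists Basis \<Longrightarrow>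
    \<exists>p. grows (\<lambda>e. K) p (partials_net X bs u)"
  unfolding moderate_nets_iff by blast

lemma negligible_grows:
  "u \<in> negligible_nets X \<Longrightarrow> compact K \<Longrightarrow> K \<subseteq> X \<Longrightarrow> bs \<in> lists Basis \<Longrightarrow>
    grows (\<lambda>e. K) p (partials_net X bs u)"
  unfolding negligible_nets_iff by blast

lemma moderateI:
  assumes "\<And>e. e \<in> {0<..1} \<Longrightarrow> smooth_on X (u e)"
    and "\<And>K bs. compact K \<Longrightarrow> K \<subseteq> X \<Longrightarrow> bs \<in> lists Basis \<Longrightarrow>
       \<exists>p. grows (\<lambda>e. K) p (partials_net X bs u)"
  shows "u \<in> moderate_nets X"
  unfolding moderate_nets_iff using assms by blast

lemma negligibleI:
  assumes "\<And>e. e \<in> {0<..1} \<Longrightarrow> smooth_on X (u e)"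
    and "\<And>K bs p. compact K \<Longrightarrow> K \<subseteq> X \<Longrightarrow> bs \<in> lists Basis \<Longrightarrow>
       grows (\<lambda>e. K) p (partials_net X bs u)"
  shows "u \<in> negligible_nets X"
  unfolding negligible_nets_iff using assms by blast

lemma grows_partials_diff:
  assumes X: "direction_limits X" "K \<subseteq> X" "bs \<in> lists Basis"
    and sm: "\<And>e. e \<in> {0<..1} \<Longrightarrow> smooth_on X (u e)" "\<And>e. e \<in> {0<..1} \<Longrightarrow> smooth_on X (v e)"
    and g: "grows (\<lambda>e. K) p (partials_net X bs u)" "grows (\<lambda>e. K) p (partials_net X bs v)"
  shows "grows (\<lambda>e. K) p (partials_net X bs (\<lambda>e x. u e x - v e x))"
proof -
  have "grows (\<lambda>e. K) p (\<lambda>e z. partials_on X bs (u e) z + - partials_on X bs (v e) z)"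
    by (intro grows_add grows_minus g)
  then show ?thesis
  proof (rule grows_cong)
    show "\<forall>\<^sub>F e in at_right 0. \<forall>z\<in>K. \<bar>partials_on X bs (\<lambda>x. u e x - v e x) z\<bar>
        \<le> \<bar>partials_on X bs (u e) z + - partials_on X bs (v e) z\<bar>"
      using eventually_unit
    proof eventually_elim
      case (elim e)
      show ?case
      proof
        fix z assume "z \<in> K"
        then have "z \<in> X" using X(2) by blast
        then show "\<bar>partials_on X bs (\<lambda>x. u e x - v e x) z\<bar>
            \<le> \<bar>partials_on X bs (u e) z + - partials_on X bs (v e) z\<bar>"
          using partials_on_diff[OF X(1) sm(1)[OF elim] sm(2)[OF elim] X(3)] by simp
      qed
    qed
  qed
qed

lemma negligible_diff:
  assumes "direction_limits X" "u \<in> negligible_nets X" "v \<in> negligible_nets X"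
  shows "(\<lambda>e x. u e x - v e x) \<in> negligible_nets X"
proof (rule negligibleI)
  show "smooth_on X (\<lambda>x. u e x - v e x)" if "e \<in> {0<..1}" for e
    using assms that by (intro smooth_on_diff) (auto intro: negligible_smooth)
  show "grows (\<lambda>e. K) p (partials_net X bs (\<lambda>e x. u e x - v e x))"
    if "compact K" "K \<subseteq> X" "bs \<in> lists Basis" for K bs p
    using assms(1) that(2,3) negligible_smooth[OF assms(2)] negligible_smooth[OF assms(3)]
      negligible_grows[OF assms(2) that] negligible_grows[OF assms(3) that]
    by (rule grows_partials_diff)
qed

lemma partials_zero:
  assumes "direction_limits X" "bs \<in> lists Basis" "x \<in> X"
  shows "partials_on X bs (\<lambda>x. 0) x = 0"
  using partials_on_diff[OF assms(1) smooth_on_const smooth_on_const assms(2,3), of 0 0] assms(1)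
  by simp

lemma zero_negligible:
  assumes "direction_limits X"
  shows "(\<lambda>e x. 0) \<in> negligible_nets X"
proof (rule negligibleI)
  show "smooth_on X (\<lambda>x. 0)" by (rule smooth_on_const[OF assms])
  fix K p and bs :: "'a list" assume "K \<subseteq> X" and bs: "bs \<in> lists Basis"
  then have "\<forall>z\<in>K. partials_on X bs (\<lambda>x. 0) z = 0" using partials_zero[OF assms bs] by blast
  then show "grows (\<lambda>e. K) p (partials_net X bs (\<lambda>e x. 0))" by (simp add: grows_def)
qed

lemma equiv_colombeau_rel:
  assumes X: "direction_limits X"
  shows "equiv (moderate_nets X) (colombeau_rel X)"
proof (rule equivI)
  show "colombeau_rel X \<subseteq> moderate_nets X \<times> moderate_nets X" by (auto simp: colombeau_rel_def)
  show "refl_on (moderate_nets X) (colombeau_rel X)"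
    using zero_negligible[OF X] by (auto simp: refl_on_def colombeau_rel_def)
  show "sym (colombeau_rel X)"
  proof (rule symI)
    fix u v assume "(u, v) \<in> colombeau_rel X"
    then show "(v, u) \<in> colombeau_rel X"
      using negligible_diff[OF X zero_negligible[OF X], of "\<lambda>e x. u e x - v e x"]
      by (simp add: colombeau_rel_def)
  qed
  then have sym: "(v, u) \<in> colombeau_rel X" if "(u, v) \<in> colombeau_rel X" for u v
    using that by (auto dest: symD)
  show "trans (colombeau_rel X)"
  proof (rule transI)
    fix u v w assume uv: "(u, v) \<in> colombeau_rel X" and "(v, w) \<in> colombeau_rel X"
    then have "(w, v) \<in> colombeau_rel X" by (blast dest: sym)
    then show "(u, w) \<in> colombeau_rel X"
      using uv negligible_diff[OF X, of "\<lambda>e x. u e x - v e x" "\<lambda>e x. w e x - v e x"]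
      by (simp add: colombeau_rel_def)
  qed
qed

lemma class_self: "direction_limits X \<Longrightarrow> u \<in> moderate_nets X \<Longrightarrow> u \<in> colombeau_class X u"
  unfolding colombeau_class_def by (rule equiv_class_self[OF equiv_colombeau_rel])

lemma in_class_iff: "v \<in> colombeau_class X u \<longleftrightarrow> (u, v) \<in> colombeau_rel X"
  by (simp add: colombeau_class_def)

lemma colombeau_rel_restrict:
  assumes Y: "openin (top_of_set X) Y" and uv: "(u, v) \<in> colombeau_rel X"
  shows "(u, v) \<in> colombeau_rel Y"
proof -
  have sub: "Y \<subseteq> X" using Y openin_imp_subset by blast
  have g: "grows (\<lambda>e. K) p (partials_net Y bs w)"
    if "grows (\<lambda>e. K) p (partials_net X bs w)" "K \<subseteq> Y" "bs \<in> lists Basis" for K p bs w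
  proof (rule grows_cong[OF that(1)], intro always_eventually allI ballI)
    fix e z assume "z \<in> K"
    then have "z \<in> Y" using that(2) by blast
    then show "\<bar>partials_on Y bs (w e) z\<bar> \<le> \<bar>partials_on X bs (w e) z\<bar>"
      using partials_on_openin[OF Y _ that(3)] by simp
  qed
  have m: "w \<in> moderate_nets Y" if "w \<in> moderate_nets X" for w
  proof (rule moderateI)
    show "smooth_on Y (w e)" if "e \<in> {0<..1}" for e
      by (rule smooth_on_openin[OF Y moderate_smooth[OF \<open>w \<in> moderate_nets X\<close> that]])
    fix K and bs :: "'a list" assume K: "compact K" "K \<subseteq> Y" "bs \<in> lists Basis"
    have "K \<subseteq> X" using K sub by blast
    from moderate_grows[OF that K(1) this K(3)] g[OF _ K(2,3)]
    show "\<exists>p. grows (\<lambda>e. K) p (partials_net Y bs w)" by blast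
  qed
  have n: "w \<in> negligible_nets Y" if "w \<in> negligible_nets X" for w
  proof (rule negligibleI)
    show "smooth_on Y (w e)" if "e \<in> {0<..1}" for e
      by (rule smooth_on_openin[OF Y negligible_smooth[OF \<open>w \<in> negligible_nets X\<close> that]])
    fix K p and bs :: "'a list" assume K: "compact K" "K \<subseteq> Y" "bs \<in> lists Basis"
    have "K \<subseteq> X" using K sub by blast
    from g[OF negligible_grows[OF that K(1) this K(3)] K(2,3)]
    show "grows (\<lambda>e. K) p (partials_net Y bs w)" .
  qed
  show ?thesis using uv m n by (auto simp: colombeau_rel_def)
qed

text \<open>Equivalent representatives remain equivalent on the smaller set, so the union over all
  of them collapses to one class.\<close>

lemma g_restrict_eq_class:
  assumes X: "direction_limits X" and Y: "openin (top_of_set X) Y"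
    and U: "U \<in> colombeau X" and u: "u \<in> U"
  shows "g_restrict Y U = colombeau_class Y u"
proof -
  have DY: "direction_limits Y" by (rule direction_limits_openin[OF Y X])
  obtain w where w: "w \<in> moderate_nets X" "U = colombeau_rel X `` {w}"
    using U by (auto simp: colombeau_def elim: quotientE)
  have "colombeau_class Y v = colombeau_class Y u" if "v \<in> U" for v
  proof -
    have "(w, v) \<in> colombeau_rel X" "(w, u) \<in> colombeau_rel X" using w u that by auto
    then have "(v, u) \<in> colombeau_rel X"
      using equiv_colombeau_rel[OF X] by (meson equivE symD transD)
    then have "(v, u) \<in> colombeau_rel Y" by (rule colombeau_rel_restrict[OF Y])
    then show ?thesis unfolding colombeau_class_def
      by (rule equiv_class_eq[OF equiv_colombeau_rel[OF DY]])
  qed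
  then have "(\<Union>v\<in>U. colombeau_class Y v) = colombeau_class Y u" using u by blast
  then show ?thesis by (simp add: g_restrict_def g_pullback_def)
qed

section \<open>Moderate nets in the differential ring\<close>

definition moderate_snet :: "snet \<Rightarrow> bool" where
  "moderate_snet f \<longleftrightarrow>
     (\<forall>K bs. compact K \<longrightarrow> K \<subseteq> half_plane \<longrightarrow> bs \<in> lists Basis \<longrightarrow> (\<exists>p. grows (\<lambda>e. K) p (ev (Ds bs f))))"

lemma moderate_snetD:
  "moderate_snet f \<Longrightarrow> compact K \<Longrightarrow> K \<subseteq> half_plane \<Longrightarrow> bs \<in> lists Basis \<Longrightarrow>
    \<exists>p. grows (\<lambda>e. K) p (ev (Ds bs f))"
  by (simp add: moderate_snet_def)

lemma grows_Ds_iff: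
  assumes "smooth_net f" "bs \<in> lists Basis" "K \<subseteq> half_plane"
  shows "grows (\<lambda>e. K) p (ev (Ds bs (snet_of f))) \<longleftrightarrow> grows (\<lambda>e. K) p (partials_net half_plane bs f)"
proof -
  have "\<forall>\<^sub>F e in at_right 0. \<forall>z\<in>K. ev (Ds bs (snet_of f)) e z = partials_on half_plane bs (f e) z"
    using eventually_unit
    by eventually_elim (use ev_Ds_snet_of[OF assms(1,2)] assms(3) in blast)
  then show ?thesis
    by (auto elim!: grows_cong elim: eventually_mono)
qed

lemma moderate_half_plane_iff:
  "f \<in> moderate_nets half_plane \<longleftrightarrow> smooth_net f \<and> moderate_snet (snet_of f)"
proof (cases "smooth_net f")
  case True
  then show ?thesis
    unfolding moderate_nets_iff moderate_snet_def smooth_net_def[symmetric]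
    using grows_Ds_iff[OF True] by metis
qed (auto simp: moderate_nets_iff smooth_net_def)

lemma negligible_half_plane_grows:
  assumes "f \<in> negligible_nets half_plane" "compact K" "K \<subseteq> half_plane" "bs \<in> lists Basis"
  shows "grows (\<lambda>e. K) p (ev (Ds bs (snet_of f)))"
proof -
  have "smooth_net f" using assms(1) by (simp add: negligible_nets_def smooth_net_def)
  from grows_Ds_iff[OF this assms(4,3)] negligible_grows[OF assms] show ?thesis by blast
qed

lemma moderate_snet_D:
  assumes "moderate_snet f" "b \<in> Basis"
  shows "moderate_snet (D b f)"
  unfolding moderate_snet_def
proof (intro allI impI)
  fix K and bs :: "(real \<times> real) list"
  assume K: "compact K" "K \<subseteq> half_plane" and "bs \<in> lists Basis"
  then have "bs @ [b] \<in> lists Basis" using assms(2) by auto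
  from moderate_snetD[OF assms(1) K this]
  show "\<exists>p. grows (\<lambda>e. K) p (ev (Ds bs (D b f)))" by simp
qed

lemma grows_ev_add_max:
  assumes "grows A p (ev f)" "grows A q (ev g)"
  shows "grows A (max p q) (ev (f + g))"
  by (intro grows_ev_add grows_mono[OF assms(1)] grows_mono[OF assms(2)]) auto

lemma moderate_snet_diff:
  assumes f: "moderate_snet f" and g: "moderate_snet g"
  shows "moderate_snet (f - g)"
  unfolding moderate_snet_def
proof (intro allI impI)
  fix K and bs :: "(real \<times> real) list"
  assume *: "compact K" "K \<subseteq> half_plane" "bs \<in> lists Basis"
  obtain p where p: "grows (\<lambda>e. K) p (ev (Ds bs f))" using moderate_snetD[OF f *] by blast
  obtain q where q: "grows (\<lambda>e. K) q (ev (Ds bs g))" using moderate_snetD[OF g *] by blast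
  have "grows (\<lambda>e. K) (max p q) (ev (Ds bs f + - Ds bs g))"
    by (rule grows_ev_add_max[OF p grows_ev_minus[OF q]])
  moreover have "Ds bs (f - g) = Ds bs f + - Ds bs g"
    using Ds_add[OF *(3), of f "- g"] Ds_minus[OF *(3), of g] by simp
  ultimately show "\<exists>p. grows (\<lambda>e. K) p (ev (Ds bs (f - g)))" by metis
qed

lemma moderate_snet_mult:
  assumes "moderate_snet f" "moderate_snet g"
  shows "moderate_snet (f * g)"
proof -
  have "\<exists>p. grows (\<lambda>e. K) p (ev (Ds bs (f * g)))"
    if "bs \<in> lists Basis" "compact K" "K \<subseteq> half_plane" "moderate_snet f" "moderate_snet g" for bs K f g
    using that
  proof (induction bs arbitrary: f g rule: rev_induct)
    case Nil
    then show ?case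
      using moderate_snetD[of f K "[]"] moderate_snetD[of g K "[]"] grows_ev_mult by force
  next
    case (snoc d bs)
    then have d: "d \<in> Basis" "bs \<in> lists Basis" by auto
    have "Ds (bs @ [d]) (f * g) = Ds bs (D d f * g) + Ds bs (f * D d g)"
      using d by (simp add: D_mult Ds_add)
    moreover obtain p where "grows (\<lambda>e. K) p (ev (Ds bs (D d f * g)))"
      using snoc.IH[of "D d f" g] snoc.prems d moderate_snet_D by blast
    moreover obtain q where "grows (\<lambda>e. K) q (ev (Ds bs (f * D d g)))"
      using snoc.IH[of f "D d g"] snoc.prems d moderate_snet_D by blast
    ultimately have "grows (\<lambda>e. K) (max p q) (ev (Ds (bs @ [d]) (f * g)))"
      using grows_ev_add_max by simp
    then show ?case by blast
  qed
  then show ?thesis using assms by (simp add: moderate_snet_def)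
qed

lemma snet_of_mult:
  assumes "smooth_net f" "smooth_net g"
  shows "snet_of (\<lambda>e z. f e z * g e z) = snet_of f * snet_of g"
  using assms by (intro snet_eqI) (simp add: ev_mult ev_snet_of_apply smooth_net_mult del: greaterThanAtMost_iff)

lemma snet_of_diff:
  assumes "smooth_net f" "smooth_net g"
  shows "snet_of (\<lambda>e z. f e z - g e z) = snet_of f - snet_of g"
  using assms by (intro snet_eqI) (simp add: ev_diff ev_snet_of_apply smooth_net_diff del: greaterThanAtMost_iff)

lemma moderate_half_plane_partial:
  "f \<in> moderate_nets half_plane \<Longrightarrow> b \<in> Basis \<Longrightarrow> (\<lambda>e. partial_on half_plane b (f e)) \<in> moderate_nets half_plane"
  using D_snet_of[of b f] moderate_snet_D[of "snet_of f" b]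
  by (simp add: moderate_half_plane_iff smooth_net_partial)

lemma moderate_half_plane_mult:
  "f \<in> moderate_nets half_plane \<Longrightarrow> g \<in> moderate_nets half_plane \<Longrightarrow>
    (\<lambda>e z. f e z * g e z) \<in> moderate_nets half_plane"
  by (simp add: moderate_half_plane_iff smooth_net_mult snet_of_mult moderate_snet_mult)

lemma moderate_half_plane_diff:
  "f \<in> moderate_nets half_plane \<Longrightarrow> g \<in> moderate_nets half_plane \<Longrightarrow>
    (\<lambda>e z. f e z - g e z) \<in> moderate_nets half_plane"
  by (simp add: moderate_half_plane_iff smooth_net_diff snet_of_diff moderate_snet_diff)

text \<open>It suffices to place the net computed from given representatives in the result: the
  equations of \<open>wave_solution\<close> equate whole sets of nets, so membership transfers to
  their right sides.\<close>

lemma in_g_partial: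
  assumes "direction_limits X" "u \<in> U" "(\<lambda>e. partial_on X b (u e)) \<in> moderate_nets X"
  shows "(\<lambda>e. partial_on X b (u e)) \<in> g_partial X b U"
  unfolding g_partial_def using class_self[OF assms(1,3)] assms(2) by blast

lemma in_g_minus:
  assumes "direction_limits X" "u \<in> U" "v \<in> V" "(\<lambda>e x. u e x - v e x) \<in> moderate_nets X"
  shows "(\<lambda>e x. u e x - v e x) \<in> g_minus X U V"
  unfolding g_minus_def using class_self[OF assms(1,4)] assms(2,3) by blast

lemma in_g_times:
  assumes "direction_limits X" "u \<in> U" "v \<in> V" "(\<lambda>e x. u e x * v e x) \<in> moderate_nets X"
  shows "(\<lambda>e x. u e x * v e x) \<in> g_times X U V"
  unfolding g_times_def using class_self[OF assms(1,4)] assms(2,3) by blast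

lemma in_g_pullback:
  assumes "direction_limits Y" "u \<in> U" "(\<lambda>e y. u e (g y)) \<in> moderate_nets Y"
  shows "(\<lambda>e y. u e (g y)) \<in> g_pullback Y g U"
  unfolding g_pullback_def using class_self[OF assms(1,3)] assms(2) by blast

lemma in_g_zero_negligible:
  assumes "direction_limits X" "u \<in> g_zero X"
  shows "u \<in> negligible_nets X"
proof -
  have "(\<lambda>e x. 0 - u e x) \<in> negligible_nets X"
    using assms(2) by (simp add: g_zero_def in_class_iff colombeau_rel_def)
  from negligible_diff[OF assms(1) zero_negligible[OF assms(1)] this] show ?thesis by simp
qed

lemma colombeau_representative:
  assumes "U \<in> colombeau X" "direction_limits X"
  obtains u where "u \<in> U" "u \<in> moderate_nets X"
proof -
  obtain w where w: "w \<in> moderate_nets X" "U = colombeau_rel X `` {w}"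
    using assms(1) by (auto simp: colombeau_def elim: quotientE)
  then show ?thesis
    using that equiv_class_self[OF equiv_colombeau_rel[OF assms(2)]] by blast
qed

lemma regular_class_moderate:
  "colombeau_class X u \<in> colombeau_regular X \<Longrightarrow> u \<in> moderate_nets X"
  by (auto simp: colombeau_regular_def in_class_iff colombeau_rel_def)

text \<open>Regularity speaks of some representative. The given one differs from it by a negligible
  net, all of whose derivatives grow with every exponent, so the uniform exponent carries
  over.\<close>

lemma regular_class_grows:
  assumes X: "direction_limits X" and u: "colombeau_class X u \<in> colombeau_regular X"
    and K: "compact K" "K \<subseteq> X" "K \<noteq> {}"
  obtains p where "\<And>bs. bs \<in> lists Basis \<Longrightarrow> grows (\<lambda>e. K) p (partials_net X bs u)"
proof -
  obtain v where "v \<in> colombeau_class X u" and v: "\<forall>K. compact K \<and> K \<subseteq> X \<and> K \<noteq> {} \<longrightarrow>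
      (\<exists>p\<ge>0. \<forall>bs\<in>lists Basis.
        (\<lambda>e. sup_on K (partials_on X bs (v e))) \<in> O[at_right 0](\<lambda>e. e powr (- p)))"
    using u unfolding colombeau_regular_def by blast
  then have "(v, u) \<in> colombeau_rel X"
    using equivE[OF equiv_colombeau_rel[OF X]] symD by (metis in_class_iff)
  then have vu: "(\<lambda>e x. v e x - u e x) \<in> negligible_nets X" and vm: "v \<in> moderate_nets X"
    by (auto simp: colombeau_rel_def)
  have "\<exists>p\<ge>0. \<forall>bs\<in>lists Basis.
      (\<lambda>e. sup_on K (partials_on X bs (v e))) \<in> O[at_right 0](\<lambda>e. e powr (- p))"
    using v K by simp
  then obtain p where p: "\<And>bs. bs \<in> lists Basis \<Longrightarrow>
      (\<lambda>e. sup_on K (partials_on X bs (v e))) \<in> O[at_right 0](\<lambda>e. e powr (- p))"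
    by blast
  have "grows (\<lambda>e. K) p (partials_net X bs u)" if bs: "bs \<in> lists Basis" for bs
  proof -
    have "grows (\<lambda>e. K) p (partials_net X bs v)"
      by (rule sup_on_bigo_imp_grows[OF K(1) partials_continuous[OF moderate_smooth[OF vm] K(2) bs] p[OF bs]])
    from grows_partials_diff[OF X K(2) bs moderate_smooth[OF vm] negligible_smooth[OF vu] this
        negligible_grows[OF vu K(1,2) bs]]
    show ?thesis by simp
  qed
  then show ?thesis using that by blast
qed

lemma slow_moderate: "slow a \<Longrightarrow> moderate_snet a"
  unfolding moderate_snet_def
proof (intro allI impI)
  fix K and bs :: "(real \<times> real) list"
  assume a: "slow a" and K: "compact K" "K \<subseteq> half_plane" and bs: "bs \<in> lists Basis"
  obtain B where B: "\<And>z. z \<in> K \<Longrightarrow> norm z \<le> B"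
    using compact_imp_bounded[OF K(1)] by (auto simp: bounded_iff)
  have "K \<subseteq> strip B"
  proof
    fix z assume z: "z \<in> K"
    have "norm (fst z) \<le> B" using B[OF z] norm_fst_le[of "fst z" "snd z"] by simp
    then show "z \<in> strip B" using z K(2) by (cases z) (auto simp: strip_def half_plane_def)
  qed
  moreover have "grows (\<lambda>e. strip B) 0 (ev (Ds bs a))" using a bs unfolding slow_def by blast
  ultimately have "grows (\<lambda>e. K) 0 (ev (Ds bs a))" by (elim grows_mono) auto
  then show "\<exists>p. grows (\<lambda>e. K) p (ev (Ds bs a))" by blast
qed

lemma initial_line_moderate:
  assumes "f \<in> moderate_nets half_plane"
  shows "(\<lambda>e x. f e (0, x)) \<in> moderate_nets UNIV"
proof (rule moderateI)
  show "smooth_on UNIV (\<lambda>x. f e (0, x))" if "e \<in> {0<..1}" for e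
    by (rule smooth_on_initial_line[OF moderate_smooth[OF assms that]])
  fix K :: "real set" and bs :: "real list" assume K: "compact K" and bs: "bs \<in> lists Basis"
  have "map (Pair (0::real)) bs \<in> lists Basis"
  proof -
    have "(0::real, x) \<in> Basis" if "x \<in> set bs" for x
    proof -
      have "x = 1" using bs that by auto
      then show ?thesis using basis_x by simp
    qed
    then show ?thesis by auto
  qed
  moreover have "compact ({0} \<times> K)" "{0} \<times> K \<subseteq> half_plane"
    using K by (auto simp: half_plane_def intro: compact_Times)
  ultimately obtain p where "grows (\<lambda>e. {0} \<times> K) p (partials_net half_plane (map (Pair 0) bs) f)"
    using moderate_grows[OF assms] by blast
  then have "grows (\<lambda>e. K) p (partials_net UNIV bs (\<lambda>e x. f e (0, x)))"
    unfolding partials_on_initial_line[OF bs] by (simp add: grows_def)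
  then show "\<exists>p. grows (\<lambda>e. K) p (partials_net UNIV bs (\<lambda>e x. f e (0, x)))" by blast
qed

lemma ev_Dx_initial:
  assumes "smooth_net f" "e \<in> {0<..1}"
  shows "ev ((Dx ^^ k) (snet_of f)) e (0, x) = nth_deriv k (\<lambda>x. f e (0, x)) x"
proof -
  have bs: "replicate k (0::real, 1::real) \<in> lists Basis" by (auto simp: Basis_real2)
  have "(Dx ^^ k) (snet_of f) = Ds (replicate k (0, 1)) (snet_of f)" by (induction k) auto
  then show ?thesis
    using ev_Ds_snet_of[OF assms(1) bs assms(2), of "(0, x)"]
      partials_on_initial_line[OF replicate_in_Basis[of k], of "f e" x]
    by (simp add: half_plane_iff map_replicate)
qed

lemma (in mollified_wave) characteristics_closed: "closed characteristics"
proof -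
  have "characteristics = {z. 0 \<le> fst z} \<inter> ({z. snd z = travel c0 c1 (fst z)} \<union> {z. snd z = - travel c0 c1 (fst z)})"
    by (auto simp: characteristics_def)
  moreover have "closed \<dots>"
    by (intro closed_Int closed_Un closed_Collect_le closed_Collect_eq continuous_intros
        continuous_on_compose2[OF continuous_on_travel[of UNIV]]) auto
  ultimately show ?thesis by simp
qed

text \<open>The complement of the two curves is a candidate by
  \<open>regular_off_characteristics\<close>, and every candidate avoids the curves by
  \<open>singular_on_characteristics\<close>; hence the complement is the greatest one.\<close>

lemma (in mollified_wave) sing_supp_representative:
  assumes U: "U \<in> colombeau half_plane" "w \<in> U" and w: "w \<in> moderate_nets half_plane" "u = snet_of w"
  shows "sing_supp U = characteristics"
proof -
  note H = direction_limits_half_plane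
  have smw: "smooth_net w" using w(1) by (simp add: moderate_half_plane_iff)
  let ?O = "half_plane - characteristics"
  have grows_u: "grows (\<lambda>e. K) p (partials_net \<Omega> bs w) \<longleftrightarrow> grows (\<lambda>e. K) p (ev (Ds bs u))"
    if "openin (top_of_set half_plane) \<Omega>" "K \<subseteq> \<Omega>" "bs \<in> lists Basis" for \<Omega> K p bs
  proof -
    have "K \<subseteq> half_plane" using that openin_imp_subset by blast
    moreover have "partials_on \<Omega> bs f z = partials_on half_plane bs f z" if "z \<in> K" for f z
      using partials_on_openin[OF \<open>openin _ \<Omega>\<close> _ \<open>bs \<in> lists Basis\<close>] \<open>K \<subseteq> \<Omega>\<close> that by blast
    then have "grows (\<lambda>e. K) p (partials_net \<Omega> bs w) \<longleftrightarrow> grows (\<lambda>e. K) p (partials_net half_plane bs w)"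
      by (simp add: grows_def)
    ultimately show ?thesis using grows_Ds_iff[OF smw that(3)] w(2) by simp
  qed
  have "(GREATEST \<Omega>. openin (top_of_set half_plane) \<Omega> \<and> g_restrict \<Omega> U \<in> colombeau_regular \<Omega>) = ?O"
  proof (rule Greatest_equality)
    have op: "openin (top_of_set half_plane) ?O"
      using characteristics_closed by (auto simp: openin_open Diff_eq intro!: exI[of _ "- characteristics"])
    have DO: "direction_limits ?O" by (rule direction_limits_openin[OF op H])
    have "(w, w) \<in> colombeau_rel half_plane"
      using equiv_colombeau_rel[OF H] w(1) by (meson equivE refl_onD)
    then have wO: "w \<in> moderate_nets ?O"
      using colombeau_rel_restrict[OF op] by (force simp: colombeau_rel_def)
    have "colombeau_class ?O w \<in> colombeau ?O"
      unfolding colombeau_def colombeau_class_def by (rule quotientI[OF wO])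
    moreover have "\<exists>p\<ge>0. \<forall>bs\<in>lists Basis.
        (\<lambda>e. sup_on K (partials_on ?O bs (w e))) \<in> O[at_right 0](\<lambda>e. e powr (- p))"
      if K: "compact K" "K \<subseteq> ?O" "K \<noteq> {}" for K
    proof -
      obtain p where p: "p \<ge> 0" "\<And>bs. bs \<in> lists Basis \<Longrightarrow> grows (\<lambda>e. K) p (ev (Ds bs u))"
        using regular_off_characteristics[OF K] by blast
      have "(\<lambda>e. sup_on K (partials_on ?O bs (w e))) \<in> O[at_right 0](\<lambda>e. e powr (- (p + 1)))"
        if "bs \<in> lists Basis" for bs
        using grows_u[OF op K(2) that] p(2)[OF that] by (intro grows_imp_sup_on_bigo K(3)) auto
      then show ?thesis using p(1) by (intro exI[of _ "p + 1"]) auto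
    qed
    ultimately have "colombeau_class ?O w \<in> colombeau_regular ?O"
      unfolding colombeau_regular_def using class_self[OF DO wO] by blast
    then show "openin (top_of_set half_plane) ?O \<and> g_restrict ?O U \<in> colombeau_regular ?O"
      using op g_restrict_eq_class[OF H op U] by simp
  next
    fix \<Omega> assume \<Omega>: "openin (top_of_set half_plane) \<Omega> \<and> g_restrict \<Omega> U \<in> colombeau_regular \<Omega>"
    note op = conjunct1[OF \<Omega>]
    have cl: "colombeau_class \<Omega> w \<in> colombeau_regular \<Omega>"
      using conjunct2[OF \<Omega>] g_restrict_eq_class[OF H op U] by simp
    have reg: "\<exists>p. \<forall>bs\<in>lists Basis. grows (\<lambda>e. K) p (ev (Ds bs u))"
      if K: "compact K" "K \<subseteq> \<Omega>" "K \<noteq> {}" for K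
    proof -
      obtain p where "\<And>bs. bs \<in> lists Basis \<Longrightarrow> grows (\<lambda>e. K) p (partials_net \<Omega> bs w)"
        using regular_class_grows[OF direction_limits_openin[OF op H] cl K] by blast
      then show ?thesis using grows_u[OF op K(2)] by blast
    qed
    show "\<Omega> \<le> ?O"
    proof
      fix z assume z: "z \<in> \<Omega>"
      have "z \<notin> characteristics"
      proof
        assume "z \<in> characteristics"
        then obtain t r where zt: "z = (t, r * travel c0 c1 t)" "0 \<le> t" "r = 1 \<or> r = -1"
          unfolding characteristics_def by force
        show False
          using singular_on_characteristics[OF zt(3,2) refl op _ reg] z zt(1) by blast
      qed
      then show "z \<in> ?O" using z openin_imp_subset[OF op] by blast
    qed
  qed
  then have "sing_supp U = half_plane - ?O" by (simp add: sing_supp_def)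
  also have "\<dots> = characteristics" by (auto simp: characteristics_def half_plane_def)
  finally show ?thesis .
qed

theorem theorem5p1:
  fixes c0 c1 N :: real and \<phi> h :: "real \<Rightarrow> real"
    and C :: "real net set" and U :: "(real \<times> real) net set"
  assumes "c0 > 0" and "c1 > 0" and "c0 \<noteq> c1"
    and "admissible_mollifier \<phi>"
    and "\<forall>\<epsilon>\<in>{0<..1}. h \<epsilon> > 0"
    and "(h \<longlongrightarrow> 0) (at_right 0)"
    and "N \<ge> 0" and "(\<lambda>\<epsilon>. 1 / h \<epsilon>) \<in> O[at_right 0](\<lambda>\<epsilon>. \<epsilon> powr (- N))"
    and "C = colombeau_class UNIV (\<lambda>\<epsilon>. convolve (jump_speed c0 c1) (scaled \<phi> (h \<epsilon>)))"
    and "wave_solution (g_pullback half_plane fst C)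
           (g_zero UNIV) (colombeau_class UNIV (\<lambda>\<epsilon>. scaled \<phi> \<epsilon>)) U"
    and "C \<in> colombeau_regular UNIV"
  shows "sing_supp U =
    {(t, x). t \<ge> 0 \<and> (x = integral {0..t} (jump_speed c0 c1) \<or>
                       x = - integral {0..t} (jump_speed c0 c1))}"
proof -
  note \<phi> = assms(4) and H = direction_limits_half_plane and R = direction_limits_UNIV
  define cn where "cn e = convolve (jump_speed c0 c1) (scaled \<phi> (h e))" for e
  have cn: "cn e = molli_speed c0 c1 \<phi> (h e)" if "e \<in> {0<..1}" for e
    unfolding cn_def using assms(5) that by (intro convolve_jump_speed[OF \<phi>]) auto
  have C: "C = colombeau_class UNIV cn" using assms(9) by (simp add: cn_def[abs_def])
  note reg_cn = assms(11)[unfolded C]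
  have cn_mod: "cn \<in> moderate_nets UNIV" by (rule regular_class_moderate[OF reg_cn])
  \<comment> \<open>The compact set \<open>{0..2}\<close> contains the zone around time 1 in which
    the speed varies, once \<open>h\<close> is below 1.\<close>
  obtain p where p: "\<And>bs. bs \<in> lists Basis \<Longrightarrow> grows (\<lambda>e. {0..2}) p (partials_net UNIV bs cn)"
    by (rule regular_class_grows[OF R reg_cn, of "{0..2}"]) auto
  have reg: "grows (\<lambda>e. {0..2}) p (\<lambda>e. partials_on UNIV bs (molli_speed c0 c1 \<phi> (h e)))"
    if "bs \<in> lists Basis" for bs
    by (rule grows_cong[OF p[OF that]]) (rule eventually_mono[OF eventually_unit], simp add: cn)
  interpret mollified_speed c0 c1 \<phi> h
  proof
    show "smooth_on UNIV (molli_speed c0 c1 \<phi> (h e))" if "e \<in> {0<..1}" for e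
      using moderate_smooth[OF cn_mod that] cn[OF that] by simp
    show "\<forall>\<^sub>F e in at_right 0. 1 / h e \<le> e powr (- d)" if "0 < d" for d
      by (rule slow_scale_of_regular_speed[OF \<phi> assms(5,6,3) reg that])
  qed (use assms in auto)

  obtain w where w: "w \<in> U" "w \<in> moderate_nets half_plane"
    using colombeau_representative[OF _ H] assms(10) unfolding wave_solution_def by blast
  have smw: "smooth_net w" and mw: "moderate_snet (snet_of w)"
    using w(2) by (auto simp: moderate_half_plane_iff)

  \<comment> \<open>The pullback of the representative of \<open>C\<close>; for parameters in
    \<open>{0<..1}\<close> it coincides with the ring element \<open>c\<close>.\<close>
  let ?cf = "\<lambda>e z. cn e (fst z) :: real"
  have smc: "smooth_net ?cf" by (rule smooth_net_time[OF moderate_smooth[OF cn_mod]])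
  have sc: "snet_of ?cf = c"
  proof (rule snet_eqI)
    fix e :: real and z :: "real \<times> real" assume *: "e \<in> {0<..1}" "z \<in> half_plane"
    then show "ev (snet_of ?cf) e z = ev c e z"
      using ev_c[of e "fst z" "snd z"] ev_snet_of_apply[OF smc *]
      by (simp add: cn cc_def half_plane_def mem_Times_iff del: greaterThanAtMost_iff)
  qed
  have cf: "?cf \<in> moderate_nets half_plane"
    by (simp add: moderate_half_plane_iff smc sc slow_moderate slow_c)

  have mt: "(\<lambda>e. partial_t (w e)) \<in> moderate_nets half_plane"
    and mx: "(\<lambda>e. partial_x (w e)) \<in> moderate_nets half_plane"
    using w(2) by (auto intro: moderate_half_plane_partial basis_t basis_x)
  have mtt: "(\<lambda>e. partial_t (partial_t (w e))) \<in> moderate_nets half_plane"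
    and mxx: "(\<lambda>e. partial_x (partial_x (w e))) \<in> moderate_nets half_plane"
    by (rule moderate_half_plane_partial[OF mt basis_t], rule moderate_half_plane_partial[OF mx basis_x])
  note wt = in_g_partial[OF H w(1) mt] and wx = in_g_partial[OF H w(1) mx]
  note wtt = in_g_partial[OF H wt mtt] and wxx = in_g_partial[OF H wx mxx]
  have cn_C: "cn \<in> C" unfolding C by (rule class_self[OF R cn_mod])
  note cf_in = in_g_pullback[OF H cn_C cf]
  note mcc = moderate_half_plane_mult[OF cf cf]
  note cc_in = in_g_times[OF H cf_in cf_in mcc]
  note mccxx = moderate_half_plane_mult[OF mcc mxx]
  note ccxx_in = in_g_times[OF H cc_in wxx mccxx]
  note mn = moderate_half_plane_diff[OF mtt mccxx]
  \<comment> \<open>A representative of the left side of the equation, hence negligible; as a ring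
    element it is the residual \<open>n\<close> of the locale.\<close>
  define nn where "nn = (\<lambda>e z. partial_t (partial_t (w e)) z
     - cn e (fst z) * cn e (fst z) * partial_x (partial_x (w e)) z)"
  have "nn \<in> g_zero half_plane"
    using in_g_minus[OF H wtt ccxx_in mn] assms(10) unfolding nn_def wave_solution_def by simp
  then have nn: "nn \<in> negligible_nets half_plane" by (rule in_g_zero_negligible[OF H])
  have sm: "smooth_net f" if "f \<in> moderate_nets half_plane" for f
    using that by (simp add: moderate_half_plane_iff)
  have snn: "snet_of nn = Dt (Dt (snet_of w)) - c * c * Dx (Dx (snet_of w))"
    unfolding nn_def
    by (simp only: snet_of_diff[OF sm[OF mtt] sm[OF mccxx]] snet_of_mult[OF sm[OF mcc] sm[OF mxx]]
        snet_of_mult[OF smc smc] sc D_snet_of[OF basis_t smw] D_snet_of[OF basis_t sm[OF mt]]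
        D_snet_of[OF basis_x smw] D_snet_of[OF basis_x sm[OF mx]])

  have "(\<lambda>e x. w e (0, x)) \<in> g_zero UNIV"
    using in_g_pullback[OF R w(1) initial_line_moderate[OF w(2)]] assms(10)
    unfolding wave_solution_def by simp
  then have w0: "(\<lambda>e x. w e (0, x)) \<in> negligible_nets UNIV" by (rule in_g_zero_negligible[OF R])
  let ?wt0 = "\<lambda>e x. partial_t (w e) (0, x)"
  have "?wt0 \<in> colombeau_class UNIV (\<lambda>e. scaled \<phi> e)"
    using in_g_pullback[OF R wt initial_line_moderate[OF mt]] assms(10)
    unfolding wave_solution_def by simp
  \<comment> \<open>Class membership yields the difference in this order. The locale states it with
    the opposite sign, which the absolute value does not see.\<close>
  then have w1: "(\<lambda>e x. scaled \<phi> e x - ?wt0 e x) \<in> negligible_nets UNIV"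
    and sm\<phi>: "scaled \<phi> \<in> moderate_nets UNIV" and smw1: "?wt0 \<in> moderate_nets UNIV"
    by (auto simp: in_class_iff colombeau_rel_def)

  interpret mollified_wave c0 c1 \<phi> h "snet_of w"
  proof
    show "\<exists>p. grows (\<lambda>e. K) p (ev (Ds bs (snet_of w)))"
      if "compact K" "K \<subseteq> half_plane" "bs \<in> lists Basis" for K bs
      by (rule moderate_snetD[OF mw that])
    show "grows (\<lambda>e. K) p (ev (Ds bs (Dt (Dt (snet_of w)) - c * c * Dx (Dx (snet_of w)))))"
      if "compact K" "K \<subseteq> half_plane" "bs \<in> lists Basis" for K bs p
      using negligible_half_plane_grows[OF nn that] snn by simp
    show "grows (\<lambda>e. {0} \<times> {-B..B}) p (ev ((Dx ^^ k) (snet_of w)))" for B k p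
    proof (rule grows_cong)
      show "grows (\<lambda>e. {0} \<times> {-B..B}) p (\<lambda>e z. nth_deriv k (\<lambda>x. w e (0, x)) (snd z))"
        using negligible_grows[OF w0, of "{-B..B}", OF _ _ replicate_in_Basis] by (simp add: grows_def)
      show "\<forall>\<^sub>F e in at_right 0. \<forall>z\<in>{0} \<times> {-B..B}. \<bar>ev ((Dx ^^ k) (snet_of w)) e z\<bar>
          \<le> \<bar>nth_deriv k (\<lambda>x. w e (0, x)) (snd z)\<bar>"
        using eventually_unit by eventually_elim (auto simp: ev_Dx_initial[OF smw] simp del: greaterThanAtMost_iff)
    qed
    show "grows (\<lambda>e. {0} \<times> {-B..B}) p
       (\<lambda>e z. ev ((Dx ^^ k) (Dt (snet_of w))) e z - nth_deriv k (scaled \<phi> e) (snd z))" for B k p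
    proof (rule grows_cong)
      show "grows (\<lambda>e. {0} \<times> {-B..B}) p (\<lambda>e z. nth_deriv k (\<lambda>x. scaled \<phi> e x - ?wt0 e x) (snd z))"
        using negligible_grows[OF w1, of "{-B..B}", OF _ _ replicate_in_Basis] by (simp add: grows_def)
      show "\<forall>\<^sub>F e in at_right 0. \<forall>z\<in>{0} \<times> {-B..B}.
          \<bar>ev ((Dx ^^ k) (Dt (snet_of w))) e z - nth_deriv k (scaled \<phi> e) (snd z)\<bar>
          \<le> \<bar>nth_deriv k (\<lambda>x. scaled \<phi> e x - ?wt0 e x) (snd z)\<bar>"
        using eventually_unit
      proof eventually_elim
        case (elim e)
        have "ev ((Dx ^^ k) (Dt (snet_of w))) e (0, x) = nth_deriv k (?wt0 e) x" for x
          unfolding D_snet_of[OF basis_t smw] by (rule ev_Dx_initial[OF sm[OF mt] elim])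
        moreover have "nth_deriv k (\<lambda>x. scaled \<phi> e x - ?wt0 e x) x =
            nth_deriv k (scaled \<phi> e) x - nth_deriv k (?wt0 e) x" for x
          by (rule partials_on_diff[OF R moderate_smooth[OF sm\<phi> elim] moderate_smooth[OF smw1 elim]
              replicate_in_Basis UNIV_I])
        ultimately show ?case by auto
      qed
    qed
  qed
  have "sing_supp U = characteristics"
    using assms(10) w by (intro sing_supp_representative[OF _ w(1,2) refl]) (simp add: wave_solution_def)
  moreover have "integral {0..t} (jump_speed c0 c1) = travel c0 c1 t" if "0 \<le> t" for t
    by (rule integral_unique[OF jump_speed_has_integral[OF that]])
  then have "characteristics = {(t, x). t \<ge> 0 \<and> (x = integral {0..t} (jump_speed c0 c1) \<or>
                       x = - integral {0..t} (jump_speed c0 c1))}"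
    by (auto simp: characteristics_def)
  ultimately show ?thesis by simp
qed

end
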